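(* Let $f$ be a Dirichlet series mapping $\mathbb{C}_0$ to $\mathbb{D}$. Then \[\lim_{T\to\infty} \left|N_f(\xi,T) - \frac{1}{2T}\int_{-T}^T \log|f_\xi(i\tau)| \,d\tau -\log\left|\frac{1-\overline{\xi}f(+\infty)}{\xi-f(+\infty)}\right|\right|=0\] for quasi-every $\xi$ in $\mathbb{D}\setminus\{f(+\infty)\}$.
   Context: $\mathbb{C}_\kappa=\{s:\mathrm{Re}\,s>\kappa\}$ and $\mathbb{D}$ is the open unit disc. A "Dirichlet series mapping $\mathbb{C}_0$ to $\mathbb{D}$" is an analytic function $f:\mathbb{C}_0\to\mathbb{D}$ which is represented by a Dirichlet series $\sum_{n\ge1}a_nn^{-s}$ converging in $\mathbb{C}_\kappa$ for some $\kappa>0$; we write $f(+\infty)=a_1$. For $\xi\in\mathbb{D}$ the Frostman shift is $f_\xi(s)=\frac{\xi-f(s)}{1-\overline{\xi}f(s)}$, and $f_\xi(i\tau)=\lim_{\sigma\to0^+}f_\xi(\sigma+i\tau)$ denotes its boundary value (existing for a.e. $\tau\in\mathbb{R}$). For $T>0$, $N_f(\xi,T)=\frac{\pi}{T}\sum \mathrm{Re}\,s$, the sum over all $s\in\mathbb{C}_0$ with $f(s)=\xi$ and $|\mathrm{Im}\,s|<T$, counted with multiplicity. "Quasi-every" means for all $\xi$ outside a set of logarithmic capacity zero. *)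

theory Defs
  imports "HOL-Complex_Analysis.Complex_Analysis"
begin

definition halfplane :: "real \<Rightarrow> complex set" where
  "halfplane \<kappa> = {s. Re s > \<kappa>}"

definition dirichlet_series_map :: "(complex \<Rightarrow> complex) \<Rightarrow> (nat \<Rightarrow> complex) \<Rightarrow> bool" where
  "dirichlet_series_map f a \<longleftrightarrow>
     f analytic_on halfplane 0 \<and> f ` halfplane 0 \<subseteq> ball 0 1 \<and>
     (\<exists>\<kappa>>0. \<forall>s\<in>halfplane \<kappa>.
        (\<lambda>n. a (Suc n) * of_nat (Suc n) powr (- s)) sums f s)"

definition frostman :: "(complex \<Rightarrow> complex) \<Rightarrow> complex \<Rightarrow> complex \<Rightarrow> complex" where
  "frostman f \<xi> s = (\<xi> - f s) / (1 - cnj \<xi> * f s)"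

definition boundary_value :: "(complex \<Rightarrow> complex) \<Rightarrow> real \<Rightarrow> complex" where
  "boundary_value g \<tau> = Lim (at_right 0) (\<lambda>\<sigma>. g (Complex \<sigma> \<tau>))"

definition N_count :: "(complex \<Rightarrow> complex) \<Rightarrow> complex \<Rightarrow> real \<Rightarrow> real" where
  "N_count f \<xi> T = pi / T *
     (\<Sum>\<^sub>\<infinity> s \<in> {s. Re s > 0 \<and> \<bar>Im s\<bar> < T \<and> f s = \<xi>}.
        of_int (zorder (\<lambda>z. f z - \<xi>) s) * Re s)"

definition log_kernel_neg :: "complex \<Rightarrow> complex \<Rightarrow> ennreal" where
  "log_kernel_neg z w = (if z = w then \<infinity> else ennreal (- ln (cmod (z - w))))"

text \<open>Polar sets (sets of logarithmic capacity zero), following Ransford: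
  E is polar iff the energy I(mu) = \<integral>\<integral> log|z-w| dmu dmu equals -infinity for every
  finite nonzero Borel measure mu whose support is a compact subset of E.
  For compactly supported finite mu the positive part of the energy integral is finite,
  so I(mu) = -infinity is exactly the divergence of the integral of the negative part.\<close>
definition polar :: "complex set \<Rightarrow> bool" where
  "polar E \<longleftrightarrow>
     (\<forall>M :: complex measure. \<forall>K.
        sets M = sets borel \<and> finite_measure M \<and> emeasure M (space M) \<noteq> 0 \<and>
        compact K \<and> K \<subseteq> E \<and> emeasure M (UNIV - K) = 0 \<longrightarrow>
        (\<integral>\<^sup>+ z. (\<integral>\<^sup>+ w. log_kernel_neg z w \<partial>M) \<partial>M) = \<infinity>)"

end

theory Submission
  imports Defs "HOL-Real_Asymp.Real_Asymp"
begin

text \<open>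
  Write \<open>F\<close> for the Frostman shift \<open>f\<^sub>\<xi>\<close>. Green's identity for \<open>ln |F|\<close> on rectangles with left side
  \<open>Re s = \<sigma>\<close>, tested against \<open>(Re s - \<sigma>) B(Im s)\<close> with \<open>B\<close> a smoothed indicator function of \<open>[-T, T]\<close>,
  gives Littlewood's formula up to an error \<open>\<epsilon> T + O(1)\<close> uniformly in \<open>\<sigma>\<close>: the right side contributes
  \<open>ln |F(+\<infinity>)|\<close>, since \<open>f - a\<^sub>1\<close> decays exponentially. It remains to let \<open>\<sigma>\<close> tend to \<open>0\<close> in
  the integral of \<open>ln |F(\<sigma> + i\<tau>)|\<close>. Along a sequence this is possible, by Scheffe's lemma, as soon as
  the weighted integrals of \<open>- ln |F|\<close> do not exceed that of the boundary values in the lower limit. The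
  exceptional \<open>\<xi>\<close> form a polar set by an argument of Frostman: against a measure of finite
  logarithmic energy, the Green potentials of the push-forwards of the weight converge.
\<close>

section \<open>Green's identity on a rectangle\<close>

text \<open>At fixed \<open>T\<close> the left side is moved to the imaginary axis first, and only
  then does \<open>T\<close> grow; so errors must be uniform in the position of the left side, while
  whatever stays bounded in \<open>T\<close> is removed by the division by \<open>2 * T\<close>. A
  sharp cut-off at height \<open>T\<close> would leave derivatives of \<open>ln |F|\<close> on the
  horizontal sides, with no control near the axis. A smooth \<open>B\<close> turns them into an
  integral of \<open>- ln |F|\<close> times \<open>Re s - \<sigma>\<close> over two strips of fixed
  height, and Green's identity with a second, trigonometric test function bounds that integral by a
  constant. The obstacle at the axis is loss of mass: Fatou's lemma gives one inequality only, and
  for \<open>exp (- 1 / s)\<close> the boundary modulus is 1 although the integrals of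
  \<open>- ln |F|\<close> along vertical lines do not tend to 0. For this reason some
  \<open>\<xi>\<close> have to be excluded. The weight \<open>1 / (1 + \<tau>\<^sup>2)\<close> has
  finite mass and is bounded below on every bounded interval, so that one exceptional set serves all
  \<open>T\<close>.\<close>

lemma green_rectangle_smooth:
  fixes h hx hxx hy hyy :: "real \<Rightarrow> real \<Rightarrow> real" and A A' A'' B B' B'' :: "real \<Rightarrow> real"
  assumes le: "a \<le> b" "c \<le> d"
    and dx: "\<And>x y. x \<in> {a..b} \<Longrightarrow> y \<in> {c..d} \<Longrightarrow> ((\<lambda>x. h x y) has_real_derivative hx x y) (at x)"
    and dxx: "\<And>x y. x \<in> {a..b} \<Longrightarrow> y \<in> {c..d} \<Longrightarrow> ((\<lambda>x. hx x y) has_real_derivative hxx x y) (at x)"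
    and dy: "\<And>x y. x \<in> {a..b} \<Longrightarrow> y \<in> {c..d} \<Longrightarrow> ((\<lambda>y. h x y) has_real_derivative hy x y) (at y)"
    and dyy: "\<And>x y. x \<in> {a..b} \<Longrightarrow> y \<in> {c..d} \<Longrightarrow> ((\<lambda>y. hy x y) has_real_derivative hyy x y) (at y)"
    and ch: "continuous_on (cbox (a,c) (b,d)) (\<lambda>z. h (fst z) (snd z))"
    and chxx: "continuous_on (cbox (a,c) (b,d)) (\<lambda>z. hxx (fst z) (snd z))"
    and chyy: "continuous_on (cbox (a,c) (b,d)) (\<lambda>z. hyy (fst z) (snd z))"
    and dA: "\<And>x. (A has_real_derivative A' x) (at x)" "\<And>x. (A' has_real_derivative A'' x) (at x)"
    and dB: "\<And>x. (B has_real_derivative B' x) (at x)" "\<And>x. (B' has_real_derivative B'' x) (at x)"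
    and cA: "continuous_on UNIV A''" and cB: "continuous_on UNIV B''"
    and A0: "A a = 0" and B0: "B c = 0" "B d = 0" "B' c = 0" "B' d = 0"
  shows "integral (cbox (a,c) (b,d)) (\<lambda>z. h (fst z) (snd z) * (A'' (fst z) * B (snd z) + A (fst z) * B'' (snd z))) =
    integral {c..d} (\<lambda>y. (h b y * A' b - hx b y * A b - h a y * A' a) * B y)
    + integral (cbox (a,c) (b,d)) (\<lambda>z. (hxx (fst z) (snd z) + hyy (fst z) (snd z)) * (A (fst z) * B (snd z)))"
proof -
  have cont: "continuous_on S A" "continuous_on S B" "continuous_on S A''" "continuous_on S B''" for S
    using DERIV_continuous_on[OF has_field_derivative_at_within[OF dA(1)]] DERIV_continuous_on[OF has_field_derivative_at_within[OF dB(1)]]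
      continuous_on_subset[OF cA] continuous_on_subset[OF cB] by auto
  note ci = continuous_intros continuous_on_compose2[OF cont(1)[of UNIV]] continuous_on_compose2[OF cont(2)[of UNIV]]
     continuous_on_compose2[OF cont(3)[of UNIV]] continuous_on_compose2[OF cont(4)[of UNIV]] ch chxx chyy
  \<comment> \<open>\<open>h A'' - h_xx A\<close> is the x-derivative of
    \<open>h A' - h_x A\<close>, and likewise in y, so each half of Green's identity is the
    fundamental theorem of calculus in one variable. \<open>A a = 0\<close> removes
    \<open>h_x\<close> from the left side; \<open>B\<close> and \<open>B'\<close> vanish at both
    ends, so the horizontal sides give nothing.\<close>
  let ?P = "\<lambda>x y. (h x y * A'' x - hxx x y * A x) * B y"
  let ?Q = "\<lambda>x y. (h x y * B'' y - hyy x y * B y) * A x"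
  have cP: "continuous_on (cbox (a,c) (b,d)) (\<lambda>z. ?P (fst z) (snd z))"
    by (intro ci) auto
  have cQ: "continuous_on (cbox (a,c) (b,d)) (\<lambda>z. ?Q (fst z) (snd z))"
    by (intro ci) auto
  have cR: "continuous_on (cbox (a,c) (b,d)) (\<lambda>z. (hxx (fst z) (snd z) + hyy (fst z) (snd z)) * (A (fst z) * B (snd z)))"
    by (intro ci) auto
  have i1: "integral {a..b} (\<lambda>x. ?P x y) = (h b y * A' b - hx b y * A b - h a y * A' a) * B y"
    if y: "y \<in> {c..d}" for y
  proof -
    have "((\<lambda>x. ?P x y) has_integral ((h b y * A' b - hx b y * A b) * B y - (h a y * A' a - hx a y * A a) * B y)) {a..b}"
    proof (intro fundamental_theorem_of_calculus le)
      fix x assume "x \<in> {a..b}"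
      then have "((\<lambda>x. (h x y * A' x - hx x y * A x) * B y) has_real_derivative ?P x y) (at x)"
        using dx[of x y] dxx[of x y] dA y by (auto intro!: derivative_eq_intros simp: algebra_simps)
      then show "((\<lambda>x. (h x y * A' x - hx x y * A x) * B y) has_vector_derivative ?P x y) (at x within {a..b})"
        using has_field_derivative_at_within has_real_derivative_iff_has_vector_derivative by blast
    qed
    then show ?thesis using A0 by (simp add: integral_unique algebra_simps)
  qed
  have i2: "integral {c..d} (\<lambda>y. ?Q x y) = 0" if x: "x \<in> {a..b}" for x
  proof -
    have "((\<lambda>y. ?Q x y) has_integral ((h x d * B' d - hy x d * B d) * A x - (h x c * B' c - hy x c * B c) * A x)) {c..d}"
    proof (intro fundamental_theorem_of_calculus le)
      fix y assume "y \<in> {c..d}"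
      then have "((\<lambda>y. (h x y * B' y - hy x y * B y) * A x) has_real_derivative ?Q x y) (at y)"
        using dy[of x y] dyy[of x y] dB x by (auto intro!: derivative_eq_intros simp: algebra_simps)
      then show "((\<lambda>y. (h x y * B' y - hy x y * B y) * A x) has_vector_derivative ?Q x y) (at y within {c..d})"
        using has_field_derivative_at_within has_real_derivative_iff_has_vector_derivative by blast
    qed
    then show ?thesis using B0 by (simp add: integral_unique algebra_simps)
  qed
  have "integral (cbox (a,c) (b,d)) (\<lambda>z. ?P (fst z) (snd z)) = integral {a..b} (\<lambda>x. integral {c..d} (?P x))"
    using integral_prod_continuous[OF cP] by simp
  also have "\<dots> = integral {c..d} (\<lambda>y. integral {a..b} (\<lambda>x. ?P x y))"
    using integral_swap_continuous[of a c b d ?P] cP by (simp add: case_prod_unfold)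
  also have "\<dots> = integral {c..d} (\<lambda>y. (h b y * A' b - hx b y * A b - h a y * A' a) * B y)"
    by (rule integral_cong) (rule i1)
  finally have 1: "integral (cbox (a,c) (b,d)) (\<lambda>z. ?P (fst z) (snd z)) = integral {c..d} (\<lambda>y. (h b y * A' b - hx b y * A b - h a y * A' a) * B y)" .
  have "integral (cbox (a,c) (b,d)) (\<lambda>z. ?Q (fst z) (snd z)) = integral {a..b} (\<lambda>x. integral {c..d} (?Q x))"
    using integral_prod_continuous[OF cQ] by simp
  also have "\<dots> = integral {a..b} (\<lambda>x. 0)"
    by (rule integral_cong) (rule i2)
  finally have 2: "integral (cbox (a,c) (b,d)) (\<lambda>z. ?Q (fst z) (snd z)) = 0" by simp
  have "integral (cbox (a,c) (b,d)) (\<lambda>z. h (fst z) (snd z) * (A'' (fst z) * B (snd z) + A (fst z) * B'' (snd z)))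
    = integral (cbox (a,c) (b,d)) (\<lambda>z. (?P (fst z) (snd z) + ?Q (fst z) (snd z)) + (hxx (fst z) (snd z) + hyy (fst z) (snd z)) * (A (fst z) * B (snd z)))"
    by (intro integral_cong) (simp add: algebra_simps)
  also have "\<dots> = integral (cbox (a,c) (b,d)) (\<lambda>z. ?P (fst z) (snd z) + ?Q (fst z) (snd z)) + 
     integral (cbox (a,c) (b,d)) (\<lambda>z. (hxx (fst z) (snd z) + hyy (fst z) (snd z)) * (A (fst z) * B (snd z)))"
    by (intro Henstock_Kurzweil_Integration.integral_add integrable_continuous continuous_on_add cP cQ cR)
  also have "integral (cbox (a,c) (b,d)) (\<lambda>z. ?P (fst z) (snd z) + ?Q (fst z) (snd z)) = 
     integral (cbox (a,c) (b,d)) (\<lambda>z. ?P (fst z) (snd z)) + integral (cbox (a,c) (b,d)) (\<lambda>z. ?Q (fst z) (snd z))"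
    by (intro Henstock_Kurzweil_Integration.integral_add integrable_continuous cP cQ)
  finally show ?thesis by (simp add: 1 2)
qed

text \<open>By the Cauchy-Riemann equations the second derivatives of \<open>Re g\<close> are
  \<open>Re g''\<close> in x and \<open>- Re g''\<close> in y, so the Laplacian term of the smooth
  identity cancels.\<close>

lemma green_rectangle_holomorphic:
  fixes g :: "complex \<Rightarrow> complex"
  assumes le: "a \<le> b" "c \<le> d"
    and g: "open U" "g holomorphic_on U" "\<And>x y. x \<in> {a..b} \<Longrightarrow> y \<in> {c..d} \<Longrightarrow> Complex x y \<in> U"
    and dA: "\<And>x. (A has_real_derivative A' x) (at x)" "\<And>x. (A' has_real_derivative A'' x) (at x)"
    and dB: "\<And>x. (B has_real_derivative B' x) (at x)" "\<And>x. (B' has_real_derivative B'' x) (at x)"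
    and cA: "continuous_on UNIV A''" and cB: "continuous_on UNIV B''"
    and A0: "A a = 0" and B0: "B c = 0" "B d = 0" "B' c = 0" "B' d = 0"
  shows "integral (cbox (a,c) (b,d)) (\<lambda>z. Re (g (Complex (fst z) (snd z))) * (A'' (fst z) * B (snd z) + A (fst z) * B'' (snd z))) =
    integral {c..d} (\<lambda>y. (Re (g (Complex b y)) * A' b - Re (deriv g (Complex b y)) * A b - Re (g (Complex a y)) * A' a) * B y)"
proof -
  have g': "deriv g holomorphic_on U" "deriv (deriv g) holomorphic_on U"
    using g by (auto intro: holomorphic_deriv)
  have dX: "((\<lambda>x. Re (k (Complex x y))) has_real_derivative Re (deriv k (Complex x y))) (at x)"
    and dY: "((\<lambda>y. Re (k (Complex x y))) has_real_derivative - Im (deriv k (Complex x y))) (at y)"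
    and dY2: "((\<lambda>y. - Im (k (Complex x y))) has_real_derivative - Re (deriv k (Complex x y))) (at y)"
    if "k holomorphic_on U" "x \<in> {a..b}" "y \<in> {c..d}" for k x y
  proof -
    have k: "(k has_field_derivative deriv k (Complex x y)) (at (Complex x y))"
      using that g by (simp add: holomorphic_derivI)
    have "((\<lambda>x. k (Complex x y)) has_vector_derivative deriv k (Complex x y) * 1) (at x)"
      unfolding has_vector_derivative_def
      by (rule has_derivative_eq_rhs[OF has_derivative_compose[where f = "\<lambda>x. Complex x y" and f' = "\<lambda>h. Complex h 0" and g = k and g' = "(*) (deriv k (Complex x y))"]])
         (auto simp: Complex_eq scaleR_conv_of_real intro!: derivative_eq_intros k[unfolded has_field_derivative_def Complex_eq])
    then show "((\<lambda>x. Re (k (Complex x y))) has_real_derivative Re (deriv k (Complex x y))) (at x)"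
      unfolding has_real_derivative_iff_has_vector_derivative
      by (auto dest: bounded_linear.has_vector_derivative[OF bounded_linear_Re])
    have *: "((\<lambda>y. k (Complex x y)) has_vector_derivative deriv k (Complex x y) * \<i>) (at y)"
      unfolding has_vector_derivative_def
      by (rule has_derivative_eq_rhs[OF has_derivative_compose[where f = "\<lambda>y. Complex x y" and f' = "\<lambda>h. Complex 0 h" and g = k and g' = "(*) (deriv k (Complex x y))"]])
         (auto simp: Complex_eq scaleR_conv_of_real intro!: derivative_eq_intros k[unfolded has_field_derivative_def Complex_eq])
    then show "((\<lambda>y. Re (k (Complex x y))) has_real_derivative - Im (deriv k (Complex x y))) (at y)"
      unfolding has_real_derivative_iff_has_vector_derivative
      by (auto dest: bounded_linear.has_vector_derivative[OF bounded_linear_Re])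
    from * have "((\<lambda>y. Im (k (Complex x y))) has_real_derivative Re (deriv k (Complex x y))) (at y)"
      unfolding has_real_derivative_iff_has_vector_derivative
      by (auto dest: bounded_linear.has_vector_derivative[OF bounded_linear_Im])
    then show "((\<lambda>y. - Im (k (Complex x y))) has_real_derivative - Re (deriv k (Complex x y))) (at y)"
      by (rule DERIV_minus)
  qed
  have C: "continuous_on (cbox (a,c) (b,d)) (\<lambda>z. Re (k (Complex (fst z) (snd z))))" if "k holomorphic_on U" for k
  proof -
    have "continuous_on U k" using that holomorphic_on_imp_continuous_on by blast
    then have "continuous_on (cbox (a,c) (b,d)) (\<lambda>z. k (Complex (fst z) (snd z)))"
      by (rule continuous_on_compose2) (use g in \<open>auto simp: Complex_eq intro!: continuous_intros\<close>)
    then show ?thesis by (intro continuous_intros)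
  qed
  have "integral (cbox (a,c) (b,d)) (\<lambda>z. Re (g (Complex (fst z) (snd z))) * (A'' (fst z) * B (snd z) + A (fst z) * B'' (snd z))) =
    integral {c..d} (\<lambda>y. (Re (g (Complex b y)) * A' b - Re (deriv g (Complex b y)) * A b - Re (g (Complex a y)) * A' a) * B y)
    + integral (cbox (a,c) (b,d)) (\<lambda>z. (Re (deriv (deriv g) (Complex (fst z) (snd z))) + - Re (deriv (deriv g) (Complex (fst z) (snd z)))) * (A (fst z) * B (snd z)))"
    apply (rule green_rectangle_smooth[where h = "\<lambda>x y. Re (g (Complex x y))" and hx = "\<lambda>x y. Re (deriv g (Complex x y))"
       and hxx = "\<lambda>x y. Re (deriv (deriv g) (Complex x y))" and hyy = "\<lambda>x y. - Re (deriv (deriv g) (Complex x y))"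
       and hy = "\<lambda>x y. - Im (deriv g (Complex x y))", OF le _ _ _ _ _ _ _ dA dB cA cB A0 B0])
    using dX dY dY2 C[OF g(2)] C[OF g'(2)] continuous_on_minus[OF C[OF g'(2)]] g(2) g' by auto
  then show ?thesis by simp
qed

section \<open>Mass and concentration of the regularised Laplacian of the logarithm\<close>

lemma nn_integral_inverse_square_kernel:
  fixes w :: real assumes "w > 0"
  shows "(\<integral>\<^sup>+x. ennreal (2 / (x^2 + w^2)^2) \<partial>lborel) = ennreal (pi / w^3)"
proof -
  \<comment> \<open>An antiderivative by partial fractions. The rational part vanishes at both ends;
    the two limits of the arctan part differ by \<open>pi / w^3\<close>.\<close>
  let ?G = "\<lambda>x. x / (w^2 * (x^2+w^2)) + arctan (x/w) / w^3"
  have pos: "x^2 + w^2 > 0" for x :: real using assms by (simp add: add_nonneg_pos)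
  have der: "(?G has_real_derivative 2 / (x^2+w^2)^2) (at x)" for x
  proof -
    have n: "x^2+w^2 \<noteq> 0" "w \<noteq> 0" "w^2*(x^2+w^2) \<noteq> 0" using pos[of x] assms by auto
    have "((\<lambda>x. x / (w^2 * (x^2+w^2))) has_real_derivative (1 * (w^2*(x^2+w^2)) - x * (w^2 * (2*x))) / (w^2*(x^2+w^2) * (w^2*(x^2+w^2)))) (at x)"
      by (intro DERIV_divide n) (auto intro!: derivative_eq_intros)
    moreover have "((\<lambda>x. arctan (x/w) / w^3) has_real_derivative (1/w) / (1+(x/w)^2) / w^3) (at x)"
      by (intro DERIV_cdivide) (use n in \<open>auto intro!: derivative_eq_intros simp: field_simps\<close>)
    ultimately have "(?G has_real_derivative (1 * (w^2*(x^2+w^2)) - x * (w^2 * (2*x))) / (w^2*(x^2+w^2) * (w^2*(x^2+w^2))) + (1/w) / (1+(x/w)^2) / w^3) (at x)"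
      by (rule DERIV_add)
    also have "(1 * (w^2*(x^2+w^2)) - x * (w^2 * (2*x))) / (w^2*(x^2+w^2) * (w^2*(x^2+w^2))) + (1/w) / (1+(x/w)^2) / w^3 = 2 / (x^2+w^2)^2"
    proof -
      have e: "1+(x/w)^2 = (x^2+w^2)/w^2" using assms by (simp add: field_simps)
      have "(1 * (w^2*(x^2+w^2)) - x * (w^2 * (2*x))) / (w^2*(x^2+w^2) * (w^2*(x^2+w^2))) = (w^2 - x^2) / (w^2 * (x^2+w^2)^2)"
        using n by (simp add: frac_eq_eq) algebra
      moreover have "(1/w) / ((x^2+w^2)/w^2) / w^3 = 1 / (w^2 * (x^2+w^2))"
        using n by (simp add: frac_eq_eq) algebra
      moreover have "(w^2 - x^2) / (w^2 * (x^2+w^2)^2) + 1 / (w^2 * (x^2+w^2)) = 2 / (x^2+w^2)^2"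
        using n by (simp add: add_frac_eq frac_eq_eq) algebra
      ultimately show ?thesis unfolding e by simp
    qed
    finally show ?thesis .
  qed
  have lim: "(?G \<longlongrightarrow> pi / 2 / w^3) at_top" "(?G \<longlongrightarrow> - (pi / 2) / w^3) at_bot"
  proof -
    have a: "((\<lambda>x. x / (w^2 * (x^2+w^2))) \<longlongrightarrow> 0) at_top" "((\<lambda>x. x / (w^2 * (x^2+w^2))) \<longlongrightarrow> 0) at_bot"
      using assms by real_asymp+
    have t: "filterlim (\<lambda>x. x / w) at_top at_top" "filterlim (\<lambda>x. x / w) at_bot at_bot"
      using assms by real_asymp+
    have "w^3 \<noteq> 0" using assms by simp
    then have "((\<lambda>x. arctan (x/w) / w^3) \<longlongrightarrow> pi / 2 / w^3) at_top" "((\<lambda>x. arctan (x/w) / w^3) \<longlongrightarrow> - (pi / 2) / w^3) at_bot"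
      using tendsto_divide[OF filterlim_compose[OF tendsto_arctan_at_top t(1)] tendsto_const] 
        tendsto_divide[OF filterlim_compose[OF tendsto_arctan_at_bot t(2)] tendsto_const] by blast+
    from tendsto_add[OF a(1) this(1)] tendsto_add[OF a(2) this(2)]
    show "(?G \<longlongrightarrow> pi / 2 / w^3) at_top" "(?G \<longlongrightarrow> - (pi / 2) / w^3) at_bot" by auto
  qed
  have "set_integrable lborel (einterval (-\<infinity>) \<infinity>) (\<lambda>x. 2 / (x^2+w^2)^2) \<and>
     (LBINT x=-\<infinity>..\<infinity>. 2 / (x^2+w^2)^2) = pi / 2 / w^3 - - (pi / 2) / w^3"
  proof (intro conjI interval_integral_FTC_nonneg[where F = ?G])
  qed (use der lim pos in \<open>auto simp: ereal_tendsto_simps intro!: continuous_intros\<close>)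
  then have "integrable lborel (\<lambda>x. 2 / (x^2+w^2)^2)" "(\<integral>x. 2 / (x^2+w^2)^2 \<partial>lborel) = pi / w^3"
    by (auto simp: set_integrable_def interval_lebesgue_integral_def einterval_def set_lebesgue_integral_def)
  then show ?thesis
    by (subst nn_integral_eq_integral) auto
qed

lemma borel_measurable_fst_snd [measurable]:
  "fst \<in> borel_measurable (borel :: ('a::second_countable_topology \<times> 'b::second_countable_topology) measure)"
  "snd \<in> borel_measurable (borel :: ('a \<times> 'b) measure)"
  by (auto intro!: borel_measurable_continuous_onI continuous_intros)

text \<open>The outer integral of the planar kernel: the inner one, taken at
  \<open>w = sqrt (1 + y^2)\<close>, has left \<open>pi / w^3\<close>.\<close>

lemma nn_integral_inverse_cube_kernel:
  "(\<integral>\<^sup>+y. ennreal (pi / sqrt (1 + y^2)^3) \<partial>lborel) = ennreal (2 * pi)"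
proof -
  let ?G = "\<lambda>y. pi * y / sqrt (1 + y^2)"
  have pos: "1 + y^2 > 0" for y :: real by (simp add: add_pos_nonneg)
  have der: "(?G has_real_derivative pi / sqrt (1 + y^2)^3) (at y)" for y :: real
  proof -
    have s: "sqrt (1+y^2) \<noteq> 0" "sqrt (1+y^2) ^ 2 = 1 + y^2" using pos[of y] by auto
    have "((\<lambda>y. sqrt (1 + y^2)) has_real_derivative y / sqrt (1+y^2)) (at y)"
      by (rule DERIV_cong[OF DERIV_chain2[where f = sqrt and g = "\<lambda>y. 1 + y^2" and Db = "2 * y", OF DERIV_real_sqrt[OF pos[of y]]]]) (auto intro!: derivative_eq_intros simp: field_simps)
    then have "(?G has_real_derivative (pi * sqrt (1+y^2) - pi * y * (y / sqrt (1+y^2))) / (sqrt (1+y^2) * sqrt (1+y^2))) (at y)"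
      by (intro DERIV_divide s) (auto intro!: derivative_eq_intros)
    also have "(pi * sqrt (1+y^2) - pi * y * (y / sqrt (1+y^2))) = pi * (sqrt (1+y^2)^2 - y^2) / sqrt (1+y^2)"
      using s(1) by (simp add: field_simps power2_eq_square)
    also have "\<dots> = pi / sqrt (1+y^2)" unfolding s(2) by simp
    also have "\<dots> / (sqrt (1+y^2) * sqrt (1+y^2)) = pi / sqrt (1 + y^2)^3"
      by (simp add: power3_eq_cube)
    finally show ?thesis .
  qed
  have lim: "(?G \<longlongrightarrow> pi) at_top" "(?G \<longlongrightarrow> - pi) at_bot"
    by real_asymp+
  have c: "isCont (\<lambda>y. pi / sqrt (1 + y^2)^3) x" for x
    using pos[of x] by (intro continuous_intros) auto
  have "set_integrable lborel (einterval (-\<infinity>) \<infinity>) (\<lambda>y. pi / sqrt (1 + y^2)^3) \<and>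
     (LBINT y=-\<infinity>..\<infinity>. pi / sqrt (1 + y^2)^3) = pi - - pi"
  proof (intro conjI interval_integral_FTC_nonneg[where F = ?G])
  qed (use der lim pos c in \<open>auto simp: ereal_tendsto_simps\<close>)
  then have "integrable lborel (\<lambda>y. pi / sqrt (1 + y^2)^3)" "(\<integral>y. pi / sqrt (1 + y^2)^3 \<partial>lborel) = 2 * pi"
    by (auto simp: set_integrable_def interval_lebesgue_integral_def einterval_def set_lebesgue_integral_def)
  then show ?thesis
    by (subst nn_integral_eq_integral) auto
qed

text \<open>The mass \<open>2 * pi\<close> is what the Laplacian of \<open>ln |z|\<close> carries at
  the origin; it becomes the constant in front of the sum over the zeros.\<close>

lemma has_bochner_integral_planar_kernel:
  "has_bochner_integral lborel (\<lambda>z::real\<times>real. 2 / ((fst z)^2 + (snd z)^2 + 1)^2) (2 * pi)"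
proof (rule has_bochner_integral_nn_integral)
  have "(\<integral>\<^sup>+z. ennreal (2 / ((fst z)^2 + (snd z)^2 + 1)^2) \<partial>(lborel :: (real\<times>real) measure))
    = (\<integral>\<^sup>+y. \<integral>\<^sup>+x. ennreal (2 / (x^2 + y^2 + 1)^2) \<partial>lborel \<partial>lborel)"
    unfolding lborel_prod[symmetric] by (subst lborel_pair.nn_integral_snd[symmetric]) auto
  also have "\<dots> = (\<integral>\<^sup>+y. ennreal (pi / sqrt (1 + y^2)^3) \<partial>lborel)"
  proof (rule nn_integral_cong)
    fix y :: real
    have "1 + y^2 > 0" by (simp add: add_pos_nonneg)
    then have "sqrt (1 + y^2) > 0" "sqrt (1+y^2)^2 = 1 + y^2" by auto
    with nn_integral_inverse_square_kernel[of "sqrt (1 + y^2)"]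
    show "(\<integral>\<^sup>+x. ennreal (2 / (x^2 + y^2 + 1)^2) \<partial>lborel) = ennreal (pi / sqrt (1 + y^2)^3)"
      by (simp add: add_ac)
  qed
  finally show "(\<integral>\<^sup>+z. ennreal (2 / ((fst z)^2 + (snd z)^2 + 1)^2) \<partial>(lborel :: (real\<times>real) measure)) = ennreal (2 * pi)"
    by (simp add: nn_integral_inverse_cube_kernel)
qed auto

text \<open>The kernel is the Laplacian of \<open>ln (|z - P|\<^sup>2 + \<epsilon>\<^sup>2) / 2\<close>.\<close>

lemma planar_kernel_approximate_identity:
  fixes \<Phi> :: "real \<times> real \<Rightarrow> real"
  assumes [measurable]: "\<Phi> \<in> borel_measurable borel" and bd: "\<And>z. \<bar>\<Phi> z\<bar> \<le> C" and cont: "isCont \<Phi> (p, q)"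
    and e: "\<And>n. e n > 0" "e \<longlonglongrightarrow> 0"
  shows "(\<lambda>n. \<integral>z. 2 * (e n)^2 / ((fst z - p)^2 + (snd z - q)^2 + (e n)^2)^2 * \<Phi> z \<partial>lborel) \<longlonglongrightarrow> 2 * pi * \<Phi> (p, q)"
proof -
  let ?K = "\<lambda>z::real\<times>real. 2 / ((fst z)^2 + (snd z)^2 + 1)^2"
  \<comment> \<open>The affine substitution centred at \<open>(p, q)\<close> with scale
    \<open>e n\<close> has Jacobian \<open>(e n)^2\<close>. It turns the kernel into the fixed
    kernel \<open>?K\<close> and moves the scale into the argument of \<open>\<Phi>\<close>.\<close>
  have eq: "(\<integral>z. 2 * (e n)^2 / ((fst z - p)^2 + (snd z - q)^2 + (e n)^2)^2 * \<Phi> z \<partial>lborel)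
     = (\<integral>z. ?K z * \<Phi> ((p, q) + e n *\<^sub>R z) \<partial>lborel)" for n
  proof -
    let ?f = "\<lambda>z. 2 * (e n)^2 / ((fst z - p)^2 + (snd z - q)^2 + (e n)^2)^2 * \<Phi> z"
    have "(\<integral>z. ?f z \<partial>lborel) = (\<integral>z. ?f z \<partial>(density (distr lborel borel (\<lambda>x. (p,q) + e n *\<^sub>R x)) (\<lambda>_. \<bar>e n\<bar>^DIM(real\<times>real))))"
      using e(1)[of n] by (subst lborel_affine[of "e n" "(p,q)"]) auto
    also have "\<dots> = (\<integral>z. (e n)^2 *\<^sub>R ?f ((p,q) + e n *\<^sub>R z) \<partial>lborel)"
      using e(1)[of n] by (subst integral_density, measurable) (subst integral_distr, auto simp: power2_eq_square)
    also have "\<dots> = (\<integral>z. ?K z * \<Phi> ((p, q) + e n *\<^sub>R z) \<partial>lborel)"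
    proof (intro Bochner_Integration.integral_cong refl)
      fix z :: "real \<times> real"
      have n: "(fst z)^2 + (snd z)^2 + 1 \<noteq> 0" "e n \<noteq> 0"
        using e(1)[of n] by (auto simp: add_nonneg_eq_0_iff)
      have "(e n)^2 * (2 * (e n)^2 / ((e n * fst z)^2 + (e n * snd z)^2 + (e n)^2)^2) = ?K z"
      proof -
        have "(e n * fst z)^2 + (e n * snd z)^2 + (e n)^2 = (e n)^2 * ((fst z)^2 + (snd z)^2 + 1)"
          by (simp add: algebra_simps power_mult_distrib)
        moreover have "u^2 * (2 * u^2 / (u^2 * X)^2) = 2 / X^2" if "X \<noteq> 0" "u \<noteq> 0" for u X :: real
          using that by (simp add: field_simps power2_eq_square)
        ultimately show ?thesis using n by simp
      qed
      moreover have "(e n)^2 *\<^sub>R ?f ((p,q) + e n *\<^sub>R z) = 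
          ((e n)^2 * (2 * (e n)^2 / ((e n * fst z)^2 + (e n * snd z)^2 + (e n)^2)^2)) * \<Phi> ((p, q) + e n *\<^sub>R z)"
        by simp
      ultimately show "(e n)^2 *\<^sub>R ?f ((p,q) + e n *\<^sub>R z) = ?K z * \<Phi> ((p, q) + e n *\<^sub>R z)"
        by simp
    qed
    finally show ?thesis .
  qed
  have "(\<lambda>n. \<integral>z. ?K z * \<Phi> ((p, q) + e n *\<^sub>R z) \<partial>lborel) \<longlonglongrightarrow> (\<integral>z. ?K z * \<Phi> (p, q) \<partial>lborel)"
  proof (rule integral_dominated_convergence[where w = "\<lambda>z. ?K z * C"])
    show "integrable lborel (\<lambda>z. ?K z * C)"
      using has_bochner_integral_planar_kernel by (intro integrable_mult_left) (auto simp: has_bochner_integral_iff)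
    show "AE z in lborel. (\<lambda>n. ?K z * \<Phi> ((p, q) + e n *\<^sub>R z)) \<longlonglongrightarrow> ?K z * \<Phi> (p, q)"
    proof (intro AE_I2 tendsto_mult tendsto_const)
      fix z :: "real \<times> real"
      have "(\<lambda>n. (p,q) + e n *\<^sub>R z) \<longlonglongrightarrow> (p,q) + 0 *\<^sub>R z"
        by (intro tendsto_intros e)
      then show "(\<lambda>n. \<Phi> ((p, q) + e n *\<^sub>R z)) \<longlonglongrightarrow> \<Phi> (p, q)"
        using isCont_tendsto_compose[OF cont] by simp
    qed
    show "AE z in lborel. norm (?K z * \<Phi> ((p, q) + e n *\<^sub>R z)) \<le> ?K z * C" for n
      by (intro AE_I2) (auto simp: abs_mult intro!: divide_right_mono mult_left_mono bd)
  qed auto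
  moreover have "(\<integral>z. ?K z * \<Phi> (p, q) \<partial>lborel) = 2 * pi * \<Phi> (p, q)"
    using has_bochner_integral_planar_kernel
    by (subst Bochner_Integration.integral_mult_left) (auto simp: has_bochner_integral_iff)
  ultimately show ?thesis unfolding eq by simp
qed

section \<open>Integrability of logarithms and removal of the regularisation\<close>

lemma set_integrable_ln_abs:
  fixes q :: real
  shows "set_integrable lborel {c..d} (\<lambda>t. ln \<bar>t - q\<bar>)"
proof (cases "c \<le> d")
  case True
  \<comment> \<open>The usual antiderivative of the logarithm. It is continuous also at
    \<open>t = q\<close>, so the fundamental theorem with one exceptional point applies across the
    singularity.\<close>
  let ?F = "\<lambda>t. (t - q) * ln \<bar>t - q\<bar> - (t - q)"
  have lim: "((\<lambda>x::real. x * ln \<bar>x\<bar>) \<longlongrightarrow> 0) (at 0)"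
    by (rule filterlim_split_at) real_asymp+
  have cont0: "isCont (\<lambda>x::real. x * ln \<bar>x\<bar>) 0"
    using lim by (simp add: isCont_def)
  have cont: "isCont (\<lambda>x::real. x * ln \<bar>x\<bar>) x" for x
    using cont0 by (cases "x = 0") (auto intro!: continuous_intros)
  have contF: "continuous_on {c..d} ?F"
    by (intro continuous_on_diff continuous_intros continuous_at_imp_continuous_on ballI
          isCont_o2[where g = "\<lambda>x. x * ln \<bar>x\<bar>" and f = "\<lambda>t. t - q"] cont)
  have der: "(?F has_real_derivative ln \<bar>t - q\<bar>) (at t)" if "t \<noteq> q" for t
  proof (cases "t > q")
    case True
    have "((\<lambda>t. (t - q) * ln (t - q) - (t - q)) has_real_derivative ln (t - q)) (at t)"
      using True by (auto intro!: derivative_eq_intros)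
    then have "(?F has_real_derivative ln (t - q)) (at t)"
      by (rule has_field_derivative_transform_within_open[where S = "{q<..}"]) (use True in auto)
    then show ?thesis using True by simp
  next
    case False
    then have l: "t < q" using that by simp
    have "((\<lambda>t. ln (q - t)) has_real_derivative -1 / (q - t)) (at t)"
      using l by (auto intro!: derivative_eq_intros)
    from DERIV_diff[OF DERIV_mult[OF DERIV_diff[OF DERIV_ident DERIV_const[of q]] this] DERIV_diff[OF DERIV_ident DERIV_const[of q]]]
    have "((\<lambda>t. (t - q) * ln (q - t) - (t - q)) has_real_derivative
        ln (q - t) + - 1 / (q - t) * (t - q) - 1) (at t)" by simp
    also have "- 1 / (q - t) * (t - q) = 1" using l by (simp add: divide_simps)
    finally have "((\<lambda>t. (t - q) * ln (q - t) - (t - q)) has_real_derivative ln (q - t)) (at t)" by simp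
    then have "(?F has_real_derivative ln (q - t)) (at t)"
      by (rule has_field_derivative_transform_within_open[where S = "{..<q}"]) (use l in auto)
    then show ?thesis using l by simp
  qed
  have "((\<lambda>t. ln \<bar>t - q\<bar>) has_integral (?F d - ?F c)) {c..d}"
    using True contF der
    by (intro fundamental_theorem_of_calculus_strong[where S = "{q}"])
       (auto simp: has_real_derivative_iff_has_vector_derivative[symmetric] intro: has_field_derivative_at_within)
  then have int: "(\<lambda>t. ln \<bar>t - q\<bar>) integrable_on {c..d}" by blast
  \<comment> \<open>\<open>m\<close> bounds the logarithm from above on the interval (at
    \<open>t = q\<close> by the convention \<open>ln 0 = 0\<close>). The difference is nonnegative,
    and for nonnegative functions gauge integrability is absolute.\<close>
  define m where "m = \<bar>c\<bar> + \<bar>d\<bar> + \<bar>q\<bar>"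
  have "(\<lambda>t. m - ln \<bar>t - q\<bar>) absolutely_integrable_on {c..d}"
  proof (rule nonnegative_absolutely_integrable_1)
    show "(\<lambda>t. m - ln \<bar>t - q\<bar>) integrable_on {c..d}"
      by (intro Henstock_Kurzweil_Integration.integrable_diff int) auto
    show "0 \<le> m - ln \<bar>t - q\<bar>" if "t \<in> {c..d}" for t
    proof (cases "t = q")
      case False
      then have "ln \<bar>t - q\<bar> \<le> \<bar>t - q\<bar>" by (simp add: ln_bound)
      also have "\<dots> \<le> m" using that by (auto simp: m_def)
      finally show ?thesis by simp
    qed (auto simp: m_def)
  qed
  moreover have "(\<lambda>t. m) absolutely_integrable_on {c..d}"
    by (auto intro!: absolutely_integrable_continuous_real)
  ultimately have "(\<lambda>t. m - (m - ln \<bar>t - q\<bar>)) absolutely_integrable_on {c..d}"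
    by (rule set_integral_diff(1)[rotated])
  then have "integrable lebesgue (\<lambda>t. indicator {c..d} t *\<^sub>R ln \<bar>t - q\<bar>)"
    by (simp add: set_integrable_def)
  then show ?thesis unfolding set_integrable_def
    by (subst (asm) integrable_completion) auto
qed (auto simp: set_integrable_def)

text \<open>A majorant that depends on one coordinate only: Fubini reduces it to an interval, and it
  dominates the planar logarithm uniformly in the regularisation.\<close>

lemma set_integrable_ln_abs_rectangle:
  fixes p :: real
  shows "set_integrable lborel (cbox (a,c) (b,d)) (\<lambda>z::real\<times>real. \<bar>ln \<bar>fst z - p\<bar>\<bar>)"
proof -
  have i: "(\<integral>\<^sup>+x. ennreal (\<bar>ln \<bar>x - p\<bar>\<bar> * indicator {a..b} x) \<partial>lborel) < \<infinity>"
    using set_integrable_ln_abs[of a b p] by (simp add: set_integrable_def integrable_iff_bounded abs_mult mult.commute)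
  have "(\<integral>\<^sup>+z. ennreal (norm (indicator (cbox (a,c) (b,d)) z *\<^sub>R \<bar>ln \<bar>fst z - p\<bar>\<bar>)) \<partial>(lborel :: (real\<times>real) measure))
     = (\<integral>\<^sup>+y. \<integral>\<^sup>+x. ennreal (\<bar>ln \<bar>x - p\<bar>\<bar> * indicator {a..b} x) * indicator {c..d} y \<partial>lborel \<partial>lborel)"
    unfolding lborel_prod[symmetric] 
    apply (subst lborel_pair.nn_integral_snd[symmetric])
    subgoal by (simp add: lborel_prod) 
    by (intro nn_integral_cong) (auto simp: indicator_def cbox_Pair_eq)
  also have "\<dots> = (\<integral>\<^sup>+x. ennreal (\<bar>ln \<bar>x - p\<bar>\<bar> * indicator {a..b} x) \<partial>lborel) * (\<integral>\<^sup>+y. indicator {c..d} y \<partial>lborel)"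
    by (simp add: nn_integral_multc nn_integral_cmult)
  also have "\<dots> < \<infinity>"
    using i by (auto simp: ennreal_mult_less_top emeasure_lborel_Icc_eq)
  finally show ?thesis
    unfolding set_integrable_def by (intro integrableI_bounded) auto
qed

lemma AE_fst_neq: "AE z::real\<times>real in lborel. fst z \<noteq> p"
  unfolding lborel_prod[symmetric]
proof (rule lborel_pair.AE_pair_measure)
  show "{x \<in> space (lborel \<Otimes>\<^sub>M lborel). fst x \<noteq> p} \<in> sets (lborel \<Otimes>\<^sub>M (lborel :: real measure))"
    unfolding lborel_prod by (auto intro!: borel_open open_Collect_neq continuous_intros)
  show "AE x in lborel. AE y::real in lborel. fst (x, y) \<noteq> p"
    using AE_lborel_singleton[of p] by eventually_elim simp
qed

text \<open>The sum of squares lies between \<open>(x-p)^2\<close> and \<open>3 * r^2\<close>. The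
  bound is uniform in \<open>e\<close>, with \<open>e = 0\<close> included, and so supplies the
  majorant for letting the regularisation tend to 0.\<close>

lemma ln_sum_squares_bound:
  fixes x y p q e r :: real
  assumes "x \<noteq> p" "\<bar>x - p\<bar> \<le> r" "\<bar>y - q\<bar> \<le> r" "0 \<le> e" "e \<le> 1" "1 \<le> r"
  shows "\<bar>ln ((x-p)^2 + (y-q)^2 + e^2) / 2\<bar> \<le> \<bar>ln \<bar>x - p\<bar>\<bar> + ln (3 * r^2)"
proof -
  let ?N = "(x-p)^2 + (y-q)^2 + e^2"
  have pos: "0 < (x-p)^2" using assms by simp
  have r1: "1 \<le> r^2" using assms by (simp add: one_le_power)
  have r2: "0 \<le> ln (3 * r^2)" using r1 by simp
  have "(x-p)^2 \<le> r^2" "(y-q)^2 \<le> r^2" "e^2 \<le> 1" using assms by (auto simp: abs_le_square_iff[symmetric] power_le_one)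
  then have up: "?N \<le> 3 * r^2" using r1 by linarith
  have lo: "(x-p)^2 \<le> ?N" by simp
  have "ln ?N \<le> ln (3 * r^2)" using up pos lo by (subst ln_le_cancel_iff) (linarith)+
  moreover have "ln ((x-p)^2) \<le> ln ?N" using pos lo by (subst ln_le_cancel_iff) (linarith)+
  moreover have "ln ((x-p)^2) = 2 * ln \<bar>x-p\<bar>" using assms ln_realpow[of "\<bar>x-p\<bar>" 2] by simp
  ultimately show ?thesis using r2 by linarith
qed

text \<open>Written with \<open>0^2\<close> so that the unregularised logarithm is literally the
  case \<open>e = 0\<close>; at \<open>P\<close> itself both sides are 0 because
  \<open>ln 0 = 0\<close>.\<close>

lemma ln_cmod_eq: "ln (cmod (Complex x y - P)) = ln ((x - Re P)^2 + (y - Im P)^2 + 0^2) / 2"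
proof (cases "(x - Re P)^2 + (y - Im P)^2 = 0")
  case True
  then have "x = Re P" "y = Im P" by (auto simp: sum_power2_eq_zero_iff)
  then show ?thesis by (simp add: cmod_def)
next
  case False
  then show ?thesis
    by (simp add: cmod_def ln_sqrt sum_power2_gt_zero_iff)
qed

lemma log_regularization_rectangle:
  fixes \<phi> :: "real \<times> real \<Rightarrow> real"
  assumes \<phi>: "continuous_on (cbox (a,c) (b,d)) \<phi>" and e: "\<And>n. 0 \<le> e n" "\<And>n. e n \<le> 1" "e \<longlonglongrightarrow> 0"
  shows "set_integrable lborel (cbox (a,c) (b,d)) (\<lambda>z. ln (cmod (Complex (fst z) (snd z) - P)) * \<phi> z)" (is ?I)
    and "(\<lambda>n. LINT z:cbox (a,c) (b,d)|lborel. ln ((fst z - Re P)^2 + (snd z - Im P)^2 + (e n)^2) / 2 * \<phi> z)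
       \<longlonglongrightarrow> (LINT z:cbox (a,c) (b,d)|lborel. ln (cmod (Complex (fst z) (snd z) - P)) * \<phi> z)" (is ?L)
proof -
  let ?R = "cbox (a,c) (b,d)"
  let ?p = "Re P" and ?q = "Im P"
  let ?N = "\<lambda>e z. (fst z - ?p)^2 + (snd z - ?q)^2 + e^2"
  have "compact (\<phi> ` ?R)" by (intro compact_continuous_image \<phi> compact_cbox)
  then obtain m where m: "\<And>z. z \<in> ?R \<Longrightarrow> \<bar>\<phi> z\<bar> \<le> m"
    by (meson bounded_real compact_imp_bounded imageI)
  have phi [measurable]: "(\<lambda>z. indicator ?R z *\<^sub>R \<phi> z) \<in> borel_measurable borel"
    using borel_integrable_compact[OF compact_cbox \<phi>] by auto
  define r where "r = max 1 (max (\<bar>a - ?p\<bar> + \<bar>b - ?p\<bar>) (\<bar>c - ?q\<bar> + \<bar>d - ?q\<bar>))"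
  let ?w = "\<lambda>z::real\<times>real. (indicator ?R z *\<^sub>R \<bar>ln \<bar>fst z - ?p\<bar>\<bar> + indicator ?R z *\<^sub>R ln (3 * r^2)) * m"
  have r1: "1 \<le> r" by (simp add: r_def)
  have w: "integrable lborel ?w"
    using set_integrable_ln_abs_rectangle[of a c b d ?p] borel_integrable_compact[of ?R "\<lambda>_. ln (3 * r^2)"]
    by (intro integrable_mult_left Bochner_Integration.integrable_add) (simp_all add: set_integrable_def compact_cbox)
  have bd: "AE z in lborel. norm (indicator ?R z *\<^sub>R (ln (?N e z) / 2 * \<phi> z)) \<le> ?w z" if "0 \<le> e" "e \<le> 1" for e
    using AE_fst_neq[of ?p]
  proof eventually_elim
    case (elim z)
    show ?case
    proof (cases "z \<in> ?R")
      case True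
      then have "\<bar>fst z - ?p\<bar> \<le> r" "\<bar>snd z - ?q\<bar> \<le> r" by (auto simp: r_def cbox_Pair_eq le_max_iff_disj)
      from ln_sum_squares_bound[OF elim this that r1]
      have "\<bar>ln (?N e z) / 2\<bar> * \<bar>\<phi> z\<bar> \<le> (\<bar>ln \<bar>fst z - ?p\<bar>\<bar> + ln (3 * r^2)) * m"
        using m[OF True] r1 by (intro mult_mono) (auto intro!: ln_ge_zero add_nonneg_nonneg simp: one_le_power less_eq_real_def
           intro: order_trans[of 1 "r^2" "3 * r^2"])
      then show ?thesis using True by (simp add: abs_mult)
    qed simp
  qed
  have lim: "AE z in lborel. (\<lambda>n. indicator ?R z *\<^sub>R (ln (?N (e n) z) / 2 * \<phi> z)) \<longlonglongrightarrow> indicator ?R z *\<^sub>R (ln (?N 0 z) / 2 * \<phi> z)"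
    using AE_fst_neq[of ?p]
  proof eventually_elim
    case (elim z)
    then have "0 < (fst z - ?p)^2 + (snd z - ?q)^2" by (simp add: sum_power2_gt_zero_iff)
    then show ?case by (intro tendsto_intros e) auto
  qed
  have meas: "(\<lambda>z. indicator ?R z *\<^sub>R (ln (?N e z) / 2 * \<phi> z)) \<in> borel_measurable lborel" for e
  proof -
    have "(\<lambda>z. ln (?N e z) / 2 * (indicator ?R z *\<^sub>R \<phi> z)) \<in> borel_measurable borel" by measurable
    then show ?thesis by (simp add: mult_ac)
  qed
  show ?I
    unfolding set_integrable_def ln_cmod_eq
    by (rule integrable_dominated_convergence[OF meas meas w lim bd]) (use e in auto)
  show ?L
    unfolding set_lebesgue_integral_def ln_cmod_eq
    by (rule integral_dominated_convergence[OF meas meas w lim bd]) (use e in auto)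
qed

text \<open>The roles of the coordinates are exchanged: on a vertical line \<open>x - Re P\<close>
  may be 0, so the majorant has to use the variable of integration \<open>y\<close>.\<close>

lemma log_regularization_line:
  fixes \<phi> :: "real \<Rightarrow> real"
  assumes \<phi>: "continuous_on {c..d} \<phi>" and e: "\<And>n. 0 \<le> e n" "\<And>n. e n \<le> 1" "e \<longlonglongrightarrow> 0"
  shows "set_integrable lborel {c..d} (\<lambda>y. ln (cmod (Complex x y - P)) * \<phi> y)" (is ?I)
    and "(\<lambda>n. LINT y:{c..d}|lborel. ln ((x - Re P)^2 + (y - Im P)^2 + (e n)^2) / 2 * \<phi> y)
       \<longlonglongrightarrow> (LINT y:{c..d}|lborel. ln (cmod (Complex x y - P)) * \<phi> y)" (is ?L)
proof -
  let ?R = "{c..d}"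
  let ?p = "Re P" and ?q = "Im P"
  let ?N = "\<lambda>e y. (x - ?p)^2 + (y - ?q)^2 + e^2"
  have "compact (\<phi> ` ?R)" by (intro compact_continuous_image \<phi> compact_Icc)
  then obtain m where m: "\<And>z. z \<in> ?R \<Longrightarrow> \<bar>\<phi> z\<bar> \<le> m"
    by (meson bounded_real compact_imp_bounded imageI)
  have phi [measurable]: "(\<lambda>z. indicator ?R z *\<^sub>R \<phi> z) \<in> borel_measurable borel"
    using borel_integrable_compact[OF compact_Icc \<phi>] by auto
  define r where "r = max 1 (max \<bar>x - ?p\<bar> (\<bar>c - ?q\<bar> + \<bar>d - ?q\<bar>))"
  let ?w = "\<lambda>y. (indicator ?R y *\<^sub>R \<bar>ln \<bar>y - ?q\<bar>\<bar> + indicator ?R y *\<^sub>R ln (3 * r^2)) * m"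
  have r1: "1 \<le> r" by (simp add: r_def)
  have w: "integrable lborel ?w"
    using integrable_abs[OF set_integrable_ln_abs[of c d ?q, unfolded set_integrable_def]] borel_integrable_compact[of ?R "\<lambda>_. ln (3 * r^2)"]
    by (intro integrable_mult_left Bochner_Integration.integrable_add) (simp_all add: set_integrable_def abs_mult compact_Icc)
  have bd: "AE y in lborel. norm (indicator ?R y *\<^sub>R (ln (?N e y) / 2 * \<phi> y)) \<le> ?w y" if "0 \<le> e" "e \<le> 1" for e
    using AE_lborel_singleton[of ?q]
  proof eventually_elim
    case (elim z)
    show ?case
    proof (cases "z \<in> ?R")
      case True
      then have "\<bar>x - ?p\<bar> \<le> r" "\<bar>z - ?q\<bar> \<le> r" by (auto simp: r_def)
      from ln_sum_squares_bound[OF elim this(2,1) that r1]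
      have "\<bar>ln (?N e z) / 2\<bar> * \<bar>\<phi> z\<bar> \<le> (\<bar>ln \<bar>z - ?q\<bar>\<bar> + ln (3 * r^2)) * m"
        using m[OF True] r1 by (intro mult_mono) (auto intro!: ln_ge_zero add_nonneg_nonneg simp: add.commute one_le_power less_eq_real_def
           intro: order_trans[of 1 "r^2" "3 * r^2"])
      then show ?thesis using True by (simp add: abs_mult)
    qed simp
  qed
  have lim: "AE y in lborel. (\<lambda>n. indicator ?R y *\<^sub>R (ln (?N (e n) y) / 2 * \<phi> y)) \<longlonglongrightarrow> indicator ?R y *\<^sub>R (ln (?N 0 y) / 2 * \<phi> y)"
    using AE_lborel_singleton[of ?q]
  proof eventually_elim
    case (elim z)
    then have "0 < (x - ?p)^2 + (z - ?q)^2" by (simp add: sum_power2_gt_zero_iff)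
    then show ?case by (intro tendsto_intros e) auto
  qed
  have meas: "(\<lambda>y. indicator ?R y *\<^sub>R (ln (?N e y) / 2 * \<phi> y)) \<in> borel_measurable lborel" for e
  proof -
    have "(\<lambda>y. ln (?N e y) / 2 * (indicator ?R y *\<^sub>R \<phi> y)) \<in> borel_measurable borel" by measurable
    then show ?thesis by (simp add: mult_ac)
  qed
  show ?I
    unfolding set_integrable_def ln_cmod_eq
    by (rule integrable_dominated_convergence[OF meas meas w lim bd]) (use e in auto)
  show ?L
    unfolding set_lebesgue_integral_def ln_cmod_eq
    by (rule integral_dominated_convergence[OF meas meas w lim bd]) (use e in auto)
qed

lemma set_lebesgue_integral_continuous:
  fixes f :: "'a::euclidean_space \<Rightarrow> real"
  assumes "continuous_on S f" "compact S"
  shows "set_integrable lborel S f" "(LINT x:S|lborel. f x) = integral S f"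
proof -
  show i: "set_integrable lborel S f"
    unfolding set_integrable_def by (rule borel_integrable_compact[OF assms(2,1)])
  show "(LINT x:S|lborel. f x) = integral S f"
    by (rule set_borel_integral_eq_integral(2)[OF i])
qed

text \<open>The Laplacian of \<open>ln |z - P|\<close> is \<open>2 * pi\<close> times the unit mass
  at \<open>P\<close>; the proof lets \<open>e\<close> tend to 0 in the identity for the regularised
  logarithm. A point on the left or on a horizontal side is harmless since the test function
  vanishes there. On the right side it need not vanish, hence \<open>Re P \<noteq> b\<close>, which
  also keeps the normal derivative finite.\<close>

lemma green_rectangle_log:
  assumes le: "a \<le> b" "c \<le> d" and P: "Re P \<noteq> b"
    and dA: "\<And>x. (A has_real_derivative A' x) (at x)" "\<And>x. (A' has_real_derivative A'' x) (at x)"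
    and dB: "\<And>x. (B has_real_derivative B' x) (at x)" "\<And>x. (B' has_real_derivative B'' x) (at x)"
    and cA: "continuous_on UNIV A''" and cB: "continuous_on UNIV B''"
    and A0: "A a = 0" and B0: "B c = 0" "B d = 0" "B' c = 0" "B' d = 0"
  shows "(LINT z:cbox (a,c) (b,d)|lborel. ln (cmod (Complex (fst z) (snd z) - P)) * (A'' (fst z) * B (snd z) + A (fst z) * B'' (snd z))) =
    (LINT y:{c..d}|lborel. (ln (cmod (Complex b y - P)) * A' b - Re (inverse (Complex b y - P)) * A b - ln (cmod (Complex a y - P)) * A' a) * B y)
    + 2 * pi * (if Re P \<in> {a..b} \<and> Im P \<in> {c..d} then A (Re P) * B (Im P) else 0)"
proof -
  let ?R = "cbox (a,c) (b,d)"
  let ?p = "Re P" and ?q = "Im P"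
  define e where "e n = inverse (real (Suc n))" for n
  have e: "e n > 0" "e n \<ge> 0" "e n \<le> 1" for n by (auto simp: e_def field_simps)
  have elim: "e \<longlonglongrightarrow> 0" unfolding e_def by (rule LIMSEQ_inverse_real_of_nat)
  let ?N = "\<lambda>e x y. (x - ?p)^2 + (y - ?q)^2 + e^2"
  let ?h = "\<lambda>e x y. ln (?N e x y) / 2"
  let ?D = "\<lambda>z. A'' (fst z) * B (snd z) + A (fst z) * B'' (snd z)"
  let ?hx = "\<lambda>e x y. (x - ?p) / ?N e x y"
  have cont: "continuous_on S A" "continuous_on S B" "continuous_on S A''" "continuous_on S B''" for S
    using DERIV_continuous_on[OF has_field_derivative_at_within[OF dA(1)]] DERIV_continuous_on[OF has_field_derivative_at_within[OF dB(1)]]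
      continuous_on_subset[OF cA] continuous_on_subset[OF cB] by auto
  note ci = continuous_intros continuous_on_compose2[OF cont(1)[of UNIV]] continuous_on_compose2[OF cont(2)[of UNIV]]
     continuous_on_compose2[OF cont(3)[of UNIV]] continuous_on_compose2[OF cont(4)[of UNIV]]
  have cD: "continuous_on S ?D" for S by (intro ci) auto
  have N0: "?N e x y > 0" if "e > 0" for e x y using that by (simp add: add_nonneg_pos)
  have N0': "?N e x y \<noteq> 0" if "e > 0" for e x y using N0[OF that, of x y] by linarith
  have chh: "continuous_on S (\<lambda>z. ?h e (fst z) (snd z))" if "e > 0" for e S
    using N0'[OF that] by (intro continuous_intros) auto
  have 1: "(LINT z:?R|lborel. ?h (e n) (fst z) (snd z) * ?D z) =
     (LINT y:{c..d}|lborel. (?h (e n) b y * A' b - ?hx (e n) b y * A b - ?h (e n) a y * A' a) * B y)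
     + (LINT z:?R|lborel. 2 * (e n)^2 / (?N (e n) (fst z) (snd z))^2 * (A (fst z) * B (snd z)))" for n
  proof -
    note e0 = e(1)[of n] and NN = N0[OF e(1)[of n]] N0'[OF e(1)[of n]]
    let ?hxx = "\<lambda>x y. 1 / ?N (e n) x y - 2 * (x - ?p)^2 / (?N (e n) x y)^2"
    let ?hyy = "\<lambda>x y. 1 / ?N (e n) x y - 2 * (y - ?q)^2 / (?N (e n) x y)^2"
    have "integral ?R (\<lambda>z. ?h (e n) (fst z) (snd z) * ?D z) =
      integral {c..d} (\<lambda>y. (?h (e n) b y * A' b - ?hx (e n) b y * A b - ?h (e n) a y * A' a) * B y)
      + integral ?R (\<lambda>z. (?hxx (fst z) (snd z) + ?hyy (fst z) (snd z)) * (A (fst z) * B (snd z)))"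
    proof (rule green_rectangle_smooth[where hy = "\<lambda>x y. (y - ?q) / ?N (e n) x y", OF le _ _ _ _ _ _ _ dA dB cA cB A0 B0])
      fix x y
      have qd: "((\<lambda>x. u x / v x) has_real_derivative 1 / v x - 2 * (u x)^2 / (v x)^2) (at x)"
        if "(u has_real_derivative 1) (at x)" "(v has_real_derivative 2 * u x) (at x)" "v x \<noteq> 0" for u v :: "real \<Rightarrow> real" and x
        using that by (auto intro!: derivative_eq_intros simp: field_simps power2_eq_square)
      have ld: "((\<lambda>x. ln (v x) / 2) has_real_derivative u / v x) (at x)"
        if "(v has_real_derivative 2 * u) (at x)" "v x > 0" for u :: real and v :: "real \<Rightarrow> real" and x
        using that by (auto intro!: derivative_eq_intros)
      show "((\<lambda>x. ?h (e n) x y) has_real_derivative ?hx (e n) x y) (at x)"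
        using NN[of x y] by (intro ld) (auto intro!: derivative_eq_intros)
      show "((\<lambda>y. ?h (e n) x y) has_real_derivative (y - ?q) / ?N (e n) x y) (at y)"
        using NN[of x y] by (intro ld) (auto intro!: derivative_eq_intros)
      show "((\<lambda>x. ?hx (e n) x y) has_real_derivative ?hxx x y) (at x)"
        using NN[of x y] by (intro qd) (auto intro!: derivative_eq_intros)
      show "((\<lambda>y. (y - ?q) / ?N (e n) x y) has_real_derivative ?hyy x y) (at y)"
        using NN[of x y] by (intro qd) (auto intro!: derivative_eq_intros)
    next
      show "continuous_on ?R (\<lambda>z. ?hxx (fst z) (snd z))" "continuous_on ?R (\<lambda>z. ?hyy (fst z) (snd z))"
        using NN by (auto intro!: continuous_intros)
    qed (use chh e0 in auto)
    also have "integral ?R (\<lambda>z. (?hxx (fst z) (snd z) + ?hyy (fst z) (snd z)) * (A (fst z) * B (snd z)))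
      = integral ?R (\<lambda>z. 2 * (e n)^2 / (?N (e n) (fst z) (snd z))^2 * (A (fst z) * B (snd z)))"
    proof (intro integral_cong arg_cong2[where f = "(*)"] refl)
      fix z :: "real \<times> real"
      have "1 / N - 2 * u / N^2 + (1 / N - 2 * v / N^2) = 2 * w / N^2" if "N = u + v + w" "N \<noteq> 0" for u v w N :: real
      proof -
        have "1 / N = N / N^2" using that(2) by (simp add: power2_eq_square)
        then have "1 / N - 2 * u / N^2 + (1 / N - 2 * v / N^2) = (2 * N - 2 * u - 2 * v) / N^2" 
          by (simp add: diff_divide_distrib add_divide_distrib)
        then show ?thesis using that by simp
      qed
      from this[OF refl NN(2)] show "?hxx (fst z) (snd z) + ?hyy (fst z) (snd z) = 2 * (e n)^2 / (?N (e n) (fst z) (snd z))^2" .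
    qed
    finally show ?thesis
      using NN by (subst (1 2 3) set_lebesgue_integral_continuous(2)) 
        (auto intro!: ci compact_cbox compact_Icc)
  qed
  have l1: "(\<lambda>n. LINT z:?R|lborel. ?h (e n) (fst z) (snd z) * ?D z) \<longlonglongrightarrow> 
     (LINT z:?R|lborel. ln (cmod (Complex (fst z) (snd z) - P)) * ?D z)"
    by (rule log_regularization_rectangle(2)[OF cD e(2,3) elim])
  have l2: "(\<lambda>n. LINT y:{c..d}|lborel. (?h (e n) b y * A' b - ?hx (e n) b y * A b - ?h (e n) a y * A' a) * B y)
     \<longlonglongrightarrow> (LINT y:{c..d}|lborel. (ln (cmod (Complex b y - P)) * A' b - Re (inverse (Complex b y - P)) * A b - ln (cmod (Complex a y - P)) * A' a) * B y)"
  proof -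
    have cB': "continuous_on {c..d} (\<lambda>y. B y * k)" for k by (intro ci) auto
    note l = log_regularization_line[OF cB' e(2,3) elim]
    have hx: "?hx 0 b y = Re (inverse (Complex b y - P))" for y
      by (simp add: power2_eq_square)
    have ihx: "set_integrable lborel {c..d} (\<lambda>y. ?hx k b y * (B y * A b))" if "k \<ge> 0" for k
    proof -
      have "?N k b y \<noteq> 0" for y using P by (simp add: add_nonneg_eq_0_iff)
      then show ?thesis by (intro set_lebesgue_integral_continuous(1) ci compact_Icc) auto
    qed
    have ihe: "set_integrable lborel {c..d} (\<lambda>y. ?h (e n) x y * (B y * k))" for n x k
      using N0'[OF e(1)[of n]] by (intro set_lebesgue_integral_continuous(1) ci compact_Icc) auto
    \<comment> \<open>Only the right side carries a normal derivative, and there it is at most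
      \<open>1 / |b - Re P|\<close> for every \<open>e\<close>, which is the majorant.\<close>
    have lhx: "(\<lambda>n. LINT y:{c..d}|lborel. ?hx (e n) b y * (B y * A b)) \<longlonglongrightarrow> (LINT y:{c..d}|lborel. ?hx 0 b y * (B y * A b))"
      unfolding set_lebesgue_integral_def
    proof (rule integral_dominated_convergence[where w = "\<lambda>y. indicator {c..d} y *\<^sub>R (1 / \<bar>b - ?p\<bar> * \<bar>B y * A b\<bar>)"])
      show "integrable lborel (\<lambda>y. indicator {c..d} y *\<^sub>R (1 / \<bar>b - ?p\<bar> * \<bar>B y * A b\<bar>))"
        by (intro borel_integrable_compact ci compact_Icc) (use P in auto)
      show "AE y in lborel. (\<lambda>n. indicator {c..d} y *\<^sub>R (?hx (e n) b y * (B y * A b))) \<longlonglongrightarrow> indicator {c..d} y *\<^sub>R (?hx 0 b y * (B y * A b))"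
        using P by (intro AE_I2 tendsto_intros elim) (auto simp: add_nonneg_eq_0_iff)
      show "AE y in lborel. norm (indicator {c..d} y *\<^sub>R (?hx (e n) b y * (B y * A b))) \<le> indicator {c..d} y *\<^sub>R (1 / \<bar>b - ?p\<bar> * \<bar>B y * A b\<bar>)" for n
      proof (intro AE_I2)
        fix y
        have "\<bar>?hx (e n) b y\<bar> \<le> 1 / \<bar>b - ?p\<bar>"
        proof -
          have "\<bar>b - ?p\<bar> * \<bar>b - ?p\<bar> \<le> ?N (e n) b y" by (simp add: power2_eq_square)
          then have "\<bar>b - ?p\<bar> / ?N (e n) b y \<le> \<bar>b - ?p\<bar> / (\<bar>b - ?p\<bar> * \<bar>b - ?p\<bar>)"
            using P by (intro divide_left_mono mult_pos_pos N0 e) auto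
          then show ?thesis using P by (simp add: abs_divide del: abs_mult_self_eq)
        qed
        then show "norm (indicator {c..d} y *\<^sub>R (?hx (e n) b y * (B y * A b))) \<le> indicator {c..d} y *\<^sub>R (1 / \<bar>b - ?p\<bar> * \<bar>B y * A b\<bar>)"
          by (auto simp: abs_mult indicator_def intro!: mult_right_mono simp del: times_divide_eq_left)
      qed
    next
      show "(\<lambda>y. indicator {c..d} y *\<^sub>R (?hx 0 b y * (B y * A b))) \<in> borel_measurable lborel" 
        using ihx[of 0] by (auto simp: set_integrable_def)
      show "(\<lambda>y. indicator {c..d} y *\<^sub>R (?hx (e n) b y * (B y * A b))) \<in> borel_measurable lborel" for n
        using ihx[OF e(2)] by (auto simp: set_integrable_def)
    qed
    have split: "(LINT y:{c..d}|lborel. (u y * A' b - v y * A b - w y * A' a) * B y) = 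
        (LINT y:{c..d}|lborel. u y * (B y * A' b)) - (LINT y:{c..d}|lborel. v y * (B y * A b)) - (LINT y:{c..d}|lborel. w y * (B y * A' a))"
      if "set_integrable lborel {c..d} (\<lambda>y. u y * (B y * A' b))" "set_integrable lborel {c..d} (\<lambda>y. v y * (B y * A b))"
        "set_integrable lborel {c..d} (\<lambda>y. w y * (B y * A' a))" for u v w
    proof -
      have "(u y * A' b - v y * A b - w y * A' a) * B y = u y * (B y * A' b) - v y * (B y * A b) - w y * (B y * A' a)" for y
        by (simp add: algebra_simps)
      then show ?thesis using that by (simp add: set_integral_diff)
    qed
    have "(LINT y:{c..d}|lborel. (?h (e n) b y * A' b - ?hx (e n) b y * A b - ?h (e n) a y * A' a) * B y) = 
        (LINT y:{c..d}|lborel. ?h (e n) b y * (B y * A' b)) - (LINT y:{c..d}|lborel. ?hx (e n) b y * (B y * A b)) - (LINT y:{c..d}|lborel. ?h (e n) a y * (B y * A' a))" for n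
      by (rule split[OF ihe ihx[OF e(2)] ihe])
    moreover have "(LINT y:{c..d}|lborel. (ln (cmod (Complex b y - P)) * A' b - ?hx 0 b y * A b - ln (cmod (Complex a y - P)) * A' a) * B y) = 
        (LINT y:{c..d}|lborel. ln (cmod (Complex b y - P)) * (B y * A' b)) - (LINT y:{c..d}|lborel. ?hx 0 b y * (B y * A b)) - (LINT y:{c..d}|lborel. ln (cmod (Complex a y - P)) * (B y * A' a))"
      by (rule split[OF l(1) ihx[OF order_refl] l(1)])
    ultimately show ?thesis
      unfolding hx[symmetric] using tendsto_diff[OF tendsto_diff[OF l(2) lhx] l(2)] by presburger
  qed
  have "(\<lambda>n. LINT z:?R|lborel. 2 * (e n)^2 / (?N (e n) (fst z) (snd z))^2 * (A (fst z) * B (snd z)))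
     \<longlonglongrightarrow> 2 * pi * (if Re P \<in> {a..b} \<and> Im P \<in> {c..d} then A (Re P) * B (Im P) else 0)"
  proof -
    define \<Phi> where "\<Phi> z = indicator ?R z * (A (fst z) * B (snd z))" for z
    have cAB: "continuous_on ?R (\<lambda>z. A (fst z) * B (snd z))" by (intro ci) auto
    have m: "\<Phi> \<in> borel_measurable borel" 
      using borel_integrable_compact[OF compact_cbox cAB] by (auto simp: \<Phi>_def[abs_def])
    have "compact ((\<lambda>z. A (fst z) * B (snd z)) ` ?R)" by (intro compact_continuous_image cAB compact_cbox)
    then obtain C where C: "\<And>z. z \<in> ?R \<Longrightarrow> \<bar>A (fst z) * B (snd z)\<bar> \<le> C"
      by (metis (mono_tags, lifting) bounded_real compact_imp_bounded imageI)
    have bd: "\<bar>\<Phi> z\<bar> \<le> max C 0" for z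
    proof (cases "z \<in> ?R")
      case True
      then have "\<bar>\<Phi> z\<bar> \<le> C" using C[OF True] by (simp only: \<Phi>_def indicator_simps mult_1_left)
      then show ?thesis by simp
    qed (simp add: \<Phi>_def)
    \<comment> \<open>The extension of the test function by 0 must be continuous at \<open>P\<close>
      for the kernel to pick out its value. It is: \<open>A\<close> vanishes at \<open>a\<close>,
      \<open>B\<close> at \<open>c\<close> and \<open>d\<close>, and the possible jump at
      \<open>b\<close> stays away from \<open>P\<close>.\<close>
    define At where "At x = (if x \<in> {a..b} then A x else 0)" for x
    define Bt where "Bt y = (if y \<in> {c..d} then B y else 0)" for y
    have \<Phi>: "\<Phi> z = At (fst z) * Bt (snd z)" for z
      by (cases z) (auto simp: \<Phi>_def At_def Bt_def cbox_Pair_eq)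
    have iA: "isCont A x" and iB: "isCont B x" for x
      using dA(1) dB(1) by (auto intro: DERIV_isCont)
    \<comment> \<open>Clamping \<open>y\<close> to the interval gives the same function, because
      both end values of \<open>B\<close> are 0, and makes the continuity visible.\<close>
    have "Bt = (\<lambda>y. B (max c (min d y)))"
      using B0 le by (auto simp: Bt_def fun_eq_iff max_def min_def)
    then have cBt: "isCont Bt ?q"
      by (auto intro!: isCont_o2[OF _ iB] continuous_intros)
    have cAt: "isCont At ?p"
    proof (cases "?p < b")
      case True
      have "isCont (\<lambda>x. A (max a x)) ?p" by (auto intro!: isCont_o2[OF _ iA] continuous_intros)
      moreover have "eventually (\<lambda>x. A (max a x) = At x) (nhds ?p)"
        by (rule eventually_mono[OF eventually_nhds_in_open[of "{..<b}" ?p]]) (use A0 True in \<open>auto simp: At_def max_def\<close>)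
      ultimately show ?thesis by (subst (asm) isCont_cong)
    next
      case False
      then have gt: "?p > b" using P by simp
      have "eventually (\<lambda>x. 0 = At x) (nhds ?p)"
        by (rule eventually_mono[OF eventually_nhds_in_open[of "{b<..}" ?p]]) (use gt in \<open>auto simp: At_def\<close>)
      moreover have "isCont (\<lambda>x. 0::real) ?p" by simp
      ultimately show ?thesis by (subst (asm) isCont_cong)
    qed
    have "isCont (\<lambda>z. At (fst z)) (?p, ?q)" "isCont (\<lambda>z. Bt (snd z)) (?p, ?q)"
      by (rule isCont_o2[OF isCont_fst[OF continuous_ident]], use cAt in simp)
         (rule isCont_o2[OF isCont_snd[OF continuous_ident]], use cBt in simp)
    then have cPhi: "isCont \<Phi> (?p, ?q)" unfolding \<Phi>[abs_def] by (rule continuous_mult)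
    have pk: "(\<lambda>n. \<integral>z. 2 * (e n)^2 / ((fst z - ?p)^2 + (snd z - ?q)^2 + (e n)^2)^2 * \<Phi> z \<partial>lborel) \<longlonglongrightarrow> 2 * pi * \<Phi> (?p, ?q)"
      by (rule planar_kernel_approximate_identity[where C = "max C 0"]) (fact m bd cPhi e(1) elim)+
    have eq1: "(LINT z:?R|lborel. 2 * (e n)^2 / (?N (e n) (fst z) (snd z))^2 * (A (fst z) * B (snd z))) =
      (\<integral>z. 2 * (e n)^2 / (?N (e n) (fst z) (snd z))^2 * \<Phi> z \<partial>lborel)" for n
      unfolding set_lebesgue_integral_def
      by (intro Bochner_Integration.integral_cong refl) (simp add: \<Phi>_def)
    have eq2: "\<Phi> (?p, ?q) = (if Re P \<in> {a..b} \<and> Im P \<in> {c..d} then A (Re P) * B (Im P) else 0)"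
      unfolding \<Phi> At_def Bt_def by simp
    show ?thesis unfolding eq1 eq2[symmetric] by (rule pk)
  qed
  from LIMSEQ_unique[OF l1[unfolded 1] tendsto_add[OF l2 this]] show ?thesis .
qed

section \<open>Green's identity for the logarithm of a holomorphic function\<close>

text \<open>Dividing by the polynomial with the same zeros and orders leaves a function without
  zeros, which has a holomorphic logarithm on the convex set \<open>U\<close>. Since the zeros are
  finitely many, \<open>F\<close> is nonzero in a punctured neighbourhood of every point, which
  makes its orders at zeros positive.\<close>

lemma holomorphic_exp_times_zeros:
  assumes F: "F holomorphic_on U" and U: "open U" "convex U"
    and Z: "finite {z\<in>U. F z = 0}"
  obtains g where "g holomorphic_on U"
    "\<And>s. s \<in> U \<Longrightarrow> F s = exp (g s) * (\<Prod>w\<in>{z\<in>U. F z = 0}. (s - w) ^ nat (zorder F w))"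
    "\<And>w. w \<in> U \<Longrightarrow> F w = 0 \<Longrightarrow> zorder F w > 0"
proof (cases "U = {}")
  case True
  then show ?thesis by (intro that[of "\<lambda>_. 0"]) auto
next
  case ne: False
  define Z where "Z = {z\<in>U. F z = 0}"
  have finZ: "finite Z" using assms by (simp add: Z_def)
  define f where "f = (\<lambda>z. \<Prod>w\<in>Z. (z - w) ^ nat (zorder F w))"
  have freq: "frequently (\<lambda>z. F z \<noteq> 0) (at z)" if "z \<in> U" for z
  proof -
    have "eventually (\<lambda>w. w \<notin> Z - {z}) (at z)"
    proof -
      have "open (- (Z - {z}))" by (intro open_Compl finite_imp_closed finite_Diff finZ)
      from eventually_at_in_open'[OF this, of z] show ?thesis
        by (auto elim: eventually_mono)
    qed
    moreover have "eventually (\<lambda>w. w \<in> U - {z}) (at z)"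
      using that U by (intro eventually_at_in_open) auto
    ultimately have "eventually (\<lambda>w. F w \<noteq> 0) (at z)"
      by eventually_elim (auto simp: Z_def)
    then show ?thesis by (rule eventually_frequently[rotated]) simp
  qed
  have pos: "zorder F z > 0 \<longleftrightarrow> F z = 0" if "z \<in> U" for z
    by (rule zorder_pos_iff[OF F U(1) that freq[OF that]])
  have f0: "f z = 0 \<longleftrightarrow> F z = 0" if "z \<in> U" for z
    using that pos finZ unfolding f_def Z_def by (auto simp: prod_zero_iff)
  have hf: "f holomorphic_on A" for A unfolding f_def by (intro holomorphic_intros)
  have zo: "zorder f z = zorder F z" if "z \<in> U" for z
  proof (cases "F z = 0")
    case False
    have "F analytic_on {z}" "f analytic_on {z}" using F hf[of U] that U(1) analytic_at by blast+
    then show ?thesis using False f0[OF that] by (simp add: zorder_eq_0I)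
  next
    case True
    show ?thesis
    proof (rule zorder_eqI)
      show "open U" "z \<in> U" "(\<lambda>s. \<Prod>w\<in>Z - {z}. (s - w) ^ nat (zorder F w)) holomorphic_on U"
        using that U by (auto intro!: holomorphic_intros)
      show "(\<Prod>w\<in>Z - {z}. (z - w) ^ nat (zorder F w)) \<noteq> 0"
        using finZ by auto
      show "f s = (\<Prod>w\<in>Z - {z}. (s - w) ^ nat (zorder F w)) * (s - z) powi zorder F z" for s
      proof -
        have "z \<in> Z" using that True by (auto simp: Z_def)
        then have "f s = (s - z) ^ nat (zorder F z) * (\<Prod>w\<in>Z - {z}. (s - w) ^ nat (zorder F w))"
          unfolding f_def by (intro prod.remove finZ)
        then show ?thesis using pos[OF that] True by (simp add: power_int_def)
      qed
    qed
  qed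
  obtain h where h: "h holomorphic_on U" "\<And>z. z \<in> U \<Longrightarrow> h z \<noteq> 0" "\<And>z. z \<in> U \<Longrightarrow> F z = h z * f z"
    using holomorphic_zorder_factorization[OF F U(1) convex_connected[OF U(2)] hf] f0 zo by metis
  obtain g where g: "g holomorphic_on U" "\<And>z. z \<in> U \<Longrightarrow> h z = exp (g z)"
    using contractible_imp_holomorphic_log[OF h(1) convex_imp_contractible[OF U(2)] h(2)] by blast
  show ?thesis
    using that[of g] g h(3) pos by (simp add: f_def Z_def)
qed

text \<open>Logarithmic differentiation: the normal derivative of \<open>ln |F|\<close> splits along
  the same sum over zeros as \<open>ln |F|\<close> itself.\<close>

lemma has_field_derivative_exp_times_powers:
  fixes g :: "complex \<Rightarrow> complex"
  assumes "finite Z" "s \<notin> Z" "(g has_field_derivative g') (at s)"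
  shows "((\<lambda>z. exp (g z) * (\<Prod>w\<in>Z. (z - w) ^ n w)) has_field_derivative
     (exp (g s) * (\<Prod>w\<in>Z. (s - w) ^ n w)) * (g' + (\<Sum>w\<in>Z. of_nat (n w) * inverse (s - w)))) (at s)"
  using assms
proof (induction Z rule: finite_induct)
  case empty
  then show ?case by (auto intro!: derivative_eq_intros)
next
  case (insert p Z)
  let ?G = "\<lambda>z. exp (g z) * (\<Prod>w\<in>Z. (z - w) ^ n w)"
  have IH: "(?G has_field_derivative ?G s * (g' + (\<Sum>w\<in>Z. of_nat (n w) * inverse (s - w)))) (at s)"
    using insert by auto
  have sp: "s - p \<noteq> 0" using insert by auto
  have "((\<lambda>z. (z - p) ^ n p) has_field_derivative of_nat (n p) * (s - p) ^ (n p - 1)) (at s)"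
    by (auto intro!: derivative_eq_intros)
  moreover have "of_nat (n p) * (s - p) ^ (n p - 1) = (s - p) ^ n p * (of_nat (n p) * inverse (s - p))"
    using sp by (cases "n p") (auto simp: field_simps)
  ultimately have "((\<lambda>z. (z - p) ^ n p) has_field_derivative (s - p) ^ n p * (of_nat (n p) * inverse (s - p))) (at s)"
    by (rule DERIV_cong)
  from DERIV_mult[OF this IH] show ?case
    using insert by (simp add: algebra_simps)
qed

lemma set_integrable_sum:
  fixes f :: "'i \<Rightarrow> 'a \<Rightarrow> 'b::{banach, second_countable_topology}"
  assumes "\<And>i. i \<in> I \<Longrightarrow> set_integrable M A (f i)"
  shows "set_integrable M A (\<lambda>x. \<Sum>i\<in>I. f i x)"
    and "(LINT x:A|M. \<Sum>i\<in>I. f i x) = (\<Sum>i\<in>I. LINT x:A|M. f i x)"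
  using assms unfolding set_integrable_def set_lebesgue_integral_def
  by (simp_all add: scaleR_sum_right)

text \<open>Green's identity is linear in the function, and off the zeros \<open>ln |F|\<close> is
  \<open>Re g\<close> plus finitely many terms \<open>n w * ln |s - w|\<close>, for which the
  identity is known. The strict inequality \<open>Re z < b\<close> for the zeros keeps the right
  side free of singularities; zeros on the left side have weight \<open>A a = 0\<close>.\<close>

lemma green_rectangle_log_modulus:
  fixes F :: "complex \<Rightarrow> complex"
  assumes le: "a < b" "c < d"
    and F: "F holomorphic_on U" "open U" "convex U" "\<And>x y. x \<in> {a..b} \<Longrightarrow> y \<in> {c..d} \<Longrightarrow> Complex x y \<in> U"
    and fin: "finite {z\<in>U. F z = 0}" and nzb: "\<And>z. z \<in> U \<Longrightarrow> F z = 0 \<Longrightarrow> Re z < b"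
  shows "\<And>\<phi>. continuous_on (cbox (a,c) (b,d)) \<phi> \<Longrightarrow> 
      set_integrable lborel (cbox (a,c) (b,d)) (\<lambda>z. ln (cmod (F (Complex (fst z) (snd z)))) * \<phi> z)"
    and "\<And>\<phi> x. x \<in> {a..b} \<Longrightarrow> continuous_on {c..d} \<phi> \<Longrightarrow> 
      set_integrable lborel {c..d} (\<lambda>y. ln (cmod (F (Complex x y))) * \<phi> y)"
    and "\<And>A A' A'' B B' B''. \<lbrakk>\<And>x. (A has_real_derivative A' x) (at x); \<And>x. (A' has_real_derivative A'' x) (at x);
      \<And>x. (B has_real_derivative B' x) (at x); \<And>x. (B' has_real_derivative B'' x) (at x);
      continuous_on UNIV A''; continuous_on UNIV B''; A a = 0; B c = 0; B d = 0; B' c = 0; B' d = 0\<rbrakk> \<Longrightarrow>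
     (LINT z:cbox (a,c) (b,d)|lborel. ln (cmod (F (Complex (fst z) (snd z)))) * (A'' (fst z) * B (snd z) + A (fst z) * B'' (snd z))) =
    (LINT y:{c..d}|lborel. (ln (cmod (F (Complex b y))) * A' b - Re (deriv F (Complex b y) / F (Complex b y)) * A b) * B y)
    - (LINT y:{c..d}|lborel. ln (cmod (F (Complex a y))) * (A' a * B y))
    + 2 * pi * (\<Sum>w\<in>{w. a \<le> Re w \<and> Re w \<le> b \<and> Im w \<in> {c..d} \<and> F w = 0}. real_of_int (zorder F w) * A (Re w) * B (Im w))"
proof -
  obtain g where g: "g holomorphic_on U"
    and Fg: "\<And>s. s \<in> U \<Longrightarrow> F s = exp (g s) * (\<Prod>w\<in>{z\<in>U. F z = 0}. (s - w) ^ nat (zorder F w))"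
    and pos: "\<And>w. w \<in> U \<Longrightarrow> F w = 0 \<Longrightarrow> zorder F w > 0"
    using holomorphic_exp_times_zeros[OF F(1-3) fin] by blast
  define Z where "Z = {z\<in>U. F z = 0}"
  define n where "n w = nat (zorder F w)" for w
  have finZ: "finite Z" using fin by (simp add: Z_def)
  let ?C = "\<lambda>z. Complex (fst z) (snd z)"
  let ?R = "cbox (a,c) (b,d)"
  let ?L = "\<lambda>s. Re (g s) + (\<Sum>w\<in>Z. real (n w) * ln (cmod (s - w)))"
  have FL: "ln (cmod (F s)) = ?L s" if "s \<in> U" "s \<notin> Z" for s
  proof -
    have nz: "(\<Prod>w\<in>Z. cmod (s - w) ^ n w) > 0" by (intro prod_pos zero_less_power) (use that in auto)
    have "cmod (F s) = exp (Re (g s)) * (\<Prod>w\<in>Z. cmod (s - w) ^ n w)"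
      using Fg[OF that(1)] by (simp add: norm_mult n_def Z_def prod_norm[symmetric] norm_power)
    then have "ln (cmod (F s)) = Re (g s) + ln (\<Prod>w\<in>Z. cmod (s - w) ^ n w)"
      using nz by (simp add: ln_mult_pos)
    also have "ln (\<Prod>w\<in>Z. cmod (s - w) ^ n w) = (\<Sum>w\<in>Z. ln (cmod (s - w) ^ n w))"
      by (intro ln_prod finZ) (use that in auto)
    also have "\<dots> = (\<Sum>w\<in>Z. real (n w) * ln (cmod (s - w)))"
      using that by (intro sum.cong) (auto simp: ln_realpow)
    finally show ?thesis .
  qed
  have CU: "?C z \<in> U" if "z \<in> ?R" for z using that F(4) by (cases z) (auto simp: cbox_Pair_eq)
  have contg: "continuous_on U g" "continuous_on U (deriv g)"
    using g F(2) by (auto intro!: holomorphic_on_imp_continuous_on holomorphic_deriv)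
  have contR: "continuous_on ?R (\<lambda>z. Re (k (?C z)))" and contx: "x \<in> {a..b} \<Longrightarrow> continuous_on {c..d} (\<lambda>y. Re (k (Complex x y)))"
    if "continuous_on U k" for k x
  proof -
    have "continuous_on ?R (\<lambda>z. k (?C z))"
      by (rule continuous_on_compose2[OF that]) (use CU in \<open>auto simp: Complex_eq intro!: continuous_intros\<close>)
    then show "continuous_on ?R (\<lambda>z. Re (k (?C z)))" by (intro continuous_intros)
    assume "x \<in> {a..b}"
    then have "continuous_on {c..d} (\<lambda>y. k (Complex x y))"
      by (intro continuous_on_compose2[OF that]) (use F(4) in \<open>auto simp: Complex_eq intro!: continuous_intros\<close>)
    then show "continuous_on {c..d} (\<lambda>y. Re (k (Complex x y)))" by (intro continuous_intros)
  qed
  \<comment> \<open>The constant regularisation 0, used only to read off integrability from the two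
    regularisation lemmas.\<close>
  have e: "\<And>n::nat. 0 \<le> (0::real)" "\<And>n::nat. (0::real) \<le> 1" "(\<lambda>n::nat. 0::real) \<longlonglongrightarrow> 0" by auto
  note reg2 = log_regularization_rectangle(1)[OF _ e]
  note reg1 = log_regularization_line(1)[OF _ e]
  have L2: "set_integrable lborel ?R (\<lambda>z. ?L (?C z) * \<phi> z)"
      "(LINT z:?R|lborel. ?L (?C z) * \<phi> z) = (LINT z:?R|lborel. Re (g (?C z)) * \<phi> z) + (\<Sum>w\<in>Z. real (n w) * (LINT z:?R|lborel. ln (cmod (?C z - w)) * \<phi> z))"
    if \<phi>: "continuous_on ?R \<phi>" for \<phi>
  proof -
    have eq: "?L (?C z) * \<phi> z = Re (g (?C z)) * \<phi> z + (\<Sum>w\<in>Z. real (n w) * (ln (cmod (?C z - w)) * \<phi> z))" for z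
      by (simp add: algebra_simps sum_distrib_left)
    have i1: "set_integrable lborel ?R (\<lambda>z. Re (g (?C z)) * \<phi> z)"
      by (intro set_lebesgue_integral_continuous(1) continuous_on_mult contR contg \<phi> compact_cbox)
    have i2: "set_integrable lborel ?R (\<lambda>z. real (n w) * (ln (cmod (?C z - w)) * \<phi> z))" for w
      using reg2[OF \<phi>] by simp
    have i3: "set_integrable lborel ?R (\<lambda>z. \<Sum>w\<in>Z. real (n w) * (ln (cmod (?C z - w)) * \<phi> z))"
      using i2 by (rule set_integrable_sum(1))
    show "set_integrable lborel ?R (\<lambda>z. ?L (?C z) * \<phi> z)"
      unfolding eq by (intro set_integral_add i1 i3)
    have "(LINT z:?R|lborel. \<Sum>w\<in>Z. real (n w) * (ln (cmod (?C z - w)) * \<phi> z)) = (\<Sum>w\<in>Z. (LINT z:?R|lborel. real (n w) * (ln (cmod (?C z - w)) * \<phi> z)))"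
      using i2 by (rule set_integrable_sum(2))
    then show "(LINT z:?R|lborel. ?L (?C z) * \<phi> z) = (LINT z:?R|lborel. Re (g (?C z)) * \<phi> z) + (\<Sum>w\<in>Z. real (n w) * (LINT z:?R|lborel. ln (cmod (?C z - w)) * \<phi> z))"
      unfolding eq by (subst set_integral_add(2)[OF i1 i3]) simp
  qed
  have L1: "set_integrable lborel {c..d} (\<lambda>y. ?L (Complex x y) * \<phi> y)"
      "(LINT y:{c..d}|lborel. ?L (Complex x y) * \<phi> y) = (LINT y:{c..d}|lborel. Re (g (Complex x y)) * \<phi> y) + (\<Sum>w\<in>Z. real (n w) * (LINT y:{c..d}|lborel. ln (cmod (Complex x y - w)) * \<phi> y))"
    if \<phi>: "continuous_on {c..d} \<phi>" and x: "x \<in> {a..b}" for \<phi> x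
  proof -
    have eq: "?L (Complex x y) * \<phi> y = Re (g (Complex x y)) * \<phi> y + (\<Sum>w\<in>Z. real (n w) * (ln (cmod (Complex x y - w)) * \<phi> y))" for y
      by (simp add: algebra_simps sum_distrib_left)
    have i1: "set_integrable lborel {c..d} (\<lambda>y. Re (g (Complex x y)) * \<phi> y)"
      by (intro set_lebesgue_integral_continuous(1) continuous_on_mult contx contg \<phi> compact_Icc x)
    have i2: "set_integrable lborel {c..d} (\<lambda>y. real (n w) * (ln (cmod (Complex x y - w)) * \<phi> y))" for w
      using reg1[OF \<phi>] by simp
    have i3: "set_integrable lborel {c..d} (\<lambda>y. \<Sum>w\<in>Z. real (n w) * (ln (cmod (Complex x y - w)) * \<phi> y))"
      using i2 by (rule set_integrable_sum(1))
    show "set_integrable lborel {c..d} (\<lambda>y. ?L (Complex x y) * \<phi> y)"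
      unfolding eq by (intro set_integral_add i1 i3)
    have "(LINT y:{c..d}|lborel. \<Sum>w\<in>Z. real (n w) * (ln (cmod (Complex x y - w)) * \<phi> y)) = (\<Sum>w\<in>Z. (LINT y:{c..d}|lborel. real (n w) * (ln (cmod (Complex x y - w)) * \<phi> y)))"
      using i2 by (rule set_integrable_sum(2))
    then show "(LINT y:{c..d}|lborel. ?L (Complex x y) * \<phi> y) = (LINT y:{c..d}|lborel. Re (g (Complex x y)) * \<phi> y) + (\<Sum>w\<in>Z. real (n w) * (LINT y:{c..d}|lborel. ln (cmod (Complex x y - w)) * \<phi> y))"
      unfolding eq by (subst set_integral_add(2)[OF i1 i3]) simp
  qed
  \<comment> \<open>At a zero of \<open>F\<close> the left side is \<open>ln 0 = 0\<close> and the
    decomposition need not hold. The zeros, and their heights on a vertical line, form countable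
    sets, which the integrals ignore.\<close>
  define X where "X = (\<lambda>w. (Re w, Im w)) ` Z"
  have eR: "indicator ?R z *\<^sub>R (ln (cmod (F (?C z))) * \<phi> z) = indicator ?R z *\<^sub>R (?L (?C z) * \<phi> z)" if "z \<notin> X" for z and \<phi> :: "real \<times> real \<Rightarrow> real"
  proof (cases "z \<in> ?R")
    case True
    have "?C z \<notin> Z" using that by (force simp: X_def)
    then show ?thesis using FL[OF CU[OF True]] by simp
  qed simp
  have e1: "indicator {c..d} y *\<^sub>R (ln (cmod (F (Complex x y))) * \<phi> y) = indicator {c..d} y *\<^sub>R (?L (Complex x y) * \<phi> y)" 
    if "y \<notin> Im ` Z" "x \<in> {a..b}" for x y and \<phi> :: "real \<Rightarrow> real"
  proof (cases "y \<in> {c..d}")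
    case True
    have "Complex x y \<notin> Z" using that by (force simp: X_def)
    then show ?thesis using FL[OF F(4)[OF that(2) True]] by simp
  qed simp
  have X: "countable X" "countable (Im ` Z)" using finZ by (auto simp: X_def countable_finite)
  have sR: "set_integrable lborel ?R (\<lambda>z. ln (cmod (F (?C z))) * \<phi> z) \<longleftrightarrow> set_integrable lborel ?R (\<lambda>z. ?L (?C z) * \<phi> z)"
    "(LINT z:?R|lborel. ln (cmod (F (?C z))) * \<phi> z) = (LINT z:?R|lborel. ?L (?C z) * \<phi> z)" for \<phi>
    unfolding set_integrable_def set_lebesgue_integral_def
    by (rule integrable_discrete_difference[OF X(1)] integral_discrete_difference[OF X(1)]; use eR in auto)+
  have s1: "set_integrable lborel {c..d} (\<lambda>y. ln (cmod (F (Complex x y))) * \<phi> y) \<longleftrightarrow> set_integrable lborel {c..d} (\<lambda>y. ?L (Complex x y) * \<phi> y)"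
    "(LINT y:{c..d}|lborel. ln (cmod (F (Complex x y))) * \<phi> y) = (LINT y:{c..d}|lborel. ?L (Complex x y) * \<phi> y)" if "x \<in> {a..b}" for \<phi> x
    unfolding set_integrable_def set_lebesgue_integral_def
    by (rule integrable_discrete_difference[OF X(2)] integral_discrete_difference[OF X(2)]; use e1 that in auto)+
  show "set_integrable lborel ?R (\<lambda>z. ln (cmod (F (?C z))) * \<phi> z)" if "continuous_on ?R \<phi>" for \<phi>
    using sR(1) L2(1)[OF that] by simp
  show int1: "set_integrable lborel {c..d} (\<lambda>y. ln (cmod (F (Complex x y))) * \<phi> y)" if "x \<in> {a..b}" "continuous_on {c..d} \<phi>" for x \<phi>
    using s1(1)[OF that(1)] L1(1)[OF that(2,1)] by simp
  fix A A' A'' B B' B'' :: "real \<Rightarrow> real"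
  assume dA: "\<And>x. (A has_real_derivative A' x) (at x)" "\<And>x. (A' has_real_derivative A'' x) (at x)"
    and dB: "\<And>x. (B has_real_derivative B' x) (at x)" "\<And>x. (B' has_real_derivative B'' x) (at x)"
    and cA: "continuous_on UNIV A''" and cB: "continuous_on UNIV B''"
    and A0: "A a = 0" and B0: "B c = 0" "B d = 0" "B' c = 0" "B' d = 0"
  have cont: "continuous_on S A" "continuous_on S B" "continuous_on S A''" "continuous_on S B''" for S
    using DERIV_continuous_on[OF has_field_derivative_at_within[OF dA(1)]] DERIV_continuous_on[OF has_field_derivative_at_within[OF dB(1)]]
      continuous_on_subset[OF cA] continuous_on_subset[OF cB] by auto
  note ci = continuous_intros continuous_on_compose2[OF cont(1)[of UNIV]] continuous_on_compose2[OF cont(2)[of UNIV]]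
     continuous_on_compose2[OF cont(3)[of UNIV]] continuous_on_compose2[OF cont(4)[of UNIV]]
  let ?D = "\<lambda>z. A'' (fst z) * B (snd z) + A (fst z) * B'' (snd z)"
  have cD: "continuous_on S ?D" for S by (intro ci) auto
  have ab: "a \<in> {a..b}" "b \<in> {a..b}" using le by auto
  have le': "a \<le> b" "c \<le> d" using le by auto
  have ZU: "w \<in> U" "Re w < b" if "w \<in> Z" for w using that nzb by (auto simp: Z_def)
  let ?la = "\<lambda>k. LINT y:{c..d}|lborel. k (Complex a y) * (A' a * B y)"
  let ?lb = "\<lambda>k k'. LINT y:{c..d}|lborel. (k (Complex b y) * A' b - k' (Complex b y) * A b) * B y"
  let ?lg = "\<lambda>w s. ln (cmod (s - w))" and ?li = "\<lambda>w s. Re (inverse (s - w))"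
  have cBk: "continuous_on {c..d} (\<lambda>y. k * B y)" for k by (intro ci) auto
  have Gg: "(LINT z:?R|lborel. Re (g (?C z)) * ?D z) = ?lb (\<lambda>s. Re (g s)) (\<lambda>s. Re (deriv g s)) - ?la (\<lambda>s. Re (g s))"
  proof -
    have i: "set_integrable lborel {c..d} (\<lambda>y. (Re (g (Complex b y)) * A' b - Re (deriv g (Complex b y)) * A b) * B y)"
      "set_integrable lborel {c..d} (\<lambda>y. Re (g (Complex a y)) * (A' a * B y))"
      by (intro set_lebesgue_integral_continuous(1) ci contx contg compact_Icc ab; simp)+
    have "(LINT z:?R|lborel. Re (g (?C z)) * ?D z) = integral ?R (\<lambda>z. Re (g (?C z)) * ?D z)"
      by (intro set_lebesgue_integral_continuous(2) continuous_on_mult contR contg cD compact_cbox)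
    also have "\<dots> = integral {c..d} (\<lambda>y. (Re (g (Complex b y)) * A' b - Re (deriv g (Complex b y)) * A b - Re (g (Complex a y)) * A' a) * B y)"
      by (rule green_rectangle_holomorphic[OF le' F(2) g F(4) dA dB cA cB A0 B0])
    also have "\<dots> = (LINT y:{c..d}|lborel. (Re (g (Complex b y)) * A' b - Re (deriv g (Complex b y)) * A b - Re (g (Complex a y)) * A' a) * B y)"
      by (intro set_lebesgue_integral_continuous(2)[symmetric] ci contx contg compact_Icc ab; simp)
    also have "\<dots> = (LINT y:{c..d}|lborel. (Re (g (Complex b y)) * A' b - Re (deriv g (Complex b y)) * A b) * B y - Re (g (Complex a y)) * (A' a * B y))"
      by (simp add: algebra_simps)
    also have "\<dots> = ?lb (\<lambda>s. Re (g s)) (\<lambda>s. Re (deriv g s)) - ?la (\<lambda>s. Re (g s))"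
      by (rule set_integral_diff(2)[OF i])
    finally show ?thesis .
  qed
  have ili: "set_integrable lborel {c..d} (\<lambda>y. (?lg w (Complex b y) * A' b - ?li w (Complex b y) * A b) * B y)" if "w \<in> Z" for w
  proof -
    have "Complex b y \<noteq> w" for y using ZU(2)[OF that] by auto
    then have "continuous_on {c..d} (\<lambda>y. (?lg w (Complex b y) * A' b - ?li w (Complex b y) * A b) * B y)"
      unfolding Complex_eq by (intro ci) (auto simp: Complex_eq)
    then show ?thesis by (intro set_lebesgue_integral_continuous(1) compact_Icc)
  qed
  have Gl: "(LINT z:?R|lborel. ?lg w (?C z) * ?D z) = ?lb (?lg w) (?li w) - ?la (?lg w) + 2 * pi * (if Re w \<in> {a..b} \<and> Im w \<in> {c..d} then A (Re w) * B (Im w) else 0)" if "w \<in> Z" for w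
  proof -
    have ne: "Re w \<noteq> b" using ZU(2)[OF that] by simp
    have "(LINT y:{c..d}|lborel. (?lg w (Complex b y) * A' b - ?li w (Complex b y) * A b - ?lg w (Complex a y) * A' a) * B y)
      = (LINT y:{c..d}|lborel. (?lg w (Complex b y) * A' b - ?li w (Complex b y) * A b) * B y - ?lg w (Complex a y) * (A' a * B y))"
      by (simp add: algebra_simps)
    also have "\<dots> = ?lb (?lg w) (?li w) - ?la (?lg w)"
      by (rule set_integral_diff(2)[OF ili[OF that] reg1[OF cBk]])
    finally show ?thesis
      using green_rectangle_log[OF le' ne dA dB cA cB A0 B0] by simp
  qed
  have dF: "Re (deriv F s / F s) = Re (deriv g s) + (\<Sum>w\<in>Z. real (n w) * ?li w s)" if "s \<in> U" "s \<notin> Z" for s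
  proof -
    have "((\<lambda>z. exp (g z) * (\<Prod>w\<in>Z. (z - w) ^ n w)) has_field_derivative
     (exp (g s) * (\<Prod>w\<in>Z. (s - w) ^ n w)) * (deriv g s + (\<Sum>w\<in>Z. of_nat (n w) * inverse (s - w)))) (at s)"
      using that g F(2) by (intro has_field_derivative_exp_times_powers finZ holomorphic_derivI) auto
    then have "(F has_field_derivative
     (exp (g s) * (\<Prod>w\<in>Z. (s - w) ^ n w)) * (deriv g s + (\<Sum>w\<in>Z. of_nat (n w) * inverse (s - w)))) (at s)"
      by (rule has_field_derivative_transform_within_open[OF _ F(2) that(1)]) (use Fg in \<open>simp add: Z_def n_def\<close>)
    then have "deriv F s = F s * (deriv g s + (\<Sum>w\<in>Z. of_nat (n w) * inverse (s - w)))"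
      using DERIV_imp_deriv Fg[OF that(1)] by (simp add: Z_def n_def)
    moreover have "F s \<noteq> 0" using that by (auto simp: Z_def)
    ultimately show ?thesis by (simp add: Re_sum del: of_nat_mult inverse_complex.simps)
  qed
  have lbF: "?lb (\<lambda>s. ln (cmod (F s))) (\<lambda>s. Re (deriv F s / F s)) = ?lb (\<lambda>s. Re (g s)) (\<lambda>s. Re (deriv g s)) + (\<Sum>w\<in>Z. real (n w) * ?lb (?lg w) (?li w))"
  proof -
    have bZ: "Complex b y \<notin> Z" for y using ZU(2) by force
    have bU: "Complex b y \<in> U" if "y \<in> {c..d}" for y using that F(4) ab by auto
    have eq: "(ln (cmod (F (Complex b y))) * A' b - Re (deriv F (Complex b y) / F (Complex b y)) * A b) * B y =
       (Re (g (Complex b y)) * A' b - Re (deriv g (Complex b y)) * A b) * B y + (\<Sum>w\<in>Z. real (n w) * ((?lg w (Complex b y) * A' b - ?li w (Complex b y) * A b) * B y))"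
      if "y \<in> {c..d}" for y
      unfolding FL[OF bU[OF that] bZ] dF[OF bU[OF that] bZ]
      by (simp add: algebra_simps sum_distrib_left sum.distrib sum_subtractf del: inverse_complex.simps)
    have i1: "set_integrable lborel {c..d} (\<lambda>y. (Re (g (Complex b y)) * A' b - Re (deriv g (Complex b y)) * A b) * B y)"
      by (intro set_lebesgue_integral_continuous(1) ci contx contg compact_Icc ab; simp)
    have i2: "set_integrable lborel {c..d} (\<lambda>y. real (n w) * ((?lg w (Complex b y) * A' b - ?li w (Complex b y) * A b) * B y))" if "w \<in> Z" for w
      using ili[OF that] by (intro set_integrable_mult_right) auto
    have i3: "set_integrable lborel {c..d} (\<lambda>y. \<Sum>w\<in>Z. real (n w) * ((?lg w (Complex b y) * A' b - ?li w (Complex b y) * A b) * B y))"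
      using i2 by (rule set_integrable_sum(1))
    have "?lb (\<lambda>s. ln (cmod (F s))) (\<lambda>s. Re (deriv F s / F s)) = 
      (LINT y:{c..d}|lborel. (Re (g (Complex b y)) * A' b - Re (deriv g (Complex b y)) * A b) * B y + (\<Sum>w\<in>Z. real (n w) * ((?lg w (Complex b y) * A' b - ?li w (Complex b y) * A b) * B y)))"
      by (intro set_lebesgue_integral_cong) (use eq in auto)
    also have "\<dots> = ?lb (\<lambda>s. Re (g s)) (\<lambda>s. Re (deriv g s)) + (LINT y:{c..d}|lborel. (\<Sum>w\<in>Z. real (n w) * ((?lg w (Complex b y) * A' b - ?li w (Complex b y) * A b) * B y)))"
      by (rule set_integral_add(2)[OF i1 i3])
    also have "(LINT y:{c..d}|lborel. (\<Sum>w\<in>Z. real (n w) * ((?lg w (Complex b y) * A' b - ?li w (Complex b y) * A b) * B y)))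
       = (\<Sum>w\<in>Z. (LINT y:{c..d}|lborel. real (n w) * ((?lg w (Complex b y) * A' b - ?li w (Complex b y) * A b) * B y)))"
      using i2 by (rule set_integrable_sum(2))
    finally show ?thesis by (simp del: inverse_complex.simps)
  qed
  let ?W = "{w. a \<le> Re w \<and> Re w \<le> b \<and> Im w \<in> {c..d} \<and> F w = 0}"
  have WZ: "?W = {w\<in>Z. Re w \<in> {a..b} \<and> Im w \<in> {c..d}}"
  proof -
    have "w \<in> U" if "a \<le> Re w" "Re w \<le> b" "c \<le> Im w" "Im w \<le> d" for w using F(4)[of "Re w" "Im w"] that by simp
    then show ?thesis by (auto simp: Z_def)
  qed
  have e1: "(LINT z:?R|lborel. ln (cmod (F (?C z))) * ?D z) = (LINT z:?R|lborel. Re (g (?C z)) * ?D z) + (\<Sum>w\<in>Z. real (n w) * (LINT z:?R|lborel. ?lg w (?C z) * ?D z))"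
    unfolding sR(2) by (rule L2(2)[OF cD])
  \<comment> \<open>The factorisation runs over all zeros in the larger set \<open>U\<close>; those
    outside the closed rectangle enter with value 0 and drop out here.\<close>
  have e2: "(\<Sum>w\<in>Z. if Re w \<in> {a..b} \<and> Im w \<in> {c..d} then real (n w) * A (Re w) * B (Im w) else 0)
     = (\<Sum>w\<in>?W. real_of_int (zorder F w) * A (Re w) * B (Im w))" (is "?Q = _")
  proof -
    have "?Q = (\<Sum>w\<in>?W. real (n w) * A (Re w) * B (Im w))"
      unfolding WZ by (rule sum.inter_filter[symmetric, OF finZ])
    also have "\<dots> = (\<Sum>w\<in>?W. real_of_int (zorder F w) * A (Re w) * B (Im w))"
    proof (rule sum.cong[OF refl])
      fix w assume "w \<in> ?W"
      then have "w \<in> Z" unfolding WZ by blast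
      then have "0 < zorder F w" using pos by (simp add: Z_def)
      then show "real (n w) * A (Re w) * B (Im w) = real_of_int (zorder F w) * A (Re w) * B (Im w)" by (simp add: n_def)
    qed
    finally show ?thesis .
  qed
  define lbw where "lbw w = ?lb (?lg w) (?li w)" for w
  define law where "law w = ?la (?lg w)" for w
  define Lw where "Lw w = (LINT z:?R|lborel. ?lg w (?C z) * ?D z)" for w
  have e3: "(\<Sum>w\<in>Z. real (n w) * Lw w) = (\<Sum>w\<in>Z. real (n w) * lbw w) - (\<Sum>w\<in>Z. real (n w) * law w) + 2 * pi * ?Q"
  proof -
    have "(\<Sum>w\<in>Z. real (n w) * Lw w) = (\<Sum>w\<in>Z. real (n w) * lbw w - real (n w) * law w
       + 2 * pi * (if Re w \<in> {a..b} \<and> Im w \<in> {c..d} then real (n w) * A (Re w) * B (Im w) else 0))"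
    proof (rule sum.cong[OF refl])
      fix w assume "w \<in> Z"
      then have "Lw w = lbw w - law w + 2 * pi * (if Re w \<in> {a..b} \<and> Im w \<in> {c..d} then A (Re w) * B (Im w) else 0)"
        unfolding Lw_def lbw_def law_def by (rule Gl)
      then show "real (n w) * Lw w = real (n w) * lbw w - real (n w) * law w
       + 2 * pi * (if Re w \<in> {a..b} \<and> Im w \<in> {c..d} then real (n w) * A (Re w) * B (Im w) else 0)"
        by (simp only:) (simp add: right_diff_distrib distrib_left)
    qed
    then show ?thesis by (simp only: sum.distrib sum_subtractf sum_distrib_left)
  qed
  have ar: "p - q + (u - v + t) = p + u - (q + v) + t" for p q u v t :: real by simp
  show "(LINT z:?R|lborel. ln (cmod (F (?C z))) * ?D z) = ?lb (\<lambda>s. ln (cmod (F s))) (\<lambda>s. Re (deriv F s / F s)) - ?la (\<lambda>s. ln (cmod (F s)))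
    + 2 * pi * (\<Sum>w\<in>?W. real_of_int (zorder F w) * A (Re w) * B (Im w))"
    unfolding e1 e3[unfolded Lw_def] e2 Gg lbF s1(2)[OF ab(1)] L1(2)[OF cBk ab(1)] lbw_def law_def by (rule ar)
qed

section \<open>Fatou's theorem in the half-plane\<close>

text \<open>Lebesgue differentiation with averages over \<open>[x, x + h]\<close>, hence a one-sided
  derivative.\<close>

lemma AE_right_derivative_of_integral:
  fixes g :: "real \<Rightarrow> real" and H :: "real \<Rightarrow> real"
  assumes "\<And>a b. a \<le> b \<Longrightarrow> (g has_integral (H b - H a)) {a..b}"
  shows "\<exists>N. negligible N \<and> (\<forall>x. x \<notin> N \<longrightarrow> (H has_real_derivative g x) (at_right x))"
proof -
  have "g integrable_on cbox a b" for a b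
    using assms[of a b] by (cases "a \<le> b") auto
  then obtain N where N: "negligible N" "\<And>x e. \<lbrakk>x \<notin> N; 0 < e\<rbrakk> \<Longrightarrow>
     \<exists>d>0. \<forall>h. 0 < h \<and> h < d \<longrightarrow> norm(integral (cbox x (x + h *\<^sub>R One)) g /\<^sub>R h ^ DIM(real) - g x) < e"
    by (rule integrable_ccontinuous_explicit) (erule that, blast)
  have "(H has_real_derivative g x) (at_right x)" if x: "x \<notin> N" for x
  proof -
    have "((\<lambda>y. (H y - H x) / (y - x)) \<longlongrightarrow> g x) (at_right x)"
    proof (rule tendstoI)
      fix e :: real assume "e > 0"
      then obtain d where d: "d > 0" "\<And>h. 0 < h \<Longrightarrow> h < d \<Longrightarrow> norm(integral (cbox x (x + h *\<^sub>R One)) g /\<^sub>R h ^ DIM(real) - g x) < e"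
        using N(2)[OF x] by blast
      have "dist ((H y - H x) / (y - x)) (g x) < e" if "x < y" "y < x + d" for y
      proof -
        have "integral {x..y} g = H y - H x" using assms[of x y] that by (simp add: integral_unique)
        then show ?thesis using d(2)[of "y - x"] that by (simp add: dist_norm divide_inverse mult.commute)
      qed
      then show "\<forall>\<^sub>F y in at_right x. dist ((H y - H x) / (y - x)) (g x) < e"
        using d(1) by (intro eventually_at_rightI[of x "x + d"]) auto
    qed
    then show ?thesis by (simp add: has_field_derivative_iff)
  qed
  then show ?thesis using N(1) by blast
qed

text \<open>The left derivative of \<open>H\<close> is the right derivative of
  \<open>- H (- x)\<close> at the reflected point; reflection preserves negligible sets.\<close>

lemma AE_derivative_of_integral:
  fixes g :: "real \<Rightarrow> real" and H :: "real \<Rightarrow> real"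
  assumes H: "\<And>a b. a \<le> b \<Longrightarrow> (g has_integral (H b - H a)) {a..b}"
  shows "\<exists>N. negligible N \<and> (\<forall>x. x \<notin> N \<longrightarrow> (H has_real_derivative g x) (at x))"
proof -
  have "((\<lambda>x. g (-x)) has_integral (- H (-b) - (- H (-a)))) {a..b}" if "a \<le> b" for a b
    using H[of "-b" "-a"] that has_integral_reflect_real[where f = g and a = "-b" and b = "-a"] by simp
  from AE_right_derivative_of_integral[OF this] obtain N1 where
    N1: "negligible N1" "\<And>x. x \<notin> N1 \<Longrightarrow> ((\<lambda>x. - H (-x)) has_real_derivative g (-x)) (at_right x)"
    by blast
  obtain N2 where N2: "negligible N2" "\<And>x. x \<notin> N2 \<Longrightarrow> (H has_real_derivative g x) (at_right x)"
    using AE_right_derivative_of_integral[OF H] by blast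
  have "negligible (uminus ` N1)"
    using N1(1) by (rule negligible_differentiable_image_negligible[OF order_refl])
      (auto intro!: linear_imp_differentiable_on linear_uminus)
  moreover have "(H has_real_derivative g x) (at x)" if "x \<notin> uminus ` N1 \<union> N2" for x
  proof -
    have "- x \<notin> N1" using that by (metis UnI1 image_eqI minus_minus)
    then have "((\<lambda>y. (- H (-y) - (- H x)) / (y - (- x))) \<longlongrightarrow> g x) (at_right (- x))"
      using N1(2)[of "-x"] by (simp add: has_field_derivative_iff)
    then have "((\<lambda>y. (- H y - (- H x)) / (- y - (- x))) \<longlongrightarrow> g x) (at_left x)"
      by (simp add: at_right_minus filterlim_filtermap)
    moreover have "(- H y - (- H x)) / (- y - (- x)) = (H y - H x) / (y - x)" for y
      by (simp add: divide_simps) (auto simp: algebra_simps)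
    ultimately have "((\<lambda>y. (H y - H x) / (y - x)) \<longlongrightarrow> g x) (at_left x)" by simp
    moreover have "((\<lambda>y. (H y - H x) / (y - x)) \<longlongrightarrow> g x) (at_right x)"
      using N2(2)[of x] that by (simp add: has_field_derivative_iff)
    ultimately show ?thesis
      by (simp add: has_field_derivative_iff filterlim_at_split)
  qed
  ultimately show ?thesis using N2(1) by (meson negligible_Un)
qed

text \<open>Both \<open>H\<close> and \<open>K x = x - H x\<close> are continuous and nondecreasing,
  and their Stieltjes measures add up to Lebesgue measure. So the measure of \<open>H\<close> is
  absolutely continuous, and its Radon-Nikodym density is the integrand.\<close>

lemma monotone_contraction_is_integral:
  fixes H :: "real \<Rightarrow> real"
  assumes mono: "\<And>x y. x \<le> y \<Longrightarrow> H x \<le> H y" and lip: "\<And>x y. x \<le> y \<Longrightarrow> H y - H x \<le> y - x"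
  obtains g where "\<And>a b. a \<le> b \<Longrightarrow> (g has_integral (H b - H a)) {a..b}"
proof -
  define K where "K x = x - H x" for x
  have monoK: "x \<le> y \<Longrightarrow> K x \<le> K y" for x y using lip[of x y] by (simp add: K_def)
  have contH: "continuous_on UNIV H"
  proof (rule lipschitz_on_continuous_on[of 1])
    show "1-lipschitz_on UNIV H"
    proof (rule lipschitz_onI)
      show "dist (H x) (H y) \<le> 1 * dist x y" for x y
        using mono[of x y] mono[of y x] lip[of x y] lip[of y x] by (cases "x \<le> y") (auto simp: dist_real_def)
    qed simp
  qed
  then have contK: "continuous_on UNIV K" unfolding K_def by (intro continuous_intros)
  let ?M = "interval_measure H" and ?N = "interval_measure K"
  define S where "S = measure_of UNIV (sets borel) (\<lambda>A. emeasure ?M A + emeasure ?N A)"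
  have S: "emeasure S A = emeasure ?M A + emeasure ?N A" if "A \<in> sets borel" for A :: "real set"
    unfolding S_def
  proof (rule emeasure_measure_of_sigma[OF _ _ _ that])
    show "sigma_algebra UNIV (sets (borel :: real measure))" using sets.sigma_algebra_axioms[of borel] by simp
    show "positive (sets borel) (\<lambda>A. emeasure ?M A + emeasure ?N A)" by (simp add: positive_def)
    show "countably_additive (sets borel) (\<lambda>A. emeasure ?M A + emeasure ?N A)"
      unfolding countably_additive_def
    proof (intro allI impI)
      fix A :: "nat \<Rightarrow> real set" assume A: "range A \<subseteq> sets borel" "disjoint_family A" "\<Union> (range A) \<in> sets borel"
      have "(\<Sum>i. emeasure ?M (A i)) = emeasure ?M (\<Union> (range A))" "(\<Sum>i. emeasure ?N (A i)) = emeasure ?N (\<Union> (range A))"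
        using A by (auto intro!: suminf_emeasure)
      then show "(\<Sum>i. emeasure ?M (A i) + emeasure ?N (A i)) = emeasure ?M (\<Union> (range A)) + emeasure ?N (\<Union> (range A))"
        by (subst suminf_add[symmetric]) auto
    qed
  qed
  have setsS: "sets S = sets borel" unfolding S_def using sets.sigma_sets_eq[of "borel :: real measure"] by (simp add: sets_measure_of_conv)
  have Ioo: "emeasure (interval_measure F) {a<..<b} = ennreal (F b - F a)"
    if "a \<le> b" "\<And>x y. x \<le> y \<Longrightarrow> F x \<le> F y" "continuous_on UNIV F" for a b and F :: "real \<Rightarrow> real"
  proof -
    have z: "emeasure (interval_measure F) {x} = 0" for x
      using emeasure_interval_measure_Icc[OF order_refl that(2,3), of x] by simp
    have "{a,b} \<in> null_sets (interval_measure F)"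
      using null_sets.Un[of "{a}" "interval_measure F" "{b}"] z by (auto simp: null_sets_def insert_commute)
    then have "emeasure (interval_measure F) ({a..b} - {a,b}) = emeasure (interval_measure F) {a..b}"
      by (intro emeasure_Diff_null_set) auto
    moreover have "{a..b} - {a,b} = {a<..<b}" by auto
    ultimately show ?thesis using emeasure_interval_measure_Icc[OF that] by simp
  qed
  have lbS: "lborel = S"
  proof (rule lborel_eqI)
    show "sets S = sets borel" by (rule setsS)
    fix l u :: real assume "\<And>b. b \<in> Basis \<Longrightarrow> l \<bullet> b \<le> u \<bullet> b"
    then have lu: "l \<le> u" by simp
    have "emeasure S {l<..<u} = ennreal (H u - H l) + ennreal (K u - K l)"
      using S[of "{l<..<u}"] Ioo[OF lu mono contH] Ioo[OF lu monoK contK] by simp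
    also have "\<dots> = ennreal (u - l)"
      using mono[OF lu] monoK[OF lu] by (subst ennreal_plus[symmetric]) (auto simp: K_def)
    finally show "emeasure S (box l u) = (\<Prod>b\<in>Basis. (u - l) \<bullet> b)" by simp
  qed
  have ac: "absolutely_continuous lborel ?M"
    unfolding absolutely_continuous_def
  proof
    fix A :: "real set" assume A: "A \<in> null_sets lborel"
    then have A': "emeasure lborel A = 0" "A \<in> sets borel" by (auto simp: null_sets_def)
    have "emeasure ?M A + emeasure ?N A = 0" using S[OF A'(2)] A'(1) unfolding lbS[symmetric] by simp
    then show "A \<in> null_sets ?M" using A'(2) by (auto simp: null_sets_def)
  qed
  have "\<exists>f \<in> borel_measurable lborel. density lborel f = ?M"
    by (rule sigma_finite_measure.Radon_Nikodym[OF sigma_finite_lborel ac])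
       (simp only: sets_interval_measure sets_lborel)
  then obtain f where f: "f \<in> borel_measurable lborel" "density lborel f = ?M"
    by blast
  have em: "(\<integral>\<^sup>+x. f x * indicator {a..b} x \<partial>lborel) = ennreal (H b - H a)" if "a \<le> b" for a b
  proof -
    have "(\<integral>\<^sup>+x. f x * indicator {a..b} x \<partial>lborel) = emeasure (density lborel f) {a..b}"
      by (rule emeasure_density[OF f(1), symmetric]) simp
    then show ?thesis using emeasure_interval_measure_Icc[OF that mono contH] by (simp add: f(2))
  qed
  \<comment> \<open>The density takes values in \<open>ennreal\<close>; it is finite almost
    everywhere because its integral over each \<open>[- n, n]\<close> is finite.\<close>
  have fin: "AE x in lborel. f x < \<infinity>"
  proof -
    have "AE x in lborel. f x * indicator {- real n..real n} x \<noteq> \<infinity>" for n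
      using em[of "- real n" "real n"] f(1) by (intro nn_integral_PInf_AE) auto
    then have "AE x in lborel. \<forall>n. f x * indicator {- real n..real n} x \<noteq> \<infinity>" by (simp add: AE_all_countable)
    then show ?thesis
    proof eventually_elim
      case (elim x)
      obtain n where "\<bar>x\<bar> \<le> real n" using real_arch_simple by blast
      then have "x \<in> {- real n..real n}" by auto
      then show ?case using elim[rule_format, of n] by (simp add: less_top)
    qed
  qed
  have "((\<lambda>x. enn2real (f x)) has_integral (H b - H a)) {a..b}" if ab: "a \<le> b" for a b
  proof -
    have "(\<integral>\<^sup>+x. ennreal (indicator {a..b} x * enn2real (f x)) \<partial>lborel) = (\<integral>\<^sup>+x. f x * indicator {a..b} x \<partial>lborel)"
      using fin by (intro nn_integral_cong_AE) (auto elim!: eventually_mono split: split_indicator)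
    then have "has_bochner_integral lborel (\<lambda>x. indicator {a..b} x * enn2real (f x)) (H b - H a)"
      using em[OF ab] f(1) mono[OF ab] by (intro has_bochner_integral_nn_integral) auto
    then have "integrable lborel (\<lambda>x. indicator {a..b} x * enn2real (f x))"
        "(\<integral>x. indicator {a..b} x * enn2real (f x) \<partial>lborel) = H b - H a"
      by (simp_all only: has_bochner_integral_iff)
    with has_integral_integral_lborel[OF this(1)]
    have "((\<lambda>x. indicator {a..b} x * enn2real (f x)) has_integral (H b - H a)) UNIV"
      by (simp only:)
    moreover have "(\<lambda>x. indicator {a..b} x * enn2real (f x)) = (\<lambda>x. if x \<in> {a..b} then enn2real (f x) else 0)"
      by (auto simp: fun_eq_iff)
    ultimately show ?thesis
      using has_integral_restrict_UNIV[of "{a..b}" "\<lambda>x. enn2real (f x)"] by (simp only:)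
  qed
  then show ?thesis by (rule that)
qed

text \<open>Rademacher's theorem on the line. The function \<open>(h x / M + x) / 2\<close> is
  nondecreasing and a contraction, hence the integral of a density, and \<open>h\<close> is
  recovered from it by an affine formula.\<close>

lemma lipschitz_AE_differentiable:
  fixes h :: "real \<Rightarrow> real"
  assumes lip: "L-lipschitz_on UNIV h"
  shows "\<exists>N. negligible N \<and> (\<forall>x. x \<notin> N \<longrightarrow> (\<exists>D. (h has_real_derivative D) (at x)))"
proof -
  \<comment> \<open>\<open>L\<close> may be 0; adding 1 permits the division.\<close>
  define M where "M = L + 1"
  have M: "M > 0" using lipschitz_on_nonneg[OF lip] by (simp add: M_def)
  have l: "\<bar>h y - h x\<bar> \<le> M * (y - x)" if "x \<le> y" for x y
  proof -
    have "\<bar>h y - h x\<bar> \<le> L * (y - x)" using lipschitz_onD[OF lip, of y x] that by (simp add: dist_real_def)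
    also have "\<dots> \<le> M * (y - x)" using that by (simp add: M_def mult_right_mono)
    finally show ?thesis .
  qed
  define H where "H x = (h x / M + x) / 2" for x
  have d: "\<bar>h y / M - h x / M\<bar> \<le> y - x" if "x \<le> y" for x y
  proof -
    have "\<bar>h y / M - h x / M\<bar> = \<bar>h y - h x\<bar> / M"
      using M unfolding diff_divide_distrib[symmetric] abs_divide by simp
    also have "\<dots> \<le> y - x"
      unfolding pos_divide_le_eq[OF M] using l[OF that] by (simp only: mult.commute)
    finally show ?thesis .
  qed
  have Hm: "H x \<le> H y" "H y - H x \<le> y - x" if "x \<le> y" for x y
  proof -
    have "2 * (H y - H x) = (h y / M - h x / M) + (y - x)"
    proof -
      have "2 * ((u + y) / 2 - (v + x) / 2) = (u - v) + (y - x)" for u v :: real by (simp add: field_simps)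
      then show ?thesis unfolding H_def .
    qed
    moreover have "h y / M - h x / M \<le> y - x" "- (h y / M - h x / M) \<le> y - x"
      using d[OF that] by (simp_all only: abs_le_iff)
    ultimately have *: "2 * (H y - H x) \<le> 2 * (y - x)" "0 \<le> 2 * (H y - H x)" by simp_all
    show "H x \<le> H y" using * by simp
    show "H y - H x \<le> y - x" using * by simp
  qed
  obtain g where "\<And>a b. a \<le> b \<Longrightarrow> (g has_integral (H b - H a)) {a..b}"
    by (rule monotone_contraction_is_integral[of H, OF Hm]) blast+
  then have "\<exists>N. negligible N \<and> (\<forall>x. x \<notin> N \<longrightarrow> (H has_real_derivative g x) (at x))"
    by (rule AE_derivative_of_integral)
  then obtain N where N: "negligible N" "\<And>x. x \<notin> N \<Longrightarrow> (H has_real_derivative g x) (at x)"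
    by blast
  have "(h has_real_derivative M * (2 * g x - 1)) (at x)" if "x \<notin> N" for x
  proof -
    have "((\<lambda>x. M * (2 * H x - x)) has_real_derivative M * (2 * g x - 1)) (at x)"
      using N(2)[OF that] by (auto intro!: derivative_eq_intros)
    moreover have "(\<lambda>x. M * (2 * H x - x)) = h" using M by (auto simp: H_def fun_eq_iff field_simps)
    ultimately show ?thesis by simp
  qed
  then show ?thesis using N(1) by blast
qed

text \<open>The maximum principle applied to \<open>G z / z\<close>, which has no limit at \<open>0\<close>: the factor
  \<open>exp (- A sqrt z)\<close> makes it small on the arc, and the \<open>n\<close>-th power times one factor \<open>z\<close> makes it continuous at \<open>0\<close>.\<close>

lemma small_on_axis_imp_small_in_halfplane:
  fixes G :: "complex \<Rightarrow> complex"
  assumes cont: "continuous_on {w. Re w \<ge> 0} G" and hol: "G holomorphic_on {w. Re w > 0}"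
    and bd: "\<And>w. Re w \<ge> 0 \<Longrightarrow> cmod (G w) \<le> C * cmod w" and C: "C > 0"
    and axis: "\<And>e. e > 0 \<Longrightarrow> \<exists>d>0. \<forall>w. Re w = 0 \<longrightarrow> cmod w \<le> d \<longrightarrow> cmod (G w) \<le> e * cmod w"
    and e: "e > 0"
  shows "\<exists>d>0. \<forall>w. Re w > 0 \<longrightarrow> cmod w < d \<longrightarrow> cmod (G w) \<le> e * cmod w"
proof -
  obtain d where d: "d > 0" "\<And>w. Re w = 0 \<Longrightarrow> cmod w \<le> d \<Longrightarrow> cmod (G w) \<le> e / 2 * cmod w"
    using axis[of "e/2"] e by auto
  \<comment> \<open>On the arc \<open>|z| = d\<close> with \<open>Re z \<ge> 0\<close>, the real
    part of \<open>csqrt z\<close>, which is \<open>sqrt ((|z| + Re z) / 2)\<close>, is at least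
    \<open>s\<close>. \<open>A\<close> is chosen so that
    \<open>C * exp (- (A * s)) \<le> e / 2\<close>.\<close>
  define s where "s = sqrt (d / 2)"
  define A where "A = C / (e / 2 * s)"
  have s: "s > 0" using d by (simp add: s_def)
  have A: "A > 0" using s C e by (simp add: A_def)
  have CA: "C * exp (- (A * s)) \<le> e / 2"
  proof -
    have As: "A * s = 2 * C / e" using s e by (simp add: A_def)
    have "1 + 2 * C / e \<le> exp (2 * C / e)" by (rule exp_ge_add_one_self)
    then have "C \<le> e / 2 * exp (2 * C / e)" using e by (simp add: field_simps)
    then show ?thesis unfolding As by (simp add: exp_minus field_simps)
  qed
  define E where "E w = exp (- (of_real A * csqrt w))" for w
  have cmodE: "cmod (E w) = exp (- (A * Re (csqrt w)))" for w by (simp add: E_def norm_exp_eq_Re)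
  have E1: "cmod (E w) \<le> 1" for w using A Re_csqrt[of w] by (simp add: cmodE)
  let ?S = "{w. Re w > 0} \<inter> ball 0 d"
  have q: "cmod (G w) / cmod w * cmod (E w) \<le> e / 2" if w: "w \<in> ?S" for w
  proof (rule ccontr)
    define qq where "qq = cmod (G w) / cmod w * cmod (E w)"
    assume "\<not> cmod (G w) / cmod w * cmod (E w) \<le> e / 2"
    then have "e / 2 < qq" by (simp add: qq_def)
    then have "1 < qq / (e / 2)" using e by (simp add: less_divide_eq)
    \<comment> \<open>If the bound \<open>e / 2\<close> failed at \<open>w\<close>, a high enough
      power would beat the ratio \<open>d / cmod w\<close> that the extra factor \<open>z\<close> in
      \<open>W\<close> costs.\<close>
    then obtain n where n: "d / cmod w < (qq / (e / 2)) ^ n" using real_arch_pow by blast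
    have w0: "w \<noteq> 0" "cmod w > 0" using w by auto
    define W where "W z = z * (G z / z * E z) ^ n" for z
    have Wb: "cmod (W z) \<le> d * (e / 2) ^ n" if "cmod z \<le> d" "cmod (G z) / cmod z * cmod (E z) \<le> e / 2" for z
      unfolding W_def norm_mult norm_power norm_divide using that e d(1) 
      by (intro mult_mono power_mono) auto
    have Wb0: "cmod (W z) \<le> cmod z * C ^ n" if "Re z \<ge> 0" for z
    proof (cases "z = 0")
      case False
      have "cmod (G z) / cmod z * cmod (E z) \<le> C * 1"
        using bd[OF that] False C by (intro mult_mono E1) (simp_all add: pos_divide_le_eq)
      then show ?thesis unfolding W_def norm_mult norm_power norm_divide
        by (intro mult_left_mono power_mono) auto
    qed (simp add: W_def)
    have "cmod (W w) \<le> d * (e / 2) ^ n"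
    proof (rule maximum_modulus_frontier[where S = ?S and f = W and \<xi> = w])
      have cl: "closure ?S \<subseteq> {z. Re z \<ge> 0} \<inter> cball 0 d"
      proof (rule closure_minimal)
        show "closed ({z. Re z \<ge> 0} \<inter> cball 0 d)" by (intro closed_Int closed_halfspace_Re_ge closed_cball)
      qed auto
      show "W holomorphic_on interior ?S"
      proof -
        have "z \<notin> \<real>\<^sub>\<le>\<^sub>0" "z \<noteq> 0" if "Re z > 0" for z using that by (auto simp: complex_nonpos_Reals_iff)
        then have "W holomorphic_on ?S" unfolding W_def E_def
          by (intro holomorphic_intros holomorphic_on_subset[OF hol]) auto
        then show ?thesis by (rule holomorphic_on_subset) (rule interior_subset)
      qed
      show "continuous_on (closure ?S) W"
      proof (rule continuous_on_subset[OF _ order_trans[OF cl Int_lower1]])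
        show "continuous_on {z. Re z \<ge> 0} W"
          unfolding continuous_on_eq_continuous_within
        proof
          fix z assume z: "z \<in> {z. Re z \<ge> 0}"
          show "continuous (at z within {z. Re z \<ge> 0}) W"
          proof (cases "z = 0")
            case True
            have "((\<lambda>w. cmod w * C ^ n) \<longlongrightarrow> cmod 0 * C ^ n) (at 0 within {z. Re z \<ge> 0})"
              by (intro tendsto_intros)
            then have "(W \<longlongrightarrow> 0) (at 0 within {z. Re z \<ge> 0})"
              by (intro Lim_null_comparison[of W "\<lambda>w. cmod w * C ^ n"]) (auto simp: eventually_at_filter Wb0)
            then show ?thesis using True by (simp add: continuous_within W_def)
          next
            case False
            then have "z \<notin> \<real>\<^sub>\<le>\<^sub>0" using z by (auto simp: complex_nonpos_Reals_iff complex_eq_iff)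
            then have "continuous (at z within {z. Re z \<ge> 0}) csqrt" by (rule continuous_within_csqrt)
            moreover have "continuous (at z within {z. Re z \<ge> 0}) G" using cont z by (simp add: continuous_on_eq_continuous_within)
            ultimately show ?thesis unfolding W_def E_def using False by (intro continuous_intros) auto
          qed
        qed
      qed
      show "bounded ?S" by (rule bounded_subset[OF bounded_ball]) auto
      show "w \<in> ?S" by (rule w)
      fix z assume z: "z \<in> frontier ?S"
      have "open ?S" by (intro open_Int open_halfspace_Re_gt open_ball)
      then have "z \<notin> ?S" using z by (metis IntI empty_iff frontier_disjoint_eq)
      moreover have "z \<in> closure ?S" using z unfolding frontier_def by (rule DiffD1)
      ultimately have zc: "z \<in> closure ?S" "z \<notin> ?S" by blast+
      then have "z \<in> {z. Re z \<ge> 0} \<inter> cball 0 d" using cl by blast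
      then have zz: "Re z \<ge> 0" "cmod z \<le> d" by simp_all
      show "cmod (W z) \<le> d * (e / 2) ^ n"
      proof (rule Wb[OF zz(2)])
        show "cmod (G z) / cmod z * cmod (E z) \<le> e / 2"
        proof (cases "z = 0")
          case False
          show ?thesis
          proof (cases "Re z = 0")
            case True
            have b: "cmod (G z) / cmod z \<le> e / 2"
              using d(2)[OF True zz(2)] False by (subst pos_divide_le_eq) simp_all
            have "cmod (G z) / cmod z * cmod (E z) \<le> (e / 2) * 1"
              using e by (intro mult_mono b E1) simp_all
            then show ?thesis by simp
          next
            case f: False
            then have dz: "cmod z = d" using zc(2) zz by simp
            have "cmod (E z) \<le> exp (- (A * s))"
            proof -
              have "s \<le> Re (csqrt z)" using zz dz by (simp add: s_def)
              then show ?thesis using A by (simp add: cmodE)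
            qed
            moreover have b: "cmod (G z) / cmod z \<le> C"
              using bd[OF zz(1)] False by (subst pos_divide_le_eq) simp_all
            ultimately have "cmod (G z) / cmod z * cmod (E z) \<le> C * exp (- (A * s))"
              using C by (intro mult_mono) simp_all
            from this CA show ?thesis by (rule order_trans)
          qed
        next
          case True
          then show ?thesis using e by simp
        qed
      qed
    qed
    then have "cmod w * qq ^ n \<le> d * (e / 2) ^ n" by (simp only: W_def qq_def norm_mult norm_power norm_divide)
    then have "(qq / (e / 2)) ^ n \<le> d / cmod w" using w0 e by (simp add: power_divide field_simps)
    then show False using n by simp
  qed
  \<comment> \<open>Within this radius \<open>exp (- A sqrt |w|)\<close> is at least
    \<open>1 / 2\<close>, so removing the factor doubles the bound \<open>e / 2\<close> at
    most.\<close>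
  define r where "r = min d ((ln 2 / A)^2)"
  have "r > 0" using d A by (simp add: r_def)
  moreover have "cmod (G w) \<le> e * cmod w" if w: "Re w > 0" "cmod w < r" for w
  proof -
    have w0: "cmod w > 0" using w by auto
    have "A * Re (csqrt w) \<le> ln 2"
    proof -
      have "Re (csqrt w) \<le> cmod (csqrt w)" by (rule complex_Re_le_cmod)
      also have "\<dots> = sqrt (cmod w)" by simp
      also have "\<dots> \<le> sqrt ((ln 2 / A)^2)" using w by (intro real_sqrt_le_mono) (simp add: r_def)
      also have "\<dots> = ln 2 / A" using A by simp
      finally show ?thesis using A by (simp add: field_simps)
    qed
    then have "exp (- ln 2) \<le> exp (- (A * Re (csqrt w)))" by simp
    then have E2: "1 / 2 \<le> cmod (E w)" unfolding cmodE by (simp add: exp_minus)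
    have "cmod (G w) / cmod w * (1 / 2) \<le> cmod (G w) / cmod w * cmod (E w)" using E2 by (intro mult_left_mono) auto
    also have "\<dots> \<le> e / 2" using q[of w] w by (simp add: r_def)
    finally show ?thesis using w0 by (simp add: field_simps)
  qed
  ultimately show ?thesis by blast
qed

text \<open>A primitive \<open>G\<close> of \<open>f\<close> is Lipschitz up to the imaginary axis, hence differentiable along it almost
  everywhere. At such a point the tangential derivative forces \<open>G\<close> to be differentiable from inside the half-plane,
  and Cauchy's estimate turns this into a limit of \<open>f\<close>.\<close>

theorem Fatou_halfplane:
  fixes f :: "complex \<Rightarrow> complex"
  assumes hol: "f holomorphic_on {w. Re w > 0}" and bd: "\<And>w. Re w > 0 \<Longrightarrow> cmod (f w) \<le> C"
  shows "\<exists>N. negligible N \<and> (\<forall>\<tau>. \<tau> \<notin> N \<longrightarrow> (\<exists>l. ((\<lambda>\<sigma>. f (Complex \<sigma> \<tau>)) \<longlongrightarrow> l) (at_right 0)))"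
proof -
  let ?H = "{w::complex. Re w > 0}"
  have H: "open ?H" "convex ?H" "closure ?H = {w. Re w \<ge> 0}"
    using closure_halfspace_gt[of "1::complex" 0]
    by (simp_all add: open_halfspace_Re_gt convex_halfspace_Re_gt inner_complex_def)
  obtain G0 where G0: "\<And>x. x \<in> ?H \<Longrightarrow> (G0 has_field_derivative f x) (at x within ?H)"
    using holomorphic_convex_primitive'[OF H(2,1) hol] by blast
  have C0: "C \<ge> 0" using order_trans[OF norm_ge_zero bd[of 1]] by simp
  have "C-lipschitz_on ?H G0"
    using field_differentiable_bound[OF H(2) G0] bd C0 by (intro lipschitz_onI) (auto simp: dist_norm)
  from lipschitz_extend_closure[OF this]
  obtain G where G: "C-lipschitz_on (closure ?H) G" "\<forall>x\<in>?H. G x = G0 x" by blast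
  have GL: "cmod (G z - G w) \<le> C * cmod (z - w)" if "Re z \<ge> 0" "Re w \<ge> 0" for z w
    using lipschitz_onD[OF G(1), of z w] that H(3) by (simp add: dist_norm)
  have Gd: "(G has_field_derivative f x) (at x)" if "x \<in> ?H" for x
  proof -
    have "(G0 has_field_derivative f x) (at x)" using G0[OF that] by (simp only: at_within_open[OF that H(1)])
    then show ?thesis by (rule has_field_derivative_transform_within_open[OF _ H(1) that]) (use G(2) in simp)
  qed
  define h where "h \<tau> = G (Complex 0 \<tau>)" for \<tau>
  have "cmod (h x - h y) \<le> C * \<bar>x - y\<bar>" for x y
  proof -
    have "cmod (Complex 0 x - Complex 0 y) = \<bar>x - y\<bar>" by (simp add: cmod_def)
    then show ?thesis using GL[of "Complex 0 x" "Complex 0 y"] by (simp add: h_def)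
  qed
  then have hL: "cmod (h x - h y) \<le> C * dist x y" for x y by (simp add: dist_real_def)
  have "\<bar>Re (h x) - Re (h y)\<bar> \<le> C * dist x y" "\<bar>Im (h x) - Im (h y)\<bar> \<le> C * dist x y" for x y
    using order_trans[OF abs_Re_le_cmod hL[of x y]] order_trans[OF abs_Im_le_cmod hL[of x y]] by simp_all
  then have "C-lipschitz_on UNIV (\<lambda>x. Re (h x))" "C-lipschitz_on UNIV (\<lambda>x. Im (h x))"
    unfolding lipschitz_on_def using C0 by (simp_all add: dist_real_def)
  then obtain N1 N2 where N: "negligible N1" "negligible N2"
      "\<And>x. x \<notin> N1 \<Longrightarrow> \<exists>D. ((\<lambda>x. Re (h x)) has_real_derivative D) (at x)"
      "\<And>x. x \<notin> N2 \<Longrightarrow> \<exists>D. ((\<lambda>x. Im (h x)) has_real_derivative D) (at x)"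
    using lipschitz_AE_differentiable by meson
  have "\<exists>l. ((\<lambda>\<sigma>. f (Complex \<sigma> \<tau>)) \<longlongrightarrow> l) (at_right 0)" if \<tau>: "\<tau> \<notin> N1 \<union> N2" for \<tau>
  proof -
    obtain D1 D2 where D: "((\<lambda>x. Re (h x)) has_real_derivative D1) (at \<tau>)" "((\<lambda>x. Im (h x)) has_real_derivative D2) (at \<tau>)"
      using N(3,4) \<tau> by blast
    \<comment> \<open>\<open>h\<close> is \<open>G\<close> along the axis, that is in direction
      \<open>\<i>\<close>; its derivative divided by \<open>\<i>\<close> is the only candidate for
      the complex derivative of \<open>G\<close>, and hence for the limit of
      \<open>f\<close>.\<close>
    define m where "m = Complex D1 D2 / \<i>"
    have hd: "((\<lambda>y. (h y - h \<tau>) /\<^sub>R (y - \<tau>)) \<longlongrightarrow> Complex D1 D2) (at \<tau>)"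
    proof (rule tendsto_complex_iff[THEN iffD2], intro conjI)
      show "((\<lambda>y. Re ((h y - h \<tau>) /\<^sub>R (y - \<tau>))) \<longlongrightarrow> Re (Complex D1 D2)) (at \<tau>)"
        using D(1) by (simp add: has_field_derivative_iff divide_inverse mult.commute)
      show "((\<lambda>y. Im ((h y - h \<tau>) /\<^sub>R (y - \<tau>))) \<longlongrightarrow> Im (Complex D1 D2)) (at \<tau>)"
        using D(2) by (simp add: has_field_derivative_iff divide_inverse mult.commute)
    qed
    let ?t = "Complex 0 \<tau>"
    define K where "K w = G (?t + w) - G ?t - m * w" for w
    define C2 where "C2 = C + cmod m + 1"
    have C2: "C2 > 0" using C0 by (simp add: C2_def add_nonneg_pos)
    have Kd: "(K has_field_derivative f (?t + w) - m) (at w)" if "Re w > 0" for w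
      unfolding K_def
      by (rule derivative_eq_intros refl DERIV_chain2[where f = G and g = "\<lambda>w. ?t + w"] Gd | use that in simp)+
    have small: "\<exists>d>0. \<forall>w. Re w > 0 \<longrightarrow> cmod w < d \<longrightarrow> cmod (K w) \<le> e * cmod w" if "e > 0" for e
    proof (rule small_on_axis_imp_small_in_halfplane[OF _ _ _ C2 _ that])
      show "continuous_on {w. Re w \<ge> 0} K" unfolding K_def
        by (intro continuous_intros continuous_on_compose2[OF lipschitz_on_continuous_on[OF G(1)]]) (auto simp: H(3))
      show "K holomorphic_on {w. Re w > 0}"
        using Kd by (auto simp: holomorphic_on_open open_halfspace_Re_gt)
      show "cmod (K w) \<le> C2 * cmod w" if "Re w \<ge> 0" for w
      proof -
        have "cmod (K w) \<le> cmod (G (?t + w) - G ?t) + cmod (m * w)" unfolding K_def by (rule norm_triangle_ineq4)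
        also have "\<dots> \<le> C * cmod w + cmod m * cmod w" using GL[of "?t + w" ?t] that by (simp add: norm_mult)
        also have "\<dots> \<le> C2 * cmod w" by (simp add: C2_def algebra_simps)
        finally show ?thesis .
      qed
      fix e :: real assume e: "e > 0"
      obtain d where d: "d > 0" "\<And>y. y \<noteq> \<tau> \<Longrightarrow> \<bar>y - \<tau>\<bar> < d \<Longrightarrow> cmod ((h y - h \<tau>) /\<^sub>R (y - \<tau>) - Complex D1 D2) < e"
        using tendstoD[OF hd e] unfolding eventually_at by (auto simp: dist_norm)
      have "cmod (K w) \<le> e * cmod w" if w: "Re w = 0" "cmod w \<le> d / 2" for w
      proof (cases "w = 0")
        case False
        define y where "y = \<tau> + Im w"
        have wy: "w = \<i> * of_real (y - \<tau>)" "Im w = y - \<tau>" using w by (auto simp: y_def complex_eq_iff)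
        have ne: "y \<noteq> \<tau>" using False w by (auto simp: y_def complex_eq_iff)
        have cw: "cmod w = \<bar>y - \<tau>\<bar>"
          using arg_cong[OF wy(1), of cmod] by (simp only: norm_mult norm_of_real norm_ii mult_1_left)
        have tw: "?t + w = Complex 0 y" using w by (simp add: complex_eq_iff y_def)
        have "K w = (of_real (y - \<tau>)) * ((h y - h \<tau>) /\<^sub>R (y - \<tau>) - Complex D1 D2)"
        proof -
          have "z / c * (c * r) = r * z" if "c \<noteq> 0" for c z r :: complex using that by simp
          from this[of \<i> "Complex D1 D2" "of_real (y - \<tau>)"]
          have "m * w = of_real (y - \<tau>) * Complex D1 D2" unfolding m_def by (simp only: wy(1)[symmetric] complex_i_not_zero not_False_eq_True simp_thms)
          moreover have "of_real (y - \<tau>) * ((h y - h \<tau>) /\<^sub>R (y - \<tau>)) = h y - h \<tau>"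
            using ne by (simp add: scaleR_conv_of_real)
          ultimately show ?thesis unfolding K_def tw by (simp add: h_def right_diff_distrib)
        qed
        then have "cmod (K w) = cmod w * cmod ((h y - h \<tau>) /\<^sub>R (y - \<tau>) - Complex D1 D2)"
          by (simp only: norm_mult norm_of_real cw)
        also have "\<dots> \<le> cmod w * e"
        proof (intro mult_left_mono less_imp_le d(2)[OF ne])
          show "\<bar>y - \<tau>\<bar> < d" using w(2) cw d(1) by linarith
        qed (use False in simp)
        finally show ?thesis by (simp add: mult.commute)
      qed (simp add: K_def)
      then show "\<exists>d>0. \<forall>w. Re w = 0 \<longrightarrow> cmod w \<le> d \<longrightarrow> cmod (K w) \<le> e * cmod w"
        using d(1) by (intro exI[of _ "d/2"]) auto
    qed
    have "((\<lambda>\<sigma>. f (Complex \<sigma> \<tau>)) \<longlongrightarrow> m) (at_right 0)"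
    proof (rule tendstoI)
      fix e :: real assume e: "e > 0"
      obtain d where d: "d > 0" "\<And>w. Re w > 0 \<Longrightarrow> cmod w < d \<Longrightarrow> cmod (K w) \<le> e / 4 * cmod w"
        using small[of "e/4"] e by auto
      have "dist (f (Complex \<sigma> \<tau>)) m < e" if \<sigma>: "0 < \<sigma>" "\<sigma> < d / 2" for \<sigma>
      proof -
        have inb: "Re w > 0 \<and> cmod w < d \<and> cmod w \<le> 3 / 2 * \<sigma>" if "w \<in> cball (of_real \<sigma>) (\<sigma>/2)" for w
        proof -
          have c: "cmod (of_real \<sigma> - w) \<le> \<sigma>/2" using that by (simp add: dist_norm)
          have "\<bar>Re (of_real \<sigma> - w)\<bar> \<le> \<sigma> / 2" using abs_Re_le_cmod c by (rule order_trans)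
          then have r: "\<sigma> - Re w \<le> \<sigma> / 2" using abs_ge_self[of "\<sigma> - Re w"] by simp
          have "cmod w \<le> cmod (of_real \<sigma>) + cmod (of_real \<sigma> - w)"
            using norm_triangle_ineq4[of "of_real \<sigma>" "of_real \<sigma> - w"] by simp
          then have "cmod w \<le> 3 / 2 * \<sigma>" using c \<sigma>(1) by simp
          then show ?thesis using r \<sigma> by (intro conjI) linarith+
        qed
        \<comment> \<open>On the disc of radius \<open>\<sigma> / 2\<close> one has
          \<open>cmod w \<le> 3 / 2 * \<sigma>\<close>, so Cauchy's estimate turns
          \<open>e / 4\<close> into \<open>3 / 4 * e\<close>, independently of
          \<open>\<sigma>\<close>.\<close>
        have "norm ((deriv ^^ 1) K (of_real \<sigma>)) \<le> fact 1 * (e / 4 * (3 / 2 * \<sigma>)) / (\<sigma>/2) ^ 1"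
        proof (rule Cauchy_inequality)
          have diff: "K field_differentiable at w" if "w \<in> cball (of_real \<sigma>) (\<sigma>/2)" for w
            unfolding field_differentiable_def using Kd[of w] inb[OF that] by blast
          show "K holomorphic_on ball (of_real \<sigma>) (\<sigma>/2)" 
            unfolding holomorphic_on_def
          proof
            fix w assume "w \<in> ball (complex_of_real \<sigma>) (\<sigma>/2)"
            then have "w \<in> cball (of_real \<sigma>) (\<sigma>/2)" by simp
            then show "K field_differentiable at w within ball (of_real \<sigma>) (\<sigma>/2)"
              by (rule field_differentiable_at_within[OF diff])
          qed
          show "continuous_on (cball (of_real \<sigma>) (\<sigma>/2)) K"
            using diff by (intro continuous_at_imp_continuous_on ballI field_differentiable_imp_continuous_at)
          show "0 < \<sigma>/2" using \<sigma> by simp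
          fix w assume "cmod (of_real \<sigma> - w) = \<sigma>/2"
          then have "w \<in> cball (of_real \<sigma>) (\<sigma>/2)" by (simp add: dist_norm)
          from inb[OF this] have w: "cmod (K w) \<le> e / 4 * cmod w" "cmod w \<le> 3 / 2 * \<sigma>" using d(2)[of w] by blast+
          have "e / 4 * cmod w \<le> e / 4 * (3 / 2 * \<sigma>)" by (rule mult_left_mono[OF w(2)]) (use e in simp)
          with w(1) show "cmod (K w) \<le> e / 4 * (3 / 2 * \<sigma>)" by (rule order_trans)
        qed
        moreover have "deriv K (of_real \<sigma>) = f (Complex \<sigma> \<tau>) - m"
        proof -
          have "?t + of_real \<sigma> = Complex \<sigma> \<tau>" by (simp add: complex_eq_iff)
          then show ?thesis using DERIV_imp_deriv[OF Kd[of "of_real \<sigma>"]] \<sigma> by simp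
        qed
        ultimately have "cmod (f (Complex \<sigma> \<tau>) - m) \<le> 3 / 4 * e" using \<sigma> by simp
        then show ?thesis using e by (simp add: dist_norm)
      qed
      then show "\<forall>\<^sub>F \<sigma> in at_right 0. dist (f (Complex \<sigma> \<tau>)) m < e"
        using d(1) by (intro eventually_at_rightI[of 0 "d/2"]) auto
    qed
    then show ?thesis by blast
  qed
  then show ?thesis using N(1,2) by (meson negligible_Un)
qed

section \<open>Frostman's theorem on the exceptional set\<close>

text \<open>Comparing two kernels below costs an additive 1; this moves the cost into the truncation
  level, also where the kernel is infinite.\<close>

lemma ennreal_diff_Suc: "(x + 1) - (of_nat N + 1) = x - (of_nat N :: ennreal)"
proof (cases x)
  case (real r)
  have "ennreal r + 1 = ennreal (r + 1)" "of_nat N + (1::ennreal) = ennreal (real N + 1)"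
    using real by (simp_all add: ennreal_of_nat_eq_real_of_nat)
  moreover have "ennreal (r + 1) - ennreal (real N + 1) = ennreal r - ennreal (real N)"
  proof -
    have "ennreal (r + 1) - ennreal (real N + 1) = ennreal (r + 1 - (real N + 1))" by (rule ennreal_minus) simp
    also have "r + 1 - (real N + 1) = r - real N" by simp
    also have "ennreal (r - real N) = ennreal r - ennreal (real N)" by (rule ennreal_minus[symmetric]) simp
    finally show ?thesis .
  qed
  ultimately show ?thesis unfolding real(2) by (simp only: ennreal_of_nat_eq_real_of_nat)
qed (simp add: ennreal_of_nat_eq_real_of_nat ennreal_top_minus)

text \<open>The negative part of the logarithm, as radial form of \<open>log_kernel_neg\<close>.
  \<open>ennreal\<close> cuts negative numbers to 0, so it vanishes for \<open>x \<ge> 1\<close>;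
  the value at 0 is set by hand because \<open>ln 0 = 0\<close>.\<close>

definition nlog :: "real \<Rightarrow> ennreal" where
  "nlog x = (if x = 0 then \<infinity> else ennreal (- ln x))"

lemma nlog_measurable [measurable]: "nlog \<in> borel_measurable borel"
  unfolding nlog_def[abs_def] by measurable

text \<open>A factor 2 in the argument costs \<open>ln 2 < 1\<close>; rounding up to 1 keeps
  truncation levels integral.\<close>

lemma nlog_le_add_one:
  assumes "0 \<le> y" "y \<le> 2 * x"
  shows "nlog x \<le> nlog y + 1"
proof (cases "y = 0")
  case False
  then have y: "0 < y" "0 < x" using assms by auto
  have "ln y \<le> ln (2 * x)" using y assms by simp
  also have "\<dots> = ln 2 + ln x" using y by (simp add: ln_mult_pos)
  also have "\<dots> \<le> 1 + ln x" using ln_2_less_1 by simp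
  finally have "- ln x \<le> - ln y + 1" by simp
  then have "ennreal (- ln x) \<le> ennreal (max 0 (- ln y) + 1)" by (intro ennreal_leI) auto
  also have "\<dots> = ennreal (- ln y) + 1"
    by (subst ennreal_plus) (auto simp: max_def ennreal_neg)
  finally show ?thesis using y by (simp add: nlog_def)
qed (simp add: nlog_def)

text \<open>Continuity on the closed half-line, including the infinite value at 0: the boundary
  values may hit \<open>\<xi>\<close>.\<close>

lemma nlog_tendsto:
  assumes x: "(x \<longlongrightarrow> l) F" and nonneg: "\<And>n. x n \<ge> 0"
  shows "((\<lambda>n. nlog (x n)) \<longlongrightarrow> nlog l) F"
proof (cases "F = bot")
  case False
  have l0: "l \<ge> 0" by (rule tendsto_lowerbound[OF x _ False]) (simp add: nonneg)
  show ?thesis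
  proof (cases "l = 0")
    case True
    have "((\<lambda>n. nlog (x n)) \<longlongrightarrow> top) F"
      unfolding tendsto_top_iff_ennreal
    proof (intro allI impI)
      fix B :: real assume B: "0 \<le> B"
      have "eventually (\<lambda>n. x n < exp (- (B + 1))) F"
        using order_tendstoD(2)[OF x] True by simp
      then show "eventually (\<lambda>n. ennreal B < nlog (x n)) F"
      proof eventually_elim
        case (elim n)
        show ?case
        proof (cases "x n = 0")
          case False
          then have "x n > 0" using nonneg[of n] by simp
          then have "ln (x n) < - (B + 1)" using elim by (metis exp_gt_zero ln_exp ln_less_cancel_iff)
          then show ?thesis using False B by (simp add: nlog_def ennreal_less_iff)
        qed (simp add: nlog_def)
      qed
    qed
    then show ?thesis using True by (simp add: nlog_def)
  next
    case False
    then have l: "l > 0" using l0 by simp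
    have "((\<lambda>n. ennreal (- ln (x n))) \<longlongrightarrow> ennreal (- ln l)) F"
      using l by (intro tendsto_ennrealI tendsto_intros x) auto
    moreover have "eventually (\<lambda>n. ennreal (- ln (x n)) = nlog (x n)) F"
      using order_tendstoD(1)[OF x l] by eventually_elim (simp add: nlog_def)
    ultimately have "((\<lambda>n. nlog (x n)) \<longlongrightarrow> ennreal (- ln l)) F"
      by (rule Lim_transform_eventually)
    then show ?thesis using l by (simp add: nlog_def)
  qed
qed simp

lemma log_kernel_neg_eq: "log_kernel_neg z w = nlog (cmod (z - w))"
  by (simp add: log_kernel_neg_def nlog_def)

text \<open>Egorov's argument: the tails of the potential tend to 0 in the mean, so they are
  uniformly small off a set of small measure, and inner regularity supplies a compact
  \<open>A\<close> there. Uniformity passes from points of \<open>A\<close> to all \<open>w\<close>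
  by replacing \<open>w\<close> with its nearest point \<open>z'\<close> in \<open>A\<close>, for
  which \<open>cmod (z - z') \<le> 2 * cmod (z - w)\<close> when \<open>z\<close> is in
  \<open>A\<close>.\<close>

lemma finite_energy_uniform_tails:
  fixes M :: "complex measure"
  assumes sets: "sets M = sets borel" and fin: "finite_measure M" and K: "compact K" "emeasure M (UNIV - K) = 0"
    and pos: "emeasure M (space M) \<noteq> 0"
    and energy: "(\<integral>\<^sup>+ z. (\<integral>\<^sup>+ w. log_kernel_neg z w \<partial>M) \<partial>M) \<noteq> \<infinity>"
  obtains A where "compact A" "A \<subseteq> K" "emeasure M A > 0"
    "\<And>e. e > 0 \<Longrightarrow> \<exists>N::nat. \<forall>w. (\<integral>\<^sup>+ z. (nlog (cmod (z - w)) - of_nat N) * indicator A z \<partial>M) \<le> ennreal e"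
proof -
  interpret finite_measure M by fact
  interpret P: pair_sigma_finite M M by standard
  have [measurable_cong]: "sets M = sets borel" by fact
  have sp: "space M = UNIV" using sets_eq_imp_space_eq[OF sets] by simp
  define k where "k z w = nlog (cmod (z - w))" for z w :: complex
  have [measurable]: "case_prod k \<in> borel_measurable (M \<Otimes>\<^sub>M M)"
    unfolding k_def[abs_def] by measurable
  define t where "t N w = (\<integral>\<^sup>+ z. (k z w - of_nat N) \<partial>M)" for N w
  have [measurable]: "t N \<in> borel_measurable M" for N unfolding t_def by measurable
  have e1: "(\<integral>\<^sup>+ p. case_prod k p \<partial>(M \<Otimes>\<^sub>M M)) \<noteq> \<infinity>"
    using energy by (simp add: nn_integral_fst[symmetric] log_kernel_neg_eq k_def)
  have kfin: "AE p in M \<Otimes>\<^sub>M M. case_prod k p \<noteq> \<infinity>"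
    by (rule nn_integral_PInf_AE) (use e1 in auto)
  have "(\<lambda>N. \<integral>\<^sup>+ p. (case_prod k p - of_nat N) \<partial>(M \<Otimes>\<^sub>M M)) \<longlonglongrightarrow> (\<integral>\<^sup>+ p. 0 \<partial>(M \<Otimes>\<^sub>M M))"
  proof (rule nn_integral_dominated_convergence[where w = "case_prod k"])
    show "AE p in M \<Otimes>\<^sub>M M. (\<lambda>N. case_prod k p - of_nat N) \<longlonglongrightarrow> 0"
      using kfin
    proof eventually_elim
      case (elim p)
      then obtain r where r: "case_prod k p = ennreal r" by (cases "case_prod k p") auto
      obtain n0 :: nat where "r \<le> real n0" using real_arch_simple by blast
      then have "case_prod k p - of_nat N = 0" if "N \<ge> n0" for N
        using that r by (simp add: diff_eq_0_iff_ennreal ennreal_of_nat_eq_real_of_nat less_top[symmetric] ennreal_leI)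
      then show ?case by (intro tendsto_eventually) (auto simp: eventually_sequentially)
    qed
  qed (use e1 in \<open>auto simp: less_top intro!: AE_I2 diff_le_self_ennreal\<close>)
  moreover have "(\<integral>\<^sup>+ p. (case_prod k p - of_nat N) \<partial>(M \<Otimes>\<^sub>M M)) = (\<integral>\<^sup>+ w. t N w \<partial>M)" for N
    unfolding t_def by (subst P.nn_integral_snd[symmetric]) auto
  ultimately have tl: "(\<lambda>N. \<integral>\<^sup>+ w. t N w \<partial>M) \<longlonglongrightarrow> 0" by simp
  define m where "m = measure M UNIV"
  have m: "m > 0" "emeasure M UNIV = ennreal m"
    using pos sp by (auto simp: m_def emeasure_eq_measure zero_less_measure_iff)
  \<comment> \<open>The power \<open>(1/4)^j\<close> is meant for Markov's inequality at level
    \<open>(1/2)^j\<close>: the bad sets then have measure at most \<open>m / 4 * (1/2)^j\<close>,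
    together at most \<open>m / 2\<close>, so that part of the mass \<open>m\<close>
    survives.\<close>
  have "\<exists>N. (\<integral>\<^sup>+ w. t N w \<partial>M) < ennreal (m / 4 * (1/4)^j)" for j
    using order_tendstoD(2)[OF tl, of "ennreal (m / 4 * (1/4)^j)"] m by (auto simp: eventually_sequentially)
  then obtain Nj where Nj: "\<And>j. (\<integral>\<^sup>+ w. t (Nj j) w \<partial>M) < ennreal (m / 4 * (1/4)^j)" by metis
  define bad where "bad j = {w \<in> space M. 1 \<le> ennreal (2^j) * t (Nj j) w}" for j
  have [measurable]: "bad j \<in> sets M" for j unfolding bad_def by measurable
  have badj: "emeasure M (bad j) \<le> ennreal (m / 4 * (1/2)^j)" for j
  proof -
    have "emeasure M (bad j) \<le> ennreal (2^j) * (\<integral>\<^sup>+ w. t (Nj j) w * indicator (space M) w \<partial>M)"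
      unfolding bad_def by (rule nn_integral_Markov_inequality) auto
    also have "(\<integral>\<^sup>+ w. t (Nj j) w * indicator (space M) w \<partial>M) = (\<integral>\<^sup>+ w. t (Nj j) w \<partial>M)"
      by (intro nn_integral_cong) simp
    also have "ennreal (2^j) * \<dots> \<le> ennreal (2^j) * ennreal (m / 4 * (1/4)^j)"
      using Nj[of j] by (intro mult_left_mono) auto
    also have "\<dots> = ennreal (2^j * (m / 4 * (1/4)^j))" by (rule ennreal_mult[symmetric]) (use m in auto)
    also have "2^j * (m / 4 * (1/4)^j) = m / 4 * (1/2)^j"
    proof -
      have "(2::real)^j * (1/4)^j = (1/2)^j" by (simp add: power_mult_distrib[symmetric])
      then show ?thesis by simp
    qed
    finally show ?thesis .
  qed
  have "emeasure M (\<Union>j. bad j) \<le> (\<Sum>j. emeasure M (bad j))"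
    by (intro emeasure_subadditive_countably) auto
  also have "\<dots> \<le> (\<Sum>j. ennreal (m / 4 * (1/2)^j))" by (intro suminf_le badj) auto
  also have "\<dots> = ennreal (m / 2)"
  proof -
    have "(\<lambda>j. m / 4 * (1/2)^j) sums (m / 4 * (1 / (1 - 1/2)))" by (intro sums_mult geometric_sums) simp
    then show ?thesis using m by (subst suminf_ennreal_eq) auto
  qed
  finally have bad: "emeasure M (\<Union>j. bad j) \<le> ennreal (m / 2)" .
  define G where "G = K - (\<Union>j. bad j)"
  have Kb [measurable]: "K \<in> sets M" using K(1) sets by (simp add: borel_compact)
  have [measurable]: "G \<in> sets M" unfolding G_def by measurable
  have Gpos: "emeasure M G > 0"
  proof (rule ccontr)
    assume "\<not> emeasure M G > 0"
    then have G0: "emeasure M G = 0" by simp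
    have "emeasure M UNIV \<le> emeasure M (G \<union> ((\<Union>j. bad j) \<union> (UNIV - K)))"
      using sp sets.compl_sets[OF Kb] by (intro emeasure_mono) (auto simp: G_def)
    also have "\<dots> \<le> emeasure M G + emeasure M ((\<Union>j. bad j) \<union> (UNIV - K))"
      using sp sets.compl_sets[OF Kb] by (intro emeasure_subadditive) auto
    also have "\<dots> \<le> 0 + (emeasure M (\<Union>j. bad j) + emeasure M (UNIV - K))"
      using sp sets.compl_sets[OF Kb] by (intro add_mono emeasure_subadditive) (auto simp: G0)
    also have "\<dots> \<le> ennreal (m / 2)" using bad K(2) by simp
    finally show False using m by simp
  qed
  have "emeasure M G = (SUP A \<in> {A. A \<subseteq> G \<and> compact A}. emeasure M A)"
  proof (rule inner_regular[OF sets])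
    show "emeasure M (space M) \<noteq> \<infinity>" using emeasure_finite by simp
    show "G \<in> sets borel" using \<open>G \<in> sets M\<close> by (simp only: sets)
  qed
  then have "0 < (SUP A \<in> {A. A \<subseteq> G \<and> compact A}. emeasure M A)" using Gpos by (simp only:)
  then obtain A where A: "A \<subseteq> G" "compact A" "emeasure M A > 0"
    unfolding less_SUP_iff by blast
  have An: "A \<noteq> {}" using A(3) by auto
  show ?thesis
  proof (rule that[OF A(2) _ A(3)])
    show "A \<subseteq> K" using A(1) by (auto simp: G_def)
    fix e :: real assume e: "e > 0"
    obtain j where j: "(1/2)^j < e" using real_arch_pow_inv[OF e, of "1/2"] by auto
    have tA: "t (Nj j) z' \<le> ennreal e" if "z' \<in> A" for z'
    proof -
      have "z' \<notin> bad j" using that A(1) by (auto simp: G_def)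
      then have lt: "ennreal (2^j) * t (Nj j) z' < 1" by (simp add: bad_def sp not_le)
      have "t (Nj j) z' = ennreal ((1/2)^j) * (ennreal (2^j) * t (Nj j) z')"
      proof -
        have "ennreal ((1/2)^j) * ennreal (2^j) = 1"
          by (subst ennreal_mult[symmetric]) (auto simp: power_mult_distrib[symmetric])
        then show ?thesis by (simp add: mult.assoc[symmetric])
      qed
      also have "\<dots> \<le> ennreal ((1/2)^j) * 1" using lt by (intro mult_left_mono) auto
      also have "\<dots> \<le> ennreal e" using j by (simp add: ennreal_leI)
      finally show ?thesis .
    qed
    show "\<exists>N::nat. \<forall>w. (\<integral>\<^sup>+ z. (nlog (cmod (z - w)) - of_nat N) * indicator A z \<partial>M) \<le> ennreal e"
    proof (intro exI allI)
      fix w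
      obtain z' where z': "z' \<in> A" "\<And>z. z \<in> A \<Longrightarrow> dist w z' \<le> dist w z"
        using distance_attains_inf[OF compact_imp_closed[OF A(2)] An] by blast
      \<comment> \<open>Passing to the nearest point costs 1 in \<open>nlog\<close>, which the
        shifted level \<open>Suc (Nj j)\<close> absorbs.\<close>
      have "(nlog (cmod (z - w)) - of_nat (Suc (Nj j))) * indicator A z \<le> k z z' - of_nat (Nj j)" for z
      proof (cases "z \<in> A")
        case True
        have "cmod (z - z') \<le> cmod (z - w) + cmod (w - z')" using norm_triangle_ineq[of "z - w" "w - z'"] by simp
        also have "\<dots> \<le> 2 * cmod (z - w)" using z'(2)[OF True] by (simp add: dist_norm norm_minus_commute)
        finally have "nlog (cmod (z - w)) \<le> k z z' + 1" unfolding k_def by (intro nlog_le_add_one) auto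
        then have "nlog (cmod (z - w)) - of_nat (Suc (Nj j)) \<le> (k z z' + 1) - (of_nat (Nj j) + 1)"
          by (simp add: ennreal_minus_mono add.commute)
        also have "\<dots> = k z z' - of_nat (Nj j)"
          by (rule ennreal_diff_Suc)
        finally show ?thesis using True by simp
      qed simp
      then have "(\<integral>\<^sup>+ z. (nlog (cmod (z - w)) - of_nat (Suc (Nj j))) * indicator A z \<partial>M) \<le> t (Nj j) z'"
        unfolding t_def by (intro nn_integral_mono)
      also have "\<dots> \<le> ennreal e" by (rule tA[OF z'(1)])
      finally show "(\<integral>\<^sup>+ z. (nlog (cmod (z - w)) - of_nat (Suc (Nj j))) * indicator A z \<partial>M) \<le> ennreal e" .
    qed
  qed
qed

lemma frostman_denominator_nonzero:
  fixes \<xi> w :: complex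
  assumes "cmod \<xi> < 1" "cmod w \<le> 1"
  shows "1 - cnj \<xi> * w \<noteq> 0"
proof
  assume "1 - cnj \<xi> * w = 0"
  then have "cmod (cnj \<xi> * w) = 1" by (metis eq_iff_diff_eq_0 norm_one)
  moreover have "cmod (cnj \<xi> * w) \<le> cmod \<xi> * 1" using assms by (simp add: norm_mult mult_left_le)
  ultimately show False using assms by simp
qed

text \<open>The Green function of the unit disc with pole \<open>\<xi>\<close>. For
  \<open>cmod \<xi> < 1\<close> and \<open>cmod w \<le> 1\<close> the quotient has modulus at most
  1, so \<open>nlog\<close> cuts nothing off.\<close>

definition green_disc :: "complex \<Rightarrow> complex \<Rightarrow> ennreal" where
  "green_disc \<xi> w = nlog (cmod ((\<xi> - w) / (1 - cnj \<xi> * w)))"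

lemma green_disc_measurable [measurable]: "(\<lambda>p. green_disc (fst p) (snd p)) \<in> borel_measurable (borel \<Otimes>\<^sub>M borel)"
proof -
  have [measurable]: "cnj \<in> borel_measurable borel" by (intro borel_measurable_continuous_onI continuous_intros)
  show ?thesis unfolding green_disc_def by measurable
qed

text \<open>The denominator has modulus at most 2, so the Green function exceeds the logarithmic
  kernel by at most 1, and tails of logarithmic potentials control tails of Green
  potentials.\<close>

lemma green_disc_le:
  assumes "cmod \<xi> < 1" "cmod w \<le> 1"
  shows "green_disc \<xi> w \<le> nlog (cmod (\<xi> - w)) + 1"
  unfolding green_disc_def
proof (rule nlog_le_add_one)
  have "cmod (1 - cnj \<xi> * w) \<le> cmod 1 + cmod (cnj \<xi> * w)" by (rule norm_triangle_ineq4)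
  also have "\<dots> \<le> 1 + 1 * 1" using assms unfolding norm_mult by (intro add_mono mult_mono) auto
  finally have "cmod (1 - cnj \<xi> * w) \<le> 2" by simp
  moreover have "cmod (1 - cnj \<xi> * w) > 0" using frostman_denominator_nonzero[OF assms] by simp
  ultimately show "cmod (\<xi> - w) \<le> 2 * cmod ((\<xi> - w) / (1 - cnj \<xi> * w))"
    using mult_left_mono[of "cmod (1 - cnj \<xi> * w)" 2 "cmod (\<xi> - w)"]
    by (simp only: norm_divide times_divide_eq_right pos_le_divide_eq mult.commute[of 2] norm_ge_zero)
qed simp

lemma green_disc_tendsto:
  assumes "cmod \<xi> < 1" "cmod l \<le> 1" "(w \<longlongrightarrow> l) F"
  shows "((\<lambda>n. green_disc \<xi> (w n)) \<longlongrightarrow> green_disc \<xi> l) F"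
  unfolding green_disc_def using frostman_denominator_nonzero[OF assms(1,2)]
  by (intro nlog_tendsto tendsto_intros assms) auto

text \<open>Suppose a measure \<open>M\<close> of finite energy lived on a compact part of the
  exceptional set, and restrict to a compact \<open>A\<close> with uniform tails. Fatou's lemma in
  \<open>\<tau>\<close> gives \<open>I \<xi> \<le> liminf (\<lambda>n. H n \<xi>)\<close> pointwise,
  while uniform integrability gives the reverse after integration in \<open>\<xi>\<close>. So
  equality with a finite value holds \<open>M\<close>-almost everywhere, and almost no point of
  \<open>A\<close> is exceptional, although \<open>A\<close> has positive mass.\<close>

theorem Frostman_polar:
  fixes \<phi> :: "nat \<Rightarrow> real \<Rightarrow> complex" and \<phi>0 :: "real \<Rightarrow> complex" and W :: "real measure"
  assumes W: "finite_measure W" "sets W = sets borel"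
    and meas [measurable]: "\<And>n. \<phi> n \<in> borel_measurable borel" "\<phi>0 \<in> borel_measurable borel"
    and bd: "\<And>n \<tau>. cmod (\<phi> n \<tau>) \<le> 1" "\<And>\<tau>. cmod (\<phi>0 \<tau>) \<le> 1"
    and lim: "AE \<tau> in W. (\<lambda>n. \<phi> n \<tau>) \<longlonglongrightarrow> \<phi>0 \<tau>"
  shows "polar {\<xi> \<in> ball 0 1. \<not> (liminf (\<lambda>n. \<integral>\<^sup>+ \<tau>. green_disc \<xi> (\<phi> n \<tau>) \<partial>W) \<le> (\<integral>\<^sup>+ \<tau>. green_disc \<xi> (\<phi>0 \<tau>) \<partial>W)
      \<and> (\<integral>\<^sup>+ \<tau>. green_disc \<xi> (\<phi>0 \<tau>) \<partial>W) < \<infinity>)}" (is "polar ?E")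
  unfolding polar_def
proof (intro allI impI, elim conjE, rule ccontr)
  fix M :: "complex measure" and K
  assume M: "sets M = sets borel" "finite_measure M" "emeasure M (space M) \<noteq> 0" "compact K" "K \<subseteq> ?E" "emeasure M (UNIV - K) = 0"
    and en: "(\<integral>\<^sup>+ z. (\<integral>\<^sup>+ w. log_kernel_neg z w \<partial>M) \<partial>M) \<noteq> \<infinity>"
  obtain A where A: "compact A" "A \<subseteq> K" "emeasure M A > 0"
    and tails: "\<And>e. e > 0 \<Longrightarrow> \<exists>N::nat. \<forall>w. (\<integral>\<^sup>+ z. (nlog (cmod (z - w)) - of_nat N) * indicator A z \<partial>M) \<le> ennreal e"
    using finite_energy_uniform_tails[OF M(1,2,4,6,3) en] by blast
  interpret M: finite_measure M by fact
  interpret W: finite_measure W by fact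
  interpret P: pair_sigma_finite M W by standard
  interpret PF: finite_measure "M \<Otimes>\<^sub>M W" by (rule finite_measure_pair_measure) fact+
  note [measurable_cong] = M(1) W(2)
  have Ab [measurable]: "A \<in> sets M" using A(1) M(1) by (simp add: borel_compact)
  have AE: "\<xi> \<in> A \<Longrightarrow> cmod \<xi> < 1" for \<xi> using A(2) M(5) by auto
  let ?g = "\<lambda>\<phi> \<xi> \<tau>. green_disc \<xi> (\<phi> \<tau>) * indicator A \<xi>"
  define H where "H n \<xi> = (\<integral>\<^sup>+ \<tau>. ?g (\<phi> n) \<xi> \<tau> \<partial>W)" for n \<xi>
  define I where "I \<xi> = (\<integral>\<^sup>+ \<tau>. ?g \<phi>0 \<xi> \<tau> \<partial>W)" for \<xi>
  have gm: "(\<lambda>p. ?g \<psi> (fst p) (snd p)) \<in> borel_measurable (M \<Otimes>\<^sub>M W)" if [measurable]: "\<psi> \<in> borel_measurable borel" for \<psi>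
  proof -
    have "(\<lambda>p. green_disc (fst (fst p, \<psi> (snd p))) (snd (fst p, \<psi> (snd p))) * indicator A (fst p)) \<in> borel_measurable (M \<Otimes>\<^sub>M W)"
      by measurable
    then show ?thesis by simp
  qed
  note [measurable] = gm[OF meas(1)] gm[OF meas(2)]
  have [measurable]: "H n \<in> borel_measurable M" "I \<in> borel_measurable M" for n
    unfolding H_def I_def using W.borel_measurable_nn_integral[of "\<lambda>x y. ?g (\<phi> n) x y" M]
      W.borel_measurable_nn_integral[of "\<lambda>x y. ?g \<phi>0 x y" M] by (auto simp: case_prod_unfold)
  have HI: "(\<integral>\<^sup>+ \<xi>. \<integral>\<^sup>+ \<tau>. ?g \<psi> \<xi> \<tau> \<partial>W \<partial>M) = (\<integral>\<^sup>+ p. ?g \<psi> (fst p) (snd p) \<partial>(M \<Otimes>\<^sub>M W))"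
    if "\<psi> \<in> borel_measurable borel" for \<psi>
    using W.nn_integral_fst[OF gm[OF that]] by simp
  \<comment> \<open>For fixed \<open>\<tau>\<close> the integral in \<open>\<xi>\<close> is a tail
    of the logarithmic potential at the point \<open>\<psi> \<tau>\<close>, and it is small wherever
    that point lies. So one \<open>N\<close> serves all \<open>\<phi> n\<close> and
    \<open>\<phi>0\<close> at once.\<close>
  have w1: "\<exists>N::nat. \<forall>\<psi>\<in>borel_measurable borel. (\<forall>\<tau>. cmod (\<psi> \<tau>) \<le> 1) \<longrightarrow> 
      (\<integral>\<^sup>+ p. (?g \<psi> (fst p) (snd p) - of_nat N) \<partial>(M \<Otimes>\<^sub>M W)) \<le> ennreal e * emeasure W UNIV" if e: "e > 0" for e
  proof -
    obtain N :: nat where N: "\<And>w. (\<integral>\<^sup>+ z. (nlog (cmod (z - w)) - of_nat N) * indicator A z \<partial>M) \<le> ennreal e"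
      using tails[OF e] by blast
    have "(\<integral>\<^sup>+ p. (?g \<psi> (fst p) (snd p) - of_nat (Suc N)) \<partial>(M \<Otimes>\<^sub>M W)) \<le> ennreal e * emeasure W UNIV"
      if \<psi> [measurable]: "\<psi> \<in> borel_measurable borel" and b: "\<And>\<tau>. cmod (\<psi> \<tau>) \<le> 1" for \<psi>
    proof -
      have [measurable]: "(\<lambda>p. ?g \<psi> (fst p) (snd p)) \<in> borel_measurable (M \<Otimes>\<^sub>M W)" by (rule gm[OF \<psi>])
      have "(\<integral>\<^sup>+ p. (?g \<psi> (fst p) (snd p) - of_nat (Suc N)) \<partial>(M \<Otimes>\<^sub>M W)) = (\<integral>\<^sup>+ \<tau>. \<integral>\<^sup>+ \<xi>. (?g \<psi> \<xi> \<tau> - of_nat (Suc N)) \<partial>M \<partial>W)"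
        by (subst P.nn_integral_snd[symmetric]) auto
      also have "\<dots> \<le> (\<integral>\<^sup>+ \<tau>. ennreal e \<partial>W)"
      proof (rule nn_integral_mono)
        fix \<tau>
        have "(\<integral>\<^sup>+ \<xi>. (?g \<psi> \<xi> \<tau> - of_nat (Suc N)) \<partial>M) \<le> (\<integral>\<^sup>+ z. (nlog (cmod (z - \<psi> \<tau>)) - of_nat N) * indicator A z \<partial>M)"
        proof (rule nn_integral_mono)
          fix \<xi>
          show "?g \<psi> \<xi> \<tau> - of_nat (Suc N) \<le> (nlog (cmod (\<xi> - \<psi> \<tau>)) - of_nat N) * indicator A \<xi>"
          proof (cases "\<xi> \<in> A")
            case True
            have "green_disc \<xi> (\<psi> \<tau>) - of_nat (Suc N) \<le> (nlog (cmod (\<xi> - \<psi> \<tau>)) + 1) - (of_nat N + 1)"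
              using green_disc_le[OF AE[OF True] b] by (simp add: ennreal_minus_mono add.commute)
            also have "\<dots> = nlog (cmod (\<xi> - \<psi> \<tau>)) - of_nat N" by (rule ennreal_diff_Suc)
            finally show ?thesis using True by simp
          qed simp
        qed
        also have "\<dots> \<le> ennreal e" by (rule N)
        finally show "(\<integral>\<^sup>+ \<xi>. (?g \<psi> \<xi> \<tau> - of_nat (Suc N)) \<partial>M) \<le> ennreal e" .
      qed
      also have "\<dots> = ennreal e * emeasure W UNIV"
        using sets_eq_imp_space_eq[OF W(2)] by simp
      finally show ?thesis .
    qed
    then show ?thesis by blast
  qed
  have Wfin: "emeasure W UNIV < \<infinity>" "emeasure (M \<Otimes>\<^sub>M W) (space (M \<Otimes>\<^sub>M W)) < \<infinity>"
    using W.emeasure_finite PF.emeasure_finite by (simp_all add: less_top[symmetric])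
  have le_split: "x \<le> min x y + (x - y)" for x y :: ennreal
    by (cases "x \<le> y") (auto simp: min_def add_diff_inverse_ennreal)
  have le_add: "x \<le> y + (x - y)" for x y :: ennreal
    using order_trans[OF le_split[of x y] add_right_mono[OF min.cobounded2]] .
  have Ifin: "(\<integral>\<^sup>+ \<xi>. I \<xi> \<partial>M) < \<infinity>"
  proof -
    obtain N :: nat where N: "\<forall>\<psi>\<in>borel_measurable borel. (\<forall>\<tau>. cmod (\<psi> \<tau>) \<le> 1) \<longrightarrow> 
      (\<integral>\<^sup>+ p. (?g \<psi> (fst p) (snd p) - of_nat N) \<partial>(M \<Otimes>\<^sub>M W)) \<le> ennreal 1 * emeasure W UNIV"
      using w1[of 1] by auto
    have "(\<integral>\<^sup>+ \<xi>. I \<xi> \<partial>M) = (\<integral>\<^sup>+ p. ?g \<phi>0 (fst p) (snd p) \<partial>(M \<Otimes>\<^sub>M W))"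
      unfolding I_def by (rule HI) measurable
    also have "\<dots> \<le> (\<integral>\<^sup>+ p. of_nat N + (?g \<phi>0 (fst p) (snd p) - of_nat N) \<partial>(M \<Otimes>\<^sub>M W))"
      by (intro nn_integral_mono le_add)
    also have "\<dots> = of_nat N * emeasure (M \<Otimes>\<^sub>M W) (space (M \<Otimes>\<^sub>M W)) + (\<integral>\<^sup>+ p. (?g \<phi>0 (fst p) (snd p) - of_nat N) \<partial>(M \<Otimes>\<^sub>M W))"
      by (subst nn_integral_add) auto
    also have "\<dots> \<le> of_nat N * emeasure (M \<Otimes>\<^sub>M W) (space (M \<Otimes>\<^sub>M W)) + ennreal 1 * emeasure W UNIV"
      by (rule add_left_mono) (use N meas(2) bd(2) in blast)
    also have "\<dots> < \<infinity>" using Wfin by (auto simp: ennreal_mult_less_top of_nat_less_top)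
    finally show ?thesis .
  qed
  \<comment> \<open>Split at level \<open>N\<close>: the part above costs at most \<open>e\<close>
    for every \<open>n\<close>, the part below is bounded and converges by dominated
    convergence.\<close>
  have up: "liminf (\<lambda>n. \<integral>\<^sup>+ \<xi>. H n \<xi> \<partial>M) \<le> (\<integral>\<^sup>+ \<xi>. I \<xi> \<partial>M)"
  proof (rule ennreal_le_epsilon)
    fix e :: real assume "0 < e"
    \<comment> \<open>The added 1 makes the divisor positive even if \<open>W\<close> is the zero
      measure.\<close>
    define w where "w = measure W UNIV + 1"
    have w: "w > 0" "emeasure W UNIV \<le> ennreal w" by (auto simp: w_def add_nonneg_pos W.emeasure_eq_measure)
    obtain N :: nat where N: "\<forall>\<psi>\<in>borel_measurable borel. (\<forall>\<tau>. cmod (\<psi> \<tau>) \<le> 1) \<longrightarrow> 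
      (\<integral>\<^sup>+ p. (?g \<psi> (fst p) (snd p) - of_nat N) \<partial>(M \<Otimes>\<^sub>M W)) \<le> ennreal (e / w) * emeasure W UNIV"
      using w1[of "e / w"] \<open>0 < e\<close> w by auto
    have ew: "ennreal (e / w) * emeasure W UNIV \<le> ennreal e"
    proof -
      have "ennreal (e / w) * emeasure W UNIV \<le> ennreal (e / w) * ennreal w" using w by (intro mult_left_mono) auto
      also have "\<dots> = ennreal e" using w \<open>0 < e\<close> by (subst ennreal_mult[symmetric]) auto
      finally show ?thesis .
    qed
    have le: "(\<integral>\<^sup>+ \<xi>. H n \<xi> \<partial>M) \<le> (\<integral>\<^sup>+ p. min (?g (\<phi> n) (fst p) (snd p)) (of_nat N) \<partial>(M \<Otimes>\<^sub>M W)) + ennreal e" for n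
    proof -
      have "(\<integral>\<^sup>+ \<xi>. H n \<xi> \<partial>M) = (\<integral>\<^sup>+ p. ?g (\<phi> n) (fst p) (snd p) \<partial>(M \<Otimes>\<^sub>M W))"
        unfolding H_def by (rule HI) measurable
      also have "\<dots> \<le> (\<integral>\<^sup>+ p. min (?g (\<phi> n) (fst p) (snd p)) (of_nat N) + (?g (\<phi> n) (fst p) (snd p) - of_nat N) \<partial>(M \<Otimes>\<^sub>M W))"
        by (intro nn_integral_mono le_split)
      also have "\<dots> = (\<integral>\<^sup>+ p. min (?g (\<phi> n) (fst p) (snd p)) (of_nat N) \<partial>(M \<Otimes>\<^sub>M W)) + (\<integral>\<^sup>+ p. (?g (\<phi> n) (fst p) (snd p) - of_nat N) \<partial>(M \<Otimes>\<^sub>M W))"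
        by (subst nn_integral_add) auto
      also have "\<dots> \<le> (\<integral>\<^sup>+ p. min (?g (\<phi> n) (fst p) (snd p)) (of_nat N) \<partial>(M \<Otimes>\<^sub>M W)) + ennreal e"
      proof (rule add_left_mono)
        have "(\<integral>\<^sup>+ p. (?g (\<phi> n) (fst p) (snd p) - of_nat N) \<partial>(M \<Otimes>\<^sub>M W)) \<le> ennreal (e / w) * emeasure W UNIV"
          using N meas(1) bd(1) by blast
        then show "(\<integral>\<^sup>+ p. (?g (\<phi> n) (fst p) (snd p) - of_nat N) \<partial>(M \<Otimes>\<^sub>M W)) \<le> ennreal e"
          using ew by (rule order_trans)
      qed
      finally show ?thesis .
    qed
    have "(\<lambda>n. \<integral>\<^sup>+ p. min (?g (\<phi> n) (fst p) (snd p)) (of_nat N) \<partial>(M \<Otimes>\<^sub>M W)) \<longlonglongrightarrow>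
       (\<integral>\<^sup>+ p. min (?g \<phi>0 (fst p) (snd p)) (of_nat N) \<partial>(M \<Otimes>\<^sub>M W))"
    proof (rule nn_integral_dominated_convergence[where w = "\<lambda>_. of_nat N"])
      show "(\<integral>\<^sup>+ p. of_nat N \<partial>(M \<Otimes>\<^sub>M W)) < \<infinity>"
        using Wfin(2) by (simp add: ennreal_mult_less_top of_nat_less_top)
      have "AE p in M \<Otimes>\<^sub>M W. (\<lambda>n. \<phi> n (snd p)) \<longlonglongrightarrow> \<phi>0 (snd p)"
      proof -
        obtain N0 where N0: "{\<tau> \<in> space W. \<not> (\<lambda>n. \<phi> n \<tau>) \<longlonglongrightarrow> \<phi>0 \<tau>} \<subseteq> N0" "emeasure W N0 = 0" "N0 \<in> sets W"
          using lim by (rule AE_E)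
        have [measurable]: "N0 \<in> sets W" by fact
        have "AE p in M \<Otimes>\<^sub>M W. snd p \<notin> N0"
        proof (rule P.AE_pair_measure)
          show "{x \<in> space (M \<Otimes>\<^sub>M W). snd x \<notin> N0} \<in> sets (M \<Otimes>\<^sub>M W)" by measurable
          show "AE x in M. AE y in W. snd (x, y) \<notin> N0"
            using AE_not_in[of N0 W] N0(2,3) by (simp add: null_sets_def)
        qed
        moreover have "(\<lambda>n. \<phi> n \<tau>) \<longlonglongrightarrow> \<phi>0 \<tau>" if "\<tau> \<notin> N0" for \<tau>
          using that N0(1) sets_eq_imp_space_eq[OF W(2)] by auto
        ultimately show ?thesis by (rule eventually_mono) blast
      qed
      then show "AE p in M \<Otimes>\<^sub>M W. (\<lambda>n. min (?g (\<phi> n) (fst p) (snd p)) (of_nat N)) \<longlonglongrightarrow> min (?g \<phi>0 (fst p) (snd p)) (of_nat N)"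
      proof eventually_elim
        case (elim p)
        show ?case
        proof (cases "fst p \<in> A")
          case True
          show ?thesis using green_disc_tendsto[OF AE[OF True] bd(2) elim] True by (auto intro!: tendsto_min)
        qed simp
      qed
    qed auto
    then have "(\<lambda>n. (\<integral>\<^sup>+ p. min (?g (\<phi> n) (fst p) (snd p)) (of_nat N) \<partial>(M \<Otimes>\<^sub>M W)) + ennreal e) \<longlonglongrightarrow>
       (\<integral>\<^sup>+ p. min (?g \<phi>0 (fst p) (snd p)) (of_nat N) \<partial>(M \<Otimes>\<^sub>M W)) + ennreal e" by (intro tendsto_intros)
    then have eq: "liminf (\<lambda>n. (\<integral>\<^sup>+ p. min (?g (\<phi> n) (fst p) (snd p)) (of_nat N) \<partial>(M \<Otimes>\<^sub>M W)) + ennreal e) =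
       (\<integral>\<^sup>+ p. min (?g \<phi>0 (fst p) (snd p)) (of_nat N) \<partial>(M \<Otimes>\<^sub>M W)) + ennreal e"
      by (intro lim_imp_Liminf) auto
    have le1: "liminf (\<lambda>n. \<integral>\<^sup>+ \<xi>. H n \<xi> \<partial>M) \<le> liminf (\<lambda>n. (\<integral>\<^sup>+ p. min (?g (\<phi> n) (fst p) (snd p)) (of_nat N) \<partial>(M \<Otimes>\<^sub>M W)) + ennreal e)"
      by (intro Liminf_mono always_eventually allI le)
    have le2: "(\<integral>\<^sup>+ p. min (?g \<phi>0 (fst p) (snd p)) (of_nat N) \<partial>(M \<Otimes>\<^sub>M W)) \<le> (\<integral>\<^sup>+ \<xi>. I \<xi> \<partial>M)"
      unfolding I_def HI[OF meas(2)] by (intro nn_integral_mono) auto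
    show "liminf (\<lambda>n. \<integral>\<^sup>+ \<xi>. H n \<xi> \<partial>M) \<le> (\<integral>\<^sup>+ \<xi>. I \<xi> \<partial>M) + ennreal e"
      by (rule order_trans[OF le1[unfolded eq] add_right_mono[OF le2]])
  qed
  have fatou1: "I \<xi> \<le> liminf (\<lambda>n. H n \<xi>)" for \<xi>
  proof (cases "\<xi> \<in> A")
    case True
    have [measurable]: "(\<lambda>\<tau>. ?g (\<phi> n) \<xi> \<tau>) \<in> borel_measurable W" for n
    proof -
      have "(\<lambda>\<tau>. green_disc (fst (\<xi>, \<phi> n \<tau>)) (snd (\<xi>, \<phi> n \<tau>)) * indicator A \<xi>) \<in> borel_measurable W" by measurable
      then show ?thesis by simp
    qed
    have "I \<xi> = (\<integral>\<^sup>+ \<tau>. liminf (\<lambda>n. ?g (\<phi> n) \<xi> \<tau>) \<partial>W)"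
      unfolding I_def
    proof (rule nn_integral_cong_AE)
      show "AE \<tau> in W. ?g \<phi>0 \<xi> \<tau> = liminf (\<lambda>n. ?g (\<phi> n) \<xi> \<tau>)"
        using lim
      proof eventually_elim
        case (elim \<tau>)
        show ?case using green_disc_tendsto[OF AE[OF True] bd(2) elim] True
          by (intro lim_imp_Liminf[symmetric]) auto
      qed
    qed
    also have "\<dots> \<le> liminf (\<lambda>n. H n \<xi>)" unfolding H_def by (rule nn_integral_liminf) measurable
    finally show ?thesis .
  qed (simp add: I_def)
  \<comment> \<open>Fatou's lemma a second time, now in \<open>\<xi>\<close>, brings the limit
    inferior inside and yields the mean form of the inequality opposite to
    \<open>fatou1\<close>.\<close>
  have fatou2: "(\<integral>\<^sup>+ \<xi>. liminf (\<lambda>n. H n \<xi>) \<partial>M) \<le> (\<integral>\<^sup>+ \<xi>. I \<xi> \<partial>M)"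
    using nn_integral_liminf[of H M] up by (simp add: order_trans)
  \<comment> \<open>The difference may be integrated termwise because the integral of
    \<open>I\<close> is finite; being nonnegative by \<open>fatou1\<close>, it vanishes almost
    everywhere.\<close>
  have "(\<integral>\<^sup>+ \<xi>. (liminf (\<lambda>n. H n \<xi>) - I \<xi>) \<partial>M) = (\<integral>\<^sup>+ \<xi>. liminf (\<lambda>n. H n \<xi>) \<partial>M) - (\<integral>\<^sup>+ \<xi>. I \<xi> \<partial>M)"
    using Ifin fatou1 by (intro nn_integral_diff) auto
  also have "\<dots> = 0" using fatou2 Ifin by (simp add: diff_eq_0_iff_ennreal)
  finally have "AE \<xi> in M. liminf (\<lambda>n. H n \<xi>) - I \<xi> = 0"
    by (subst (asm) nn_integral_0_iff_AE) auto
  moreover have "AE \<xi> in M. I \<xi> \<noteq> \<infinity>" using Ifin by (intro nn_integral_PInf_AE) auto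
  ultimately have good: "AE \<xi> in M. liminf (\<lambda>n. H n \<xi>) \<le> I \<xi> \<and> I \<xi> < \<infinity>"
  proof eventually_elim
    case (elim \<xi>)
    then show ?case by (simp add: diff_eq_0_iff_ennreal less_top)
  qed
  have "AE \<xi> in M. \<xi> \<notin> A"
    using good
  proof eventually_elim
    case (elim \<xi>)
    show ?case
    proof
      assume a: "\<xi> \<in> A"
      then have "\<xi> \<in> ?E" using A(2) M(5) by blast
      moreover have "H n \<xi> = (\<integral>\<^sup>+ \<tau>. green_disc \<xi> (\<phi> n \<tau>) \<partial>W)" "I \<xi> = (\<integral>\<^sup>+ \<tau>. green_disc \<xi> (\<phi>0 \<tau>) \<partial>W)" for n
        using a by (auto simp: H_def I_def)
      ultimately show False using elim by simp
    qed
  qed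
  then have "emeasure M A = 0"
    by (subst (asm) AE_iff_measurable[OF Ab]) (use sets.sets_into_space[OF Ab] in auto)
  then show False using A(3) by simp
qed

section \<open>Littlewood's formula with a smooth window\<close>

lemma smooth_step:
  obtains s s' s'' :: "real \<Rightarrow> real" where
    "\<And>t. (s has_real_derivative s' t) (at t)" "\<And>t. (s' has_real_derivative s'' t) (at t)"
    "continuous_on UNIV s''" "\<And>t. 0 \<le> s t" "\<And>t. s t \<le> 1" "\<And>t. t \<le> 0 \<Longrightarrow> s t = 0" "\<And>t. t \<ge> 3 \<Longrightarrow> s t = 1"
    "\<And>t. t \<le> 0 \<or> t \<ge> 3 \<Longrightarrow> s' t = 0" "\<And>t. t \<le> 0 \<or> t \<ge> 3 \<Longrightarrow> s'' t = 0" "\<And>t. \<bar>s'' t\<bar> \<le> 1"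
proof -
  define p :: "real \<Rightarrow> real" where "p t = max 0 t" for t
  \<comment> \<open>The exponent is at least 2, which makes the truncated power differentiable also
    at its corner \<open>t = 0\<close>.\<close>
  have dp: "((\<lambda>t. p t ^ Suc (Suc n)) has_real_derivative (real (Suc (Suc n)) * p t ^ Suc n)) (at t)" for t n
  proof (rule linorder_cases[of t 0])
    assume t: "t < 0"
    have "((\<lambda>t. 0) has_real_derivative 0) (at t)" by simp
    then have "((\<lambda>t. p t ^ Suc (Suc n)) has_real_derivative 0) (at t)"
      by (rule has_field_derivative_transform_within_open[where S = "{..<0}"]) (use t in \<open>auto simp: p_def\<close>)
    then show ?thesis using t by (simp add: p_def)
  next
    assume t: "t > 0"
    have "((\<lambda>t. t ^ Suc (Suc n)) has_real_derivative (real (Suc (Suc n)) * t ^ Suc n)) (at t)"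
      using DERIV_pow[of "Suc (Suc n)" t] by simp
    then have "((\<lambda>t. p t ^ Suc (Suc n)) has_real_derivative (real (Suc (Suc n)) * t ^ Suc n)) (at t)"
      by (rule has_field_derivative_transform_within_open[where S = "{0<..}"]) (use t in \<open>auto simp: p_def\<close>)
    then show ?thesis using t by (simp add: p_def)
  next
    assume t: "t = 0"
    have "((\<lambda>h. p h ^ Suc n) \<longlongrightarrow> 0) (at 0)"
    proof -
      have "isCont (\<lambda>h. p h ^ Suc n) 0" unfolding p_def by (intro continuous_intros)
      then show ?thesis by (simp add: isCont_def p_def)
    qed
    then have "((\<lambda>h. p h ^ Suc (Suc n) / h) \<longlongrightarrow> 0) (at 0)"
    proof (rule Lim_null_comparison[rotated])
      show "\<forall>\<^sub>F h in at 0. norm (p h ^ Suc (Suc n) / h) \<le> p h ^ Suc n"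
        by (intro always_eventually allI) (auto simp: p_def max_def)
    qed
    then show ?thesis using t by (simp add: has_field_derivative_iff p_def)
  qed
  have shift: "((\<lambda>t. g (t - a)) has_real_derivative D) (at t)" if "(g has_real_derivative D) (at (t - a))" for g a D t
    using that DERIV_shift[of g D t "- a"] by simp
  have dp3: "((\<lambda>t. p (t - a) ^ 3) has_real_derivative 3 * p (t - a) ^ 2) (at t)" for a t
    by (rule shift[of "\<lambda>t. p t ^ 3"]) (use dp[of 1 "t - a"] in \<open>simp add: numeral_3_eq_3 numeral_2_eq_2\<close>)
  have dp2: "((\<lambda>t. p (t - a) ^ 2) has_real_derivative 2 * p (t - a)) (at t)" for a t
    by (rule shift[of "\<lambda>t. p t ^ 2"]) (use dp[of 0 "t - a"] in \<open>simp add: numeral_2_eq_2\<close>)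
  \<comment> \<open>Third differences of truncated powers: \<open>s'\<close> is the quadratic
    B-spline with knots 0, 1, 2, 3, and \<open>s\<close> is its integral. \<open>s''\<close> is
    piecewise linear through the values 0, 1, -1, 0 at the knots.\<close>
  define s where "s t = (p (t - 0) ^ 3 - 3 * p (t - 1) ^ 3 + 3 * p (t - 2) ^ 3 - p (t - 3) ^ 3) / 6" for t
  define s' where "s' t = (p (t - 0) ^ 2 - 3 * p (t - 1) ^ 2 + 3 * p (t - 2) ^ 2 - p (t - 3) ^ 2) / 2" for t
  define s'' where "s'' t = p (t - 0) - 3 * p (t - 1) + 3 * p (t - 2) - p (t - 3)" for t
  show ?thesis
  proof (rule that[of s s' s''])
    fix t
    have "(s has_real_derivative (3 * p (t - 0) ^ 2 - 3 * (3 * p (t - 1) ^ 2) + 3 * (3 * p (t - 2) ^ 2) - 3 * p (t - 3) ^ 2) / 6) (at t)"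
      unfolding s_def[abs_def] by (intro DERIV_cdivide DERIV_diff DERIV_add DERIV_cmult dp3)
    then show "(s has_real_derivative s' t) (at t)" by (rule DERIV_cong) (simp add: s'_def field_simps)
    have "(s' has_real_derivative (2 * p (t - 0) - 3 * (2 * p (t - 1)) + 3 * (2 * p (t - 2)) - 2 * p (t - 3)) / 2) (at t)"
      unfolding s'_def[abs_def] by (intro DERIV_cdivide DERIV_diff DERIV_add DERIV_cmult dp2)
    then show "(s' has_real_derivative s'' t) (at t)" by (rule DERIV_cong) (simp add: s''_def field_simps)
    show "continuous_on UNIV s''" unfolding s''_def p_def by (intro continuous_intros)
    show z: "s t = 0" if "t \<le> 0" using that by (simp add: s_def p_def)
    show o: "s t = 1" if "t \<ge> 3"
      using that by (simp add: s_def p_def) (simp add: power3_eq_cube algebra_simps)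
    show "s' t = 0" if "t \<le> 0 \<or> t \<ge> 3"
      using that by (auto simp: s'_def p_def power2_eq_square algebra_simps)
    show "s'' t = 0" if "t \<le> 0 \<or> t \<ge> 3" using that by (auto simp: s''_def p_def)
    show "\<bar>s'' t\<bar> \<le> 1" by (auto simp: s''_def p_def max_def abs_le_iff)
    have "0 \<le> s t \<and> s t \<le> 1"
    proof -
      consider "t \<le> 0" | "0 \<le> t" "t \<le> 1" | "1 \<le> t" "t \<le> 2" | "2 \<le> t" "t \<le> 3" | "3 \<le> t" by linarith
      then show ?thesis
      proof cases
        case 2
        then have "s t = t ^ 3 / 6" by (simp add: s_def p_def)
        moreover have "0 \<le> t ^ 3 / 6" "t ^ 3 / 6 \<le> 1" using 2 power_le_one[of t 3] by simp_all
        ultimately show ?thesis by (intro conjI) linarith+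
      next
        case 3
        define r where "r = t - 1"
        have r: "0 \<le> r" "r \<le> 1" using 3 by (auto simp: r_def)
        have "s t = ((1 + r) ^ 3 - 3 * r ^ 3) / 6" using 3 by (simp add: s_def p_def r_def)
        also have "(1 + r) ^ 3 - 3 * r ^ 3 = 1 + 3 * r + 3 * r^2 - 2 * r^3" by (simp add: power3_eq_cube power2_eq_square algebra_simps)
        finally have s: "s t = (1 + 3 * r + 3 * r^2 - 2 * r^3) / 6" .
        \<comment> \<open>Both bounds on \<open>3 * r^2 - 2 * r^3\<close> come from factorisations:
          of the polynomial itself, and of 1 minus it, which is
          \<open>(1 - r)^2 * (1 + 2 * r)\<close>.\<close>
        have "0 \<le> r^2 * (3 - 2 * r)" using r by simp
        then have 1: "0 \<le> 3 * r^2 - 2 * r^3" by (simp add: power3_eq_cube power2_eq_square algebra_simps)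
        have "0 \<le> (1 - r)^2 * (1 + 2 * r)" using r by simp
        then have 2: "3 * r^2 - 2 * r^3 \<le> 1" by (simp add: power3_eq_cube power2_eq_square algebra_simps)
        show ?thesis unfolding s using 1 2 r by simp
      next
        case 4
        define r where "r = 3 - t"
        have r: "0 \<le> r" "r \<le> 1" using 4 by (auto simp: r_def)
        have "s t = ((3 - r) ^ 3 - 3 * ((3 - r) - 1) ^ 3 + 3 * ((3 - r) - 2) ^ 3) / 6" using 4 by (simp add: s_def p_def r_def)
        also have "((3 - r) ^ 3 - 3 * ((3 - r) - 1) ^ 3 + 3 * ((3 - r) - 2) ^ 3) / 6 = 1 - r ^ 3 / 6"
          by (simp add: power3_eq_cube field_simps)
        finally have s: "s t = 1 - r ^ 3 / 6" .
        moreover have "0 \<le> r ^ 3 / 6" "r ^ 3 / 6 \<le> 1" using r power_le_one[of r 3] by simp_all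
        ultimately show ?thesis by (intro conjI) linarith+
      qed (use z o in auto)
    qed
    then show "0 \<le> s t" "s t \<le> 1" by auto
  qed
qed

text \<open>A step rising on \<open>[- T - 3, - T]\<close> minus one rising on
  \<open>[T, T + 3]\<close>. The transition length does not depend on \<open>T\<close>, which keeps
  \<open>B''\<close> bounded; being less than \<open>pi\<close>, it will also fit into one box of
  \<open>box_bound\<close>.\<close>

lemma smooth_window:
  fixes T :: real assumes T: "T \<ge> 0"
  obtains B B' B'' :: "real \<Rightarrow> real" where
    "\<And>t. (B has_real_derivative B' t) (at t)" "\<And>t. (B' has_real_derivative B'' t) (at t)"
    "continuous_on UNIV B''" "\<And>t. 0 \<le> B t" "\<And>t. B t \<le> 1" "\<And>t. \<bar>t\<bar> \<le> T \<Longrightarrow> B t = 1" "\<And>t. \<bar>t\<bar> \<ge> T + 3 \<Longrightarrow> B t = 0"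
    "B' (T + 3) = 0" "B' (- (T + 3)) = 0" "\<And>t. \<bar>B'' t\<bar> \<le> 2" "\<And>t. \<bar>t\<bar> \<le> T \<Longrightarrow> B'' t = 0"
proof -
  obtain s s' s'' :: "real \<Rightarrow> real" where s: 
    "\<And>t. (s has_real_derivative s' t) (at t)" "\<And>t. (s' has_real_derivative s'' t) (at t)"
    "continuous_on UNIV s''" "\<And>t. 0 \<le> s t" "\<And>t. s t \<le> 1" "\<And>t. t \<le> 0 \<Longrightarrow> s t = 0" "\<And>t. t \<ge> 3 \<Longrightarrow> s t = 1"
    "\<And>t. t \<le> 0 \<or> t \<ge> 3 \<Longrightarrow> s' t = 0" "\<And>t. t \<le> 0 \<or> t \<ge> 3 \<Longrightarrow> s'' t = 0" "\<And>t. \<bar>s'' t\<bar> \<le> 1"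
    by (rule smooth_step) (rule that; assumption)
  have sh: "((\<lambda>t. g (t + c)) has_real_derivative g' (t + c)) (at t)" if "\<And>t. (g has_real_derivative g' t) (at t)" for g g' :: "real \<Rightarrow> real" and c t
    using that DERIV_shift by blast
  show ?thesis
  proof (rule that[of "\<lambda>t. s (t + (T + 3)) - s (t + (- T))" "\<lambda>t. s' (t + (T + 3)) - s' (t + (- T))" "\<lambda>t. s'' (t + (T + 3)) - s'' (t + (- T))"])
    fix t
    show "((\<lambda>t. s (t + (T + 3)) - s (t + (- T))) has_real_derivative s' (t + (T + 3)) - s' (t + (- T))) (at t)"
      by (intro DERIV_diff sh s)
    show "((\<lambda>t. s' (t + (T + 3)) - s' (t + (- T))) has_real_derivative s'' (t + (T + 3)) - s'' (t + (- T))) (at t)"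
      by (intro DERIV_diff sh s)
    show "continuous_on UNIV (\<lambda>t. s'' (t + (T + 3)) - s'' (t + (- T)))"
      by (intro continuous_intros continuous_on_compose2[OF s(3)]) auto
    show "0 \<le> s (t + (T + 3)) - s (t + (- T))"
      using s(4)[of "t + (T + 3)"] s(5)[of "t + (- T)"] s(6)[of "t + (- T)"] s(7)[of "t + (T + 3)"] T by (cases "t \<le> T") auto
    show "s (t + (T + 3)) - s (t + (- T)) \<le> 1" using s(5)[of "t + (T + 3)"] s(4)[of "t + (- T)"] by simp
    show "s (t + (T + 3)) - s (t + (- T)) = 1" if "\<bar>t\<bar> \<le> T"
      using that s(7)[of "t + (T + 3)"] s(6)[of "t + (- T)"] by auto
    show "s (t + (T + 3)) - s (t + (- T)) = 0" if "\<bar>t\<bar> \<ge> T + 3"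
    proof (cases "t \<ge> 0")
      case True
      then show ?thesis using that T s(7)[of "t + (T + 3)"] s(7)[of "t + (- T)"] by auto
    next
      case False
      then show ?thesis using that T s(6)[of "t + (T + 3)"] s(6)[of "t + (- T)"] by auto
    qed
    show "s' ((T + 3) + (T + 3)) - s' ((T + 3) + (- T)) = 0" using s(8)[of "(T + 3) + (T + 3)"] s(8)[of "(T + 3) + (- T)"] T by auto
    show "s' (- (T + 3) + (T + 3)) - s' (- (T + 3) + (- T)) = 0" using s(8)[of "- (T + 3) + (T + 3)"] s(8)[of "- (T + 3) + (- T)"] T by auto
    show "\<bar>s'' (t + (T + 3)) - s'' (t + (- T))\<bar> \<le> 2" using s(10)[of "t + (T + 3)"] s(10)[of "t + (- T)"] by linarith
    show "s'' (t + (T + 3)) - s'' (t + (- T)) = 0" if "\<bar>t\<bar> \<le> T"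
    proof -
      have "t + (T + 3) \<ge> 3" "t + (- T) \<le> 0" using that by linarith+
      then show ?thesis using s(9)[of "t + (T + 3)"] s(9)[of "t + (- T)"] by simp
    qed
  qed
qed

text \<open>What the argument needs of a Frostman shift: \<open>L\<close> is its value at
  \<open>+\<infinity>\<close>, nonzero as \<open>\<xi> \<noteq> a 1\<close>, and the rate
  \<open>2 powr (- Re s)\<close> is that of the term \<open>n = 2\<close> of the Dirichlet
  series.\<close>

locale halfplane_selfmap =
  fixes F :: "complex \<Rightarrow> complex" and L :: complex and C \<kappa> :: real
  assumes hol: "F holomorphic_on {s. Re s > 0}" and bd: "\<And>s. Re s > 0 \<Longrightarrow> cmod (F s) \<le> 1"
    and L0: "L \<noteq> 0" and decay: "\<And>s. Re s \<ge> \<kappa> \<Longrightarrow> cmod (F s - L) \<le> C * 2 powr (- Re s)"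
begin

text \<open>At the zeros of \<open>F\<close> the convention \<open>ln 0 = 0\<close> gives \<open>u\<close> the value \<open>0\<close> instead of \<open>\<infinity>\<close>.\<close>

definition u :: "real \<Rightarrow> real \<Rightarrow> real" where "u x y = - ln (cmod (F (Complex x y)))"

lemma u_nonneg: "x > 0 \<Longrightarrow> 0 \<le> u x y"
proof -
  assume "x > 0"
  then have "cmod (F (Complex x y)) \<le> 1" by (intro bd) simp
  then show ?thesis
    by (cases "F (Complex x y) = 0") (auto simp: u_def)
qed

text \<open>On the right side of the rectangle the test function is of size about \<open>b\<close>,
  so the logarithmic derivative has to be small even after multiplication by \<open>Re s\<close>.
  Exponential decay together with Cauchy's estimate gives this.\<close>

lemma near_infinity:
  assumes e: "e > 0"
  shows "\<exists>b\<ge>1. \<forall>s. Re s \<ge> b \<longrightarrow> F s \<noteq> 0 \<and> \<bar>ln (cmod (F s)) - ln (cmod L)\<bar> \<le> e \<and> Re s * cmod (deriv F s / F s) \<le> e"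
proof -
  have l: "isCont (\<lambda>w. ln (cmod w)) L" using L0 by (intro continuous_intros) auto
  obtain d where d: "d > 0" "\<And>w. cmod (w - L) < d \<Longrightarrow> \<bar>ln (cmod w) - ln (cmod L)\<bar> < e"
    using l e unfolding continuous_at_eps_delta dist_norm real_norm_def by blast
  have lim0: "((\<lambda>x. x * (2 * \<bar>C\<bar> * 2 powr (- x)) / (cmod L / 2)) \<longlongrightarrow> 0) at_top"
  proof -
    have "((\<lambda>x::real. x * 2 powr (- x)) \<longlongrightarrow> 0) at_top" by real_asymp
    then have "((\<lambda>x. (2 * \<bar>C\<bar> / (cmod L / 2)) * (x * 2 powr (- x))) \<longlongrightarrow> (2 * \<bar>C\<bar> / (cmod L / 2)) * 0) at_top"
      by (intro tendsto_intros)
    then show ?thesis by (simp add: mult_ac)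
  qed
  have lim1: "((\<lambda>x. C * 2 powr (- x)) \<longlongrightarrow> 0) at_top"
  proof -
    have "((\<lambda>x::real. 2 powr (- x)) \<longlongrightarrow> 0) at_top" by real_asymp
    then have "((\<lambda>x. C * 2 powr (- x)) \<longlongrightarrow> C * 0) at_top" by (intro tendsto_intros)
    then show ?thesis by simp
  qed
  have ev: "eventually (\<lambda>x. x * (2 * \<bar>C\<bar> * 2 powr (- x)) / (cmod L / 2) < e \<and> C * 2 powr (- x) < min d (cmod L / 2) \<and> x \<ge> max 2 (\<kappa> + 2)) at_top"
  proof (intro eventually_conj)
    show "eventually (\<lambda>x. x * (2 * \<bar>C\<bar> * 2 powr (- x)) / (cmod L / 2) < e) at_top" by (rule order_tendstoD(2)[OF lim0 e])
    show "eventually (\<lambda>x. C * 2 powr (- x) < min d (cmod L / 2)) at_top"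
      by (rule order_tendstoD(2)[OF lim1]) (use d L0 in auto)
    show "eventually (\<lambda>x. x \<ge> max 2 (\<kappa> + 2)) at_top" by (rule eventually_ge_at_top)
  qed
  then obtain b where b: "\<And>x. x \<ge> b \<Longrightarrow> x * (2 * \<bar>C\<bar> * 2 powr (- x)) / (cmod L / 2) < e"
     "\<And>x. x \<ge> b \<Longrightarrow> C * 2 powr (- x) < d" "\<And>x. x \<ge> b \<Longrightarrow> C * 2 powr (- x) < cmod L / 2" "\<And>x. x \<ge> b \<Longrightarrow> x \<ge> 2" "\<And>x. x \<ge> b \<Longrightarrow> x \<ge> \<kappa> + 2"
    unfolding eventually_at_top_linorder by auto
  have "F s \<noteq> 0 \<and> \<bar>ln (cmod (F s)) - ln (cmod L)\<bar> \<le> e \<and> Re s * cmod (deriv F s / F s) \<le> e" if s: "Re s \<ge> b" for s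
  proof -
    have x2: "Re s \<ge> 2" "Re s \<ge> \<kappa> + 2" using b s by auto
    have dF: "cmod (F s - L) \<le> C * 2 powr (- Re s)" using decay[of s] x2 by simp
    have "cmod L - cmod (F s - L) \<le> cmod (F s)" using norm_triangle_ineq4[of "F s" "F s - L"] by simp
    then have Fs: "cmod (F s) \<ge> cmod L / 2" using dF b(3)[OF s] by simp
    have Lp: "cmod L / 2 > 0" using L0 by simp
    have 1: "F s \<noteq> 0" using Fs Lp by auto
    have 2: "\<bar>ln (cmod (F s)) - ln (cmod L)\<bar> \<le> e" using d(2)[of "F s"] dF b(2)[OF s] by simp
    \<comment> \<open>On the unit disc around \<open>s\<close> the real part drops by at most 1,
      which only doubles the decay bound.\<close>
    have "norm ((deriv ^^ 1) (\<lambda>z. F z - L) s) \<le> fact 1 * (\<bar>C\<bar> * 2 powr (- (Re s - 1))) / 1 ^ 1"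
    proof (rule Cauchy_inequality)
      have inb: "Re z \<ge> Re s - 1" if "z \<in> cball s 1" for z
      proof -
        have "\<bar>Re (s - z)\<bar> \<le> 1" using that abs_Re_le_cmod[of "s - z"] by (simp add: dist_norm)
        then show ?thesis by simp
      qed
      have h: "(\<lambda>z. F z - L) holomorphic_on {s. Re s > 0}" by (intro holomorphic_intros hol)
      have sub: "cball s 1 \<subseteq> {s. Re s > 0}" using inb x2 by force
      show "(\<lambda>z. F z - L) holomorphic_on ball s 1"
        by (rule holomorphic_on_subset[OF h]) (use sub ball_subset_cball in blast)
      show "continuous_on (cball s 1) (\<lambda>z. F z - L)"
        by (rule continuous_on_subset[OF holomorphic_on_imp_continuous_on[OF h] sub])
      fix z assume "cmod (s - z) = 1"
      then have z: "Re z \<ge> Re s - 1" by (intro inb) (simp add: dist_norm)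
      have "cmod (F z - L) \<le> C * 2 powr (- Re z)" using z x2 by (intro decay) simp
      also have "\<dots> \<le> \<bar>C\<bar> * 2 powr (- (Re s - 1))" using z by (intro mult_mono) auto
      finally show "cmod (F z - L) \<le> \<bar>C\<bar> * 2 powr (- (Re s - 1))" .
    qed simp
    moreover have "deriv (\<lambda>z. F z - L) s = deriv F s"
    proof -
      have "(F has_field_derivative deriv F s) (at s)"
        by (rule holomorphic_derivI[OF hol]) (use x2 in \<open>auto simp: open_halfspace_Re_gt\<close>)
      then have "((\<lambda>z. F z - L) has_field_derivative deriv F s) (at s)" by (auto intro!: derivative_eq_intros)
      then show ?thesis by (rule DERIV_imp_deriv)
    qed
    moreover have "(2::real) powr (- (Re s - 1)) = 2 * 2 powr (- Re s)"
    proof -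
      have "- (Re s - 1) = 1 + - Re s" by simp
      then show ?thesis by (simp only: powr_add) simp
    qed
    ultimately have D: "cmod (deriv F s) \<le> 2 * \<bar>C\<bar> * 2 powr (- Re s)" by (simp add: mult_ac)
    have "Re s * cmod (deriv F s / F s) = Re s * (cmod (deriv F s) / cmod (F s))" by (simp add: norm_divide)
    also have "\<dots> \<le> Re s * ((2 * \<bar>C\<bar> * 2 powr (- Re s)) / (cmod L / 2))"
      using x2 D Fs Lp by (intro mult_left_mono frac_le) auto
    also have "\<dots> \<le> e" using b(1)[OF s] by (simp add: mult_ac)
    finally show ?thesis using 1 2 by blast
  qed
  then show ?thesis by (intro exI[of _ "max 1 b"]) auto
qed

lemma finite_zeros:
  assumes "p > 0"
  shows "finite {z. p \<le> Re z \<and> Re z \<le> r \<and> c \<le> Im z \<and> Im z \<le> d \<and> F z = 0}"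
proof -
  obtain b where b: "b \<ge> 1" "\<And>s. Re s \<ge> b \<Longrightarrow> F s \<noteq> 0" using near_infinity[of 1] by auto
  show ?thesis
  proof (cases "F constant_on {s. Re s > 0}")
    case True
    then obtain k where k: "\<And>s. Re s > 0 \<Longrightarrow> F s = k" by (auto simp: constant_on_def)
    have "k \<noteq> 0" using k[of "of_real b"] b(2)[of "of_real b"] b(1) by auto
    then have "{z. p \<le> Re z \<and> Re z \<le> r \<and> c \<le> Im z \<and> Im z \<le> d \<and> F z = 0} = {}" using k assms by auto
    then show ?thesis by (simp only: finite.emptyI)
  next
    case False
    have "finite {z \<in> cbox (Complex p c) (Complex r d). F z = 0}"
      by (rule holomorphic_compact_finite_zeros[OF hol open_halfspace_Re_gt _ compact_cbox _ False])
         (use assms in \<open>auto simp: in_cbox_complex_iff convex_halfspace_Re_gt intro!: convex_connected\<close>)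
    moreover have "{z. p \<le> Re z \<and> Re z \<le> r \<and> c \<le> Im z \<and> Im z \<le> d \<and> F z = 0} = {z \<in> cbox (Complex p c) (Complex r d). F z = 0}"
      by (auto simp: in_cbox_complex_iff)
    ultimately show ?thesis by simp
  qed
qed

text \<open>Zeros are isolated because \<open>F\<close> does not vanish identically: it has no zeros
  far to the right.\<close>

lemma eventually_nonzero:
  assumes "Re w > 0" shows "eventually (\<lambda>z. F z \<noteq> 0) (at w)"
proof -
  obtain b where b: "b \<ge> 1" "\<And>s. Re s \<ge> b \<Longrightarrow> F s \<noteq> 0" using near_infinity[of 1] by auto
  have "eventually (\<lambda>z. F z \<noteq> 0 \<and> z \<in> {s. Re s > 0}) (at w)"
    by (rule non_zero_neighbour_alt[OF hol open_halfspace_Re_gt, where \<beta> = "of_real b"])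
       (use assms b in \<open>auto intro!: convex_connected convex_halfspace_Re_gt\<close>)
  then show ?thesis by (auto elim: eventually_mono)
qed

lemma zorder_nonneg: 
  assumes "Re w > 0" shows "zorder F w \<ge> 0"
proof -
  have "frequently (\<lambda>z. F z \<noteq> 0) (at w)"
    using eventually_nonzero[OF assms] by (intro eventually_frequently) auto
  moreover have "F analytic_on {w}"
    using hol assms analytic_at[of F w] open_halfspace_Re_gt[of 0] by blast
  ultimately show ?thesis by (intro zorder_ge_0)
qed

text \<open>Passing to \<open>u\<close> and rearranging puts the terms on the left that are all
  nonnegative in \<open>box_bound\<close>, so each can be estimated by the right side. The
  neighbourhood \<open>U\<close> is an open box slightly larger than the rectangle and still inside
  the half-plane.\<close>

lemma green_rectangle:
  assumes ab: "0 < a" "a < b" "c < d" and nz: "\<forall>s. Re s \<ge> b \<longrightarrow> F s \<noteq> 0"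
  shows "\<And>\<phi>. continuous_on (cbox (a,c) (b,d)) \<phi> \<Longrightarrow> set_integrable lborel (cbox (a,c) (b,d)) (\<lambda>z. u (fst z) (snd z) * \<phi> z)" 
    and "\<And>\<phi> x. x \<in> {a..b} \<Longrightarrow> continuous_on {c..d} \<phi> \<Longrightarrow> set_integrable lborel {c..d} (\<lambda>y. u x y * \<phi> y)"
    and "\<And>A A' A'' B B' B''. \<lbrakk>\<And>x. (A has_real_derivative A' x) (at x); \<And>x. (A' has_real_derivative A'' x) (at x);
      \<And>x. (B has_real_derivative B' x) (at x); \<And>x. (B' has_real_derivative B'' x) (at x);
      continuous_on UNIV A''; continuous_on UNIV B''; A a = 0; B c = 0; B d = 0; B' c = 0; B' d = 0\<rbrakk> \<Longrightarrow>
     (LINT z:cbox (a,c) (b,d)|lborel. u (fst z) (snd z) * (A'' (fst z) * B (snd z) + A (fst z) * B'' (snd z)))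
     + 2 * pi * (\<Sum>w\<in>{w. a \<le> Re w \<and> Re w \<le> b \<and> Im w \<in> {c..d} \<and> F w = 0}. real_of_int (zorder F w) * A (Re w) * B (Im w))
     + (LINT y:{c..d}|lborel. u a y * (A' a * B y)) =
    (LINT y:{c..d}|lborel. (u b y * A' b + Re (deriv F (Complex b y) / F (Complex b y)) * A b) * B y)"
proof -
  define U where "U = box (Complex (a/2) (c - 1)) (Complex (b + 1) (d + 1))"
  have U: "open U" "convex U" "U \<subseteq> {s. Re s > 0}" "\<And>x y. x \<in> {a..b} \<Longrightarrow> y \<in> {c..d} \<Longrightarrow> Complex x y \<in> U"
    using ab by (auto simp: U_def in_box_complex_iff)
  have "{z \<in> U. F z = 0} \<subseteq> {z. a/2 \<le> Re z \<and> Re z \<le> b + 1 \<and> c - 1 \<le> Im z \<and> Im z \<le> d + 1 \<and> F z = 0}"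
    by (auto simp: U_def in_box_complex_iff)
  then have fin: "finite {z \<in> U. F z = 0}" using finite_zeros[of "a/2" "b+1" "c-1" "d+1"] ab by (auto intro: finite_subset)
  have nzb: "\<And>z. z \<in> U \<Longrightarrow> F z = 0 \<Longrightarrow> Re z < b" using nz by force
  note hU = holomorphic_on_subset[OF hol U(3)]
  show "set_integrable lborel (cbox (a,c) (b,d)) (\<lambda>z. u (fst z) (snd z) * \<phi> z)" if "continuous_on (cbox (a,c) (b,d)) \<phi>" for \<phi>
  proof -
    have "set_integrable lborel (cbox (a,c) (b,d)) (\<lambda>z. ln (cmod (F (Complex (fst z) (snd z)))) * \<phi> z)"
      by (rule green_rectangle_log_modulus(1)[OF ab(2,3) hU U(1,2,4) fin nzb that])
    from set_integrable_mult_right[OF this, of "-1"] show ?thesis by (simp add: u_def)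
  qed
  show "set_integrable lborel {c..d} (\<lambda>y. u x y * \<phi> y)" if "x \<in> {a..b}" "continuous_on {c..d} \<phi>" for x \<phi>
  proof -
    have "set_integrable lborel {c..d} (\<lambda>y. ln (cmod (F (Complex x y))) * \<phi> y)"
      by (rule green_rectangle_log_modulus(2)[OF ab(2,3) hU U(1,2,4) fin nzb that])
    from set_integrable_mult_right[OF this, of "-1"] show ?thesis by (simp add: u_def)
  qed
  fix A A' A'' B B' B'' :: "real \<Rightarrow> real"
  assume H: "\<And>x. (A has_real_derivative A' x) (at x)" "\<And>x. (A' has_real_derivative A'' x) (at x)"
      "\<And>x. (B has_real_derivative B' x) (at x)" "\<And>x. (B' has_real_derivative B'' x) (at x)"
      "continuous_on UNIV A''" "continuous_on UNIV B''" "A a = 0" "B c = 0" "B d = 0" "B' c = 0" "B' d = 0"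
  have G3: "(LINT z:cbox (a,c) (b,d)|lborel. ln (cmod (F (Complex (fst z) (snd z)))) * (A'' (fst z) * B (snd z) + A (fst z) * B'' (snd z))) =
    (LINT y:{c..d}|lborel. (ln (cmod (F (Complex b y))) * A' b - Re (deriv F (Complex b y) / F (Complex b y)) * A b) * B y)
    - (LINT y:{c..d}|lborel. ln (cmod (F (Complex a y))) * (A' a * B y))
    + 2 * pi * (\<Sum>w\<in>{w. a \<le> Re w \<and> Re w \<le> b \<and> Im w \<in> {c..d} \<and> F w = 0}. real_of_int (zorder F w) * A (Re w) * B (Im w))"
    by (rule green_rectangle_log_modulus(3)[OF ab(2,3) hU U(1,2,4) fin nzb H])
  have neg: "(LINT z:S|lborel. - k z) = - (LINT z:S|lborel. k z)" for S and k :: "'a::euclidean_space \<Rightarrow> real"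
    by (simp add: set_lebesgue_integral_def)
  have e1: "(LINT z:cbox (a,c) (b,d)|lborel. u (fst z) (snd z) * (A'' (fst z) * B (snd z) + A (fst z) * B'' (snd z)))
     = - (LINT z:cbox (a,c) (b,d)|lborel. ln (cmod (F (Complex (fst z) (snd z)))) * (A'' (fst z) * B (snd z) + A (fst z) * B'' (snd z)))"
    by (subst neg[symmetric]) (simp only: u_def mult_minus_left)
  have e2: "(LINT y:{c..d}|lborel. u a y * (A' a * B y)) = - (LINT y:{c..d}|lborel. ln (cmod (F (Complex a y))) * (A' a * B y))"
    by (subst neg[symmetric]) (simp only: u_def mult_minus_left)
  have "(u b y * A' b + Re (deriv F (Complex b y) / F (Complex b y)) * A b) * B y = - ((ln (cmod (F (Complex b y))) * A' b - Re (deriv F (Complex b y) / F (Complex b y)) * A b) * B y)" for y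
  proof -
    have "(- l * p + r * q) * t = - ((l * p - r * q) * t)" for l p r q t :: real by (simp add: algebra_simps)
    then show ?thesis unfolding u_def .
  qed
  then have e3: "(LINT y:{c..d}|lborel. (u b y * A' b + Re (deriv F (Complex b y) / F (Complex b y)) * A b) * B y) = 
     - (LINT y:{c..d}|lborel. (ln (cmod (F (Complex b y))) * A' b - Re (deriv F (Complex b y) / F (Complex b y)) * A b) * B y)"
    by (subst neg[symmetric]) (simp only:)
  show "(LINT z:cbox (a,c) (b,d)|lborel. u (fst z) (snd z) * (A'' (fst z) * B (snd z) + A (fst z) * B'' (snd z)))
     + 2 * pi * (\<Sum>w\<in>{w. a \<le> Re w \<and> Re w \<le> b \<and> Im w \<in> {c..d} \<and> F w = 0}. real_of_int (zorder F w) * A (Re w) * B (Im w))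
     + (LINT y:{c..d}|lborel. u a y * (A' a * B y)) =
    (LINT y:{c..d}|lborel. (u b y * A' b + Re (deriv F (Complex b y) / F (Complex b y)) * A b) * B y)"
    unfolding e1 e2 e3 G3 by simp
qed

end

context halfplane_selfmap
begin

text \<open>The test function is \<open>sinh (2 (x - a)) cos\<^sup>2 (y - q)\<close>: its Laplacian \<open>2 sinh (2 (x - a))\<close>
  dominates \<open>4 (x - a)\<close>, and it vanishes to second order on the horizontal sides.\<close>

lemma box_bound:
  assumes b: "1 \<le> b" and nz: "\<forall>s. Re s \<ge> b \<longrightarrow> F s \<noteq> 0"
    and m: "\<And>y. u b y \<le> m" "\<And>y. cmod (deriv F (Complex b y) / F (Complex b y)) \<le> 1" and m0: "0 \<le> m"
    and a: "0 < a" "a < b"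
  shows "(LINT z:cbox (a,q - pi/2) (b,q + pi/2)|lborel. u (fst z) (snd z) * (fst z - a)) \<le> pi * (2 * m * cosh (2 * b) + sinh (2 * b))"
proof -
  let ?c = "q - pi/2" and ?d = "q + pi/2"
  let ?R = "cbox (a,?c) (b,?d)"
  define A A' A'' where "A x = sinh (2 * (x - a))" and "A' x = 2 * cosh (2 * (x - a))" and "A'' x = 4 * sinh (2 * (x - a))" for x
  define B B' B'' where "B y = (1 + cos (2 * (y - q))) / 2" and "B' y = - sin (2 * (y - q))" and "B'' y = - (2 * cos (2 * (y - q)))" for y
  have cd: "?c < ?d" by simp
  have dA: "(A has_real_derivative A' x) (at x)" "(A' has_real_derivative A'' x) (at x)" for x
    unfolding A_def[abs_def] A'_def[abs_def] A''_def by (auto intro!: derivative_eq_intros)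
  have dB: "(B has_real_derivative B' x) (at x)" "(B' has_real_derivative B'' x) (at x)" for x
    unfolding B_def[abs_def] B'_def[abs_def] B''_def by (auto intro!: derivative_eq_intros)
  have cA: "continuous_on S A''" "continuous_on S B''" "continuous_on S A" "continuous_on S B" for S 
    unfolding A''_def B''_def A_def B_def by (intro continuous_intros; simp)+
  have ends: "A a = 0" "B ?c = 0" "B ?d = 0" "B' ?c = 0" "B' ?d = 0" 
    by (simp_all add: A_def B_def B'_def)
  have "-1 \<le> x \<Longrightarrow> 0 \<le> (1 + x) / 2" "x \<le> 1 \<Longrightarrow> (1 + x) / 2 \<le> 1" for x :: real by simp_all
  then have B0: "0 \<le> B y" and B1: "B y \<le> 1" for y
    unfolding B_def by (blast intro: cos_ge_minus_one cos_le_one)+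
  note B01 = B0 B1
  have A0: "0 \<le> A x" "0 \<le> A' x" if "x \<ge> a" for x using that by (simp_all add: A_def A'_def)
  \<comment> \<open>\<open>A'' = 4 A\<close> and \<open>B'' = 2 - 4 B\<close>, so that
    \<open>B\<close> cancels from the Laplacian and nothing degenerates near the horizontal
    sides.\<close>
  have D: "A'' x * B y + A x * B'' y = 2 * A x" for x y by (simp add: A''_def B_def A_def B''_def algebra_simps)
  note G = green_rectangle[OF a cd nz]
  have id: "(LINT z:?R|lborel. u (fst z) (snd z) * (2 * A (fst z)))
     + 2 * pi * (\<Sum>w\<in>{w. a \<le> Re w \<and> Re w \<le> b \<and> Im w \<in> {?c..?d} \<and> F w = 0}. real_of_int (zorder F w) * A (Re w) * B (Im w))
     + (LINT y:{?c..?d}|lborel. u a y * (A' a * B y)) =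
    (LINT y:{?c..?d}|lborel. (u b y * A' b + Re (deriv F (Complex b y) / F (Complex b y)) * A b) * B y)"
    using G(3)[OF dA dB cA(1,2) ends] unfolding D by simp
  have s0: "0 \<le> (\<Sum>w\<in>{w. a \<le> Re w \<and> Re w \<le> b \<and> Im w \<in> {?c..?d} \<and> F w = 0}. real_of_int (zorder F w) * A (Re w) * B (Im w))"
    by (intro sum_nonneg mult_nonneg_nonneg) (use zorder_nonneg a A0 B01 in auto)
  have l0: "0 \<le> (LINT y:{?c..?d}|lborel. u a y * (A' a * B y))"
    unfolding set_lebesgue_integral_def
    by (intro integral_nonneg_AE AE_I2) (use u_nonneg[OF a(1)] A0[of a] B01 in simp)
  have r: "(LINT y:{?c..?d}|lborel. (u b y * A' b + Re (deriv F (Complex b y) / F (Complex b y)) * A b) * B y) \<le> (2 * m * cosh (2 * b) + sinh (2 * b)) * pi"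
  proof -
    have pt: "(u b y * A' b + Re (deriv F (Complex b y) / F (Complex b y)) * A b) * B y \<le> 2 * m * cosh (2 * b) + sinh (2 * b)" for y
    proof -
      have "Re (deriv F (Complex b y) / F (Complex b y)) \<le> 1" using complex_Re_le_cmod m(2) by (rule order_trans)
      moreover have "A' b \<le> 2 * cosh (2 * b)" "A b \<le> sinh (2 * b)" using a by (simp_all add: A'_def A_def cosh_real_nonneg_le_iff)
      ultimately have "u b y * A' b + Re (deriv F (Complex b y) / F (Complex b y)) * A b \<le> m * (2 * cosh (2 * b)) + 1 * sinh (2 * b)"
        using m(1)[of y] m0 A0[of b] a by (intro add_mono mult_mono) auto
      then have "(u b y * A' b + Re (deriv F (Complex b y) / F (Complex b y)) * A b) * B y \<le> (m * (2 * cosh (2 * b)) + 1 * sinh (2 * b)) * B y"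
        using B01 by (intro mult_right_mono)
      also have "\<dots> \<le> (m * (2 * cosh (2 * b)) + 1 * sinh (2 * b)) * 1"
        using B01 m0 b by (intro mult_left_mono add_nonneg_nonneg mult_nonneg_nonneg) auto
      finally show ?thesis by simp
    qed
    let ?K = "2 * m * cosh (2 * b) + sinh (2 * b)"
    \<comment> \<open>Were the integrand not integrable, its integral would be 0 by convention, and
      the bound would hold because \<open>?K\<close> is nonnegative.\<close>
    have "(LINT y:{?c..?d}|lborel. (u b y * A' b + Re (deriv F (Complex b y) / F (Complex b y)) * A b) * B y) \<le> (LINT y:{?c..?d}|lborel. ?K)"
    proof (cases "set_integrable lborel {?c..?d} (\<lambda>y. (u b y * A' b + Re (deriv F (Complex b y) / F (Complex b y)) * A b) * B y)")
      case True
      show ?thesis by (rule set_integral_mono[OF True]) (use pt in \<open>auto intro: set_lebesgue_integral_continuous(1)\<close>)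
    next
      case False
      then have "(LINT y:{?c..?d}|lborel. (u b y * A' b + Re (deriv F (Complex b y) / F (Complex b y)) * A b) * B y) = 0"
        unfolding set_integrable_def set_lebesgue_integral_def by (rule not_integrable_integral_eq)
      moreover have "0 \<le> (LINT y:{?c..?d}|lborel. ?K)" using m0 b by (simp add: set_lebesgue_integral_def)
      ultimately show ?thesis by simp
    qed
    also have "(LINT y:{?c..?d}|lborel. ?K) = ?K * pi" by (simp add: set_lebesgue_integral_def)
    finally show ?thesis .
  qed
  have "(LINT z:?R|lborel. u (fst z) (snd z) * (fst z - a)) \<le> (LINT z:?R|lborel. u (fst z) (snd z) * (2 * A (fst z)))"
  proof (rule set_integral_mono)
    show "set_integrable lborel ?R (\<lambda>z. u (fst z) (snd z) * (fst z - a))" by (intro G(1) continuous_intros)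
    show "set_integrable lborel ?R (\<lambda>z. u (fst z) (snd z) * (2 * A (fst z)))" 
      by (intro G(1) continuous_intros continuous_on_compose2[OF cA(3)[of UNIV]]) auto
    fix z assume "z \<in> ?R"
    then have z: "a \<le> fst z" by (cases z) auto
    have "x \<le> sinh x" if "x \<ge> 0" for x :: real
    proof -
      have "(\<lambda>x. sinh x - x) 0 \<le> (\<lambda>x. sinh x - x) x"
        by (rule DERIV_nonneg_imp_nondecreasing[OF that]) (auto intro!: derivative_eq_intros exI simp: cosh_real_ge_1)
      then show ?thesis by simp
    qed
    from this[of "2 * (fst z - a)"] z have "fst z - a \<le> 2 * A (fst z)" by (simp add: A_def)
    then show "u (fst z) (snd z) * (fst z - a) \<le> u (fst z) (snd z) * (2 * A (fst z))"
      using u_nonneg[of "fst z" "snd z"] z a by (intro mult_left_mono) auto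
  qed
  moreover have "0 \<le> 2 * pi * (\<Sum>w\<in>{w. a \<le> Re w \<and> Re w \<le> b \<and> Im w \<in> {?c..?d} \<and> F w = 0}. real_of_int (zorder F w) * A (Re w) * B (Im w))"
    using s0 by (intro mult_nonneg_nonneg) auto
  ultimately have "(LINT z:?R|lborel. u (fst z) (snd z) * (fst z - a)) \<le> (2 * m * cosh (2 * b) + sinh (2 * b)) * pi"
    using id l0 r by linarith
  then show ?thesis by (simp only: mult.commute)
qed


text \<open>The derivatives are hidden behind existential quantifiers, so that limits can be stated
  for \<open>B\<close> alone.\<close>

definition window :: "real \<Rightarrow> (real \<Rightarrow> real) \<Rightarrow> bool" where
  "window T B \<longleftrightarrow> (\<exists>B' B''. (\<forall>t. (B has_real_derivative B' t) (at t)) \<and> (\<forall>t. (B' has_real_derivative B'' t) (at t)) \<and>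
    continuous_on UNIV B'' \<and> (\<forall>t. 0 \<le> B t \<and> B t \<le> 1) \<and> (\<forall>t. \<bar>t\<bar> \<le> T \<longrightarrow> B t = 1) \<and> (\<forall>t. \<bar>t\<bar> \<ge> T + 3 \<longrightarrow> B t = 0) \<and>
    B' (T + 3) = 0 \<and> B' (- (T + 3)) = 0 \<and> (\<forall>t. \<bar>B'' t\<bar> \<le> 2) \<and> (\<forall>t. \<bar>t\<bar> \<le> T \<longrightarrow> B'' t = 0))"

definition zeros :: "real \<Rightarrow> real \<Rightarrow> complex set" where
  "zeros a R = {w. a \<le> Re w \<and> \<bar>Im w\<bar> \<le> R \<and> F w = 0}"

text \<open>With \<open>A x = x - a\<close> the Laplacian of the test function is
  \<open>(x - a) * B'' y\<close>. It lives where \<open>T \<le> |y| \<le> T + 3\<close>, which two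
  boxes of \<open>box_bound\<close> cover, and so costs a constant. On the far right side
  \<open>u\<close> is close to \<open>- ln |L|\<close>, which gives the main term. \<open>C0\<close>
  depends on \<open>e\<close>, but not on \<open>T\<close>, \<open>B\<close> or
  \<open>a\<close>.\<close>

lemma window_estimate:
  assumes e: "e > 0"
  shows "\<exists>C0\<ge>0. \<forall>T\<ge>0. \<forall>B. window T B \<longrightarrow> (\<forall>a. 0 < a \<and> a \<le> 1/2 \<longrightarrow>
     \<bar>2 * pi * (\<Sum>w\<in>zeros a (T + 3). real_of_int (zorder F w) * (Re w - a) * B (Im w))
      + (LINT y:{- (T + 3)..T + 3}|lborel. u a y * B y) - 2 * T * (- ln (cmod L))\<bar> \<le> e * (2 * T + 6) + C0)"
proof -
  let ?m = "- ln (cmod L)"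
  \<comment> \<open>In the minimum, \<open>e / 2\<close> serves the main term, while 1 is the bound
    that \<open>box_bound\<close> asks of the logarithmic derivative.\<close>
  obtain b where b: "1 \<le> b" "\<And>s. Re s \<ge> b \<Longrightarrow> F s \<noteq> 0" "\<And>s. Re s \<ge> b \<Longrightarrow> \<bar>ln (cmod (F s)) - ln (cmod L)\<bar> \<le> min (e/2) 1"
      "\<And>s. Re s \<ge> b \<Longrightarrow> Re s * cmod (deriv F s / F s) \<le> min (e/2) 1"
    using near_infinity[of "min (e/2) 1"] e by auto
  have b2: "\<forall>s. Re s \<ge> b \<longrightarrow> F s \<noteq> 0" using b(2) by blast
  define m1 where "m1 = \<bar>?m\<bar> + 1"
  have ub: "\<bar>u b y - ?m\<bar> \<le> min (e/2) 1" for y using b(3)[of "Complex b y"] by (simp add: u_def abs_minus_commute)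
  have db: "b * cmod (deriv F (Complex b y) / F (Complex b y)) \<le> min (e/2) 1" for y using b(4)[of "Complex b y"] by simp
  have db1: "cmod (deriv F (Complex b y) / F (Complex b y)) \<le> 1" for y
  proof -
    have "1 * cmod (deriv F (Complex b y) / F (Complex b y)) \<le> b * cmod (deriv F (Complex b y) / F (Complex b y))"
      using b(1) by (rule mult_right_mono) simp
    then show ?thesis using db[of y] by simp
  qed
  have ub1: "u b y \<le> m1" for y using ub[of y] unfolding m1_def min.bounded_iff by linarith
  define K where "K = pi * (2 * m1 * cosh (2 * b) + sinh (2 * b))"
  have K: "0 \<le> K" using b(1) unfolding K_def m1_def by (intro mult_nonneg_nonneg add_nonneg_nonneg) auto
  have box: "(LINT z:cbox (a,q - pi/2) (b,q + pi/2)|lborel. u (fst z) (snd z) * (fst z - a)) \<le> K" if "0 < a" "a < b" for a q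
    unfolding K_def by (rule box_bound[OF b(1) b2 ub1 db1 _ that]) (simp_all add: m1_def)
  show ?thesis
  \<comment> \<open>\<open>4 * K\<close> stands for two boxes, each with
    \<open>|B''| \<le> 2\<close>; \<open>6 * |?m|\<close> appears because the integral of
    \<open>B\<close> exceeds \<open>2 * T\<close> by at most 6.\<close>
  proof (intro exI[of _ "4 * K + 6 * \<bar>?m\<bar>"] conjI allI impI)
    show "0 \<le> 4 * K + 6 * \<bar>?m\<bar>" using K by simp
    fix T B a assume T: "0 \<le> (T::real)" and "window T B" and a: "0 < a \<and> a \<le> (1/2::real)"
    then obtain B' B'' where dB: "\<And>t. (B has_real_derivative B' t) (at t)" "\<And>t. (B' has_real_derivative B'' t) (at t)"
      and cB: "continuous_on UNIV B''" and B01: "\<And>t. 0 \<le> B t" "\<And>t. B t \<le> 1" and B1: "\<And>t. \<bar>t\<bar> \<le> T \<Longrightarrow> B t = 1" 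
      and B0: "\<And>t. \<bar>t\<bar> \<ge> T + 3 \<Longrightarrow> B t = 0" and B': "B' (- (T + 3)) = 0" "B' (T + 3) = 0" 
      and B2: "\<And>t. \<bar>B'' t\<bar> \<le> 2" "\<And>t. \<bar>t\<bar> \<le> T \<Longrightarrow> B'' t = 0"
      unfolding window_def by metis
    let ?c = "- (T + 3)" and ?d = "T + 3"
    let ?R = "cbox (a,?c) (b,?d)"
    have ab: "0 < a" "a < b" "?c < ?d" using a b(1) T by auto
    have contB: "continuous_on S B" for S using DERIV_continuous_on[OF has_field_derivative_at_within[OF dB(1)]] by blast
    have contB'': "continuous_on S (\<lambda>z. B'' (snd z))" for S :: "(real \<times> real) set"
      by (intro continuous_on_compose2[OF cB] continuous_intros) auto
    note G = green_rectangle[OF ab b2]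
    let ?S = "\<Sum>w\<in>zeros a (T + 3). real_of_int (zorder F w) * (Re w - a) * B (Im w)"
    have dA: "((\<lambda>x. x - a) has_real_derivative 1) (at x)" "((\<lambda>x. 1) has_real_derivative 0) (at x)" for x
      by (auto intro!: derivative_eq_intros)
    have Bc: "B ?c = 0" "B ?d = 0" using B0[of ?c] B0[of ?d] T by auto
    have zs: "{w. a \<le> Re w \<and> Re w \<le> b \<and> Im w \<in> {?c..?d} \<and> F w = 0} = zeros a (T + 3)"
    proof -
      have "Re w \<le> b" if "F w = 0" for w using b(2)[of w] that by force
      then show ?thesis unfolding zeros_def by auto
    qed
    let ?DD = "LINT z:?R|lborel. u (fst z) (snd z) * ((fst z - a) * B'' (snd z))"
    let ?h = "\<lambda>y. u b y + Re (deriv F (Complex b y) / F (Complex b y)) * (b - a)"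
    let ?V = "LINT y:{?c..?d}|lborel. ?h y * B y"
    have id: "?DD + 2 * pi * ?S + (LINT y:{?c..?d}|lborel. u a y * B y) = ?V"
      using G(3)[OF dA dB _ cB _ Bc B'] unfolding zs by simp
    have hb: "\<bar>?h y - ?m\<bar> \<le> e" for y
    proof -
      have "\<bar>Re (deriv F (Complex b y) / F (Complex b y)) * (b - a)\<bar> \<le> cmod (deriv F (Complex b y) / F (Complex b y)) * b"
        unfolding abs_mult using ab by (intro mult_mono abs_Re_le_cmod) auto
      also have "\<dots> \<le> e/2" using db[of y] by (simp add: mult.commute)
      finally have "\<bar>Re (deriv F (Complex b y) / F (Complex b y)) * (b - a)\<bar> \<le> e/2" .
      moreover have "\<bar>u b y - ?m\<bar> \<le> e/2" using ub[of y] by simp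
      ultimately show ?thesis by linarith
    qed
    have contC: "continuous_on {?c..?d} (\<lambda>y. k (Complex b y))" if "k holomorphic_on {s. Re s > 0}" for k
      by (rule continuous_on_compose2[OF holomorphic_on_imp_continuous_on[OF that]]) (use ab in \<open>auto simp: Complex_eq intro!: continuous_intros\<close>)
    have Fn: "F (Complex b y) \<noteq> 0" for y using b(2)[of "Complex b y"] by simp
    have ch: "continuous_on {?c..?d} ?h"
      unfolding u_def by (intro continuous_intros contC hol holomorphic_deriv open_halfspace_Re_gt) (use Fn in auto)
    have iV: "set_integrable lborel {?c..?d} (\<lambda>y. ?h y * B y)"
      by (intro set_lebesgue_integral_continuous(1) continuous_on_mult ch contB compact_Icc)
    have iB: "set_integrable lborel {?c..?d} B" 
      by (intro set_lebesgue_integral_continuous(1) contB compact_Icc)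
    let ?I = "LINT y:{?c..?d}|lborel. B y"
    have icon: "set_integrable lborel {p..q} (\<lambda>y. k)" for p q k :: real
      by (intro set_lebesgue_integral_continuous(1) continuous_intros compact_Icc)
    have I1: "?I \<le> 2 * T + 6"
    proof -
      have "?I \<le> (LINT y:{?c..?d}|lborel. 1)" by (rule set_integral_mono[OF iB icon]) (use B01 in auto)
      also have "\<dots> = 2 * T + 6" using T by (simp add: set_lebesgue_integral_def)
      finally show ?thesis .
    qed
    have I2: "2 * T \<le> ?I"
    proof -
      have "2 * T = (LINT y:{-T..T}|lborel. 1)" using T by (simp add: set_lebesgue_integral_def)
      also have "\<dots> \<le> ?I" unfolding set_lebesgue_integral_def
        by (intro integral_mono) (use iB icon[of "-T" T 1] B01 B1 in \<open>auto simp: set_integrable_def indicator_def\<close>)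
      finally show ?thesis .
    qed
    have V1: "?V \<le> (?m + e) * ?I"
    proof -
      have "?V \<le> (LINT y:{?c..?d}|lborel. (?m + e) * B y)"
      proof (rule set_integral_mono[OF iV])
        show "?h y * B y \<le> (?m + e) * B y" for y using hb[of y] B01(1)[of y] by (intro mult_right_mono) (simp_all add: abs_le_iff)
      qed (use iB in simp)
      then show ?thesis by simp
    qed
    have V2: "(?m - e) * ?I \<le> ?V"
    proof -
      have "(LINT y:{?c..?d}|lborel. (?m - e) * B y) \<le> ?V"
      proof (rule set_integral_mono[OF _ iV])
        show "(?m - e) * B y \<le> ?h y * B y" for y using hb[of y] B01(1)[of y] by (intro mult_right_mono) (simp_all add: abs_le_iff)
      qed (use iB in simp)
      then show ?thesis by simp
    qed
    have V: "\<bar>?V - 2 * T * ?m\<bar> \<le> e * (2 * T + 6) + 6 * \<bar>?m\<bar>"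
    proof -
      have "\<bar>?m * (?I - 2 * T)\<bar> \<le> \<bar>?m\<bar> * 6" unfolding abs_mult using I1 I2 by (intro mult_left_mono) auto
      then have "\<bar>?m * ?I - 2 * T * ?m\<bar> \<le> 6 * \<bar>?m\<bar>" by (simp add: algebra_simps)
      moreover have "\<bar>?V - ?m * ?I\<bar> \<le> e * ?I" using V1 V2 by (simp add: algebra_simps abs_le_iff)
      moreover have "e * ?I \<le> e * (2 * T + 6)" using I1 e by (intro mult_left_mono) auto
      ultimately show ?thesis by linarith
    qed
    have DD: "\<bar>?DD\<bar> \<le> 4 * K"
    proof -
      \<comment> \<open>The middles of the two transition strips. Boxes of height
        \<open>pi > 3\<close> centred there cover the strips.\<close>
      let ?q1 = "T + 3/2" and ?q2 = "- (T + 3/2)"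
      let ?R1 = "cbox (a, ?q1 - pi/2) (b, ?q1 + pi/2)" and ?R2 = "cbox (a, ?q2 - pi/2) (b, ?q2 + pi/2)"
      let ?g = "\<lambda>z. u (fst z) (snd z) * (fst z - a)"
      have iR: "integrable lborel (\<lambda>z. indicator (cbox (a, q - pi/2) (b, q + pi/2)) z *\<^sub>R ?g z)" for q
      proof -
        have "q - pi/2 < q + pi/2" by simp
        moreover have "continuous_on (cbox (a, q - pi/2) (b, q + pi/2)) (\<lambda>z. fst z - a)" by (intro continuous_intros)
        ultimately show ?thesis
          using green_rectangle(1)[OF ab(1,2) _ b2, of "q - pi/2" "q + pi/2" "\<lambda>z. fst z - a"] unfolding set_integrable_def by blast
      qed
      have iD: "integrable lborel (\<lambda>z. indicator ?R z *\<^sub>R (u (fst z) (snd z) * ((fst z - a) * B'' (snd z))))"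
      proof -
        have "continuous_on ?R (\<lambda>z. (fst z - a) * B'' (snd z))" by (intro continuous_intros contB'')
        from G(1)[OF this] show ?thesis unfolding set_integrable_def .
      qed
      have pi3: "3/2 \<le> pi/2" using pi_gt3 by simp
      have "\<bar>?DD\<bar> \<le> (\<integral>z. norm (indicator ?R z *\<^sub>R (u (fst z) (snd z) * ((fst z - a) * B'' (snd z)))) \<partial>lborel)"
        unfolding set_lebesgue_integral_def real_norm_def[symmetric] by (rule integral_norm_bound)
      also have "\<dots> \<le> (\<integral>z. 2 * (indicator ?R1 z *\<^sub>R ?g z) + 2 * (indicator ?R2 z *\<^sub>R ?g z) \<partial>lborel)"
      proof (rule integral_mono)
        show "integrable lborel (\<lambda>z. norm (indicator ?R z *\<^sub>R (u (fst z) (snd z) * ((fst z - a) * B'' (snd z)))))"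
          by (rule integrable_norm[OF iD])
        show "integrable lborel (\<lambda>z. 2 * (indicator ?R1 z *\<^sub>R ?g z) + 2 * (indicator ?R2 z *\<^sub>R ?g z))"
          by (intro Bochner_Integration.integrable_add integrable_mult_right iR)
        fix z :: "real \<times> real"
        obtain x y where z: "z = (x, y)" by (cases z)
        have nn: "0 \<le> indicator (cbox (a, q - pi/2) (b, q + pi/2)) z *\<^sub>R ?g z" for q
          using u_nonneg[of x y] ab by (auto simp: indicator_def z intro!: mult_nonneg_nonneg)
        show "norm (indicator ?R z *\<^sub>R (u (fst z) (snd z) * ((fst z - a) * B'' (snd z)))) \<le> 2 * (indicator ?R1 z *\<^sub>R ?g z) + 2 * (indicator ?R2 z *\<^sub>R ?g z)"
        proof (cases "z \<in> ?R \<and> \<bar>y\<bar> > T")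
          case True
          then have xy: "a \<le> x" "x \<le> b" "\<bar>y\<bar> \<le> T + 3" "\<bar>y\<bar> > T" by (auto simp: z)
          have g0: "0 \<le> ?g z" using u_nonneg[of x y] xy ab by (simp add: z)
          have "norm (indicator ?R z *\<^sub>R (u (fst z) (snd z) * ((fst z - a) * B'' (snd z)))) = ?g z * \<bar>B'' y\<bar>"
            using True g0 u_nonneg[of x y] xy(1) ab(1) by (simp add: z abs_mult mult.assoc[symmetric])
          also have "\<dots> \<le> ?g z * 2" using B2(1)[of y] g0 by (rule mult_left_mono)
          finally have le: "norm (indicator ?R z *\<^sub>R (u (fst z) (snd z) * ((fst z - a) * B'' (snd z)))) \<le> 2 * ?g z" by (simp add: mult.commute)
          have "z \<in> ?R1 \<or> z \<in> ?R2" using xy pi3 by (auto simp: z abs_le_iff abs_if split: if_splits)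
          then show ?thesis
          proof
            assume "z \<in> ?R1"
            then have "indicator ?R1 z *\<^sub>R ?g z = ?g z" by simp
            then show ?thesis using le nn[of ?q2] by linarith
          next
            assume "z \<in> ?R2"
            then have "indicator ?R2 z *\<^sub>R ?g z = ?g z" by simp
            then show ?thesis using le nn[of ?q1] by linarith
          qed
        next
          case False
          then have "norm (indicator ?R z *\<^sub>R (u (fst z) (snd z) * ((fst z - a) * B'' (snd z)))) = 0"
            using B2(2)[of y] by (cases "z \<in> ?R") (auto simp: z)
          then show ?thesis using nn[of ?q1] nn[of ?q2] by linarith
        qed
      qed
      also have "\<dots> = 2 * (LINT z:?R1|lborel. ?g z) + 2 * (LINT z:?R2|lborel. ?g z)"
        unfolding set_lebesgue_integral_def
        by (subst Bochner_Integration.integral_add) (intro integrable_mult_right iR, intro integrable_mult_right iR, simp only: integral_mult_right_zero)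
      also have "\<dots> \<le> 4 * K" using box[OF ab(1,2), of ?q1] box[OF ab(1,2), of ?q2] by linarith
      finally show ?thesis .
    qed
    show "\<bar>2 * pi * ?S + (LINT y:{?c..?d}|lborel. u a y * B y) - 2 * T * ?m\<bar> \<le> e * (2 * T + 6) + (4 * K + 6 * \<bar>?m\<bar>)"
      using id DD V by linarith
  qed
qed

end

section \<open>The counting function\<close>

context halfplane_selfmap
begin

lemma finite_zeros_right:
  assumes "a > 0" shows "finite (zeros a R)"
proof -
  obtain b where b: "b \<ge> 1" "\<And>s. Re s \<ge> b \<Longrightarrow> F s \<noteq> 0" using near_infinity[of 1] by auto
  have "zeros a R \<subseteq> {z. a \<le> Re z \<and> Re z \<le> b \<and> - R \<le> Im z \<and> Im z \<le> R \<and> F z = 0}"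
    unfolding zeros_def using b(2) by (auto simp: abs_le_iff) (meson linear)
  then show ?thesis using finite_zeros[OF assms] by (rule finite_subset)
qed

text \<open>The zero sum is squeezed between two windows: that for \<open>T\<close> equals 1 on
  \<open>[- T, T]\<close> and counts everything there in full, that for \<open>T - 3\<close> is
  supported in \<open>[- T, T]\<close>. Their main terms differ by a constant, which the division by
  \<open>2 * T\<close> removes.\<close>

lemma counting_limit:
  fixes u0 :: "real \<Rightarrow> real" and \<sigma> :: "nat \<Rightarrow> real"
  assumes \<sigma>: "\<And>n. \<sigma> n > 0" "\<sigma> \<longlonglongrightarrow> 0" and u0: "\<And>y. u0 y \<ge> 0" and int: "\<And>R. set_integrable lborel {-R..R} u0"
    and conv: "\<And>T B. T \<ge> 0 \<Longrightarrow> window T B \<Longrightarrow>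
      (\<lambda>n. LINT y:{- (T + 3)..T + 3}|lborel. u (\<sigma> n) y * B y) \<longlonglongrightarrow> (LINT y:{- (T + 3)..T + 3}|lborel. u0 y * B y)"
  shows "((\<lambda>T. pi / T * (\<Sum>\<^sub>\<infinity>s\<in>{s. Re s > 0 \<and> \<bar>Im s\<bar> < T \<and> F s = 0}. real_of_int (zorder F s) * Re s)
     + 1 / (2 * T) * (LINT y:{-T..T}|lborel. u0 y)) \<longlongrightarrow> - ln (cmod L)) at_top"
proof -
  define m where "m = - ln (cmod L)"
  define g where "g s = real_of_int (zorder F s) * Re s" for s
  define Z where "Z T = {s. Re s > 0 \<and> \<bar>Im s\<bar> < T \<and> F s = 0}" for T
  define J where "J T = (LINT y:{-T..T}|lborel. u0 y)" for T
  have g0: "g s \<ge> 0" if "Re s > 0" for s using zorder_nonneg[OF that] that by (simp add: g_def)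
  have small: "eventually (\<lambda>n. \<sigma> n < d) sequentially" if "d > 0" for d
    using order_tendstoD(2)[OF \<sigma>(2) that] .
  have win: "\<exists>B. window T B" if T: "T \<ge> 0" for T
  proof -
    obtain B B' B'' :: "real \<Rightarrow> real" where 
    "\<And>t. (B has_real_derivative B' t) (at t)" "\<And>t. (B' has_real_derivative B'' t) (at t)"
    "continuous_on UNIV B''" "\<And>t. 0 \<le> B t" "\<And>t. B t \<le> 1" "\<And>t. \<bar>t\<bar> \<le> T \<Longrightarrow> B t = 1" "\<And>t. \<bar>t\<bar> \<ge> T + 3 \<Longrightarrow> B t = 0"
    "B' (T + 3) = 0" "B' (- (T + 3)) = 0" "\<And>t. \<bar>B'' t\<bar> \<le> 2" "\<And>t. \<bar>t\<bar> \<le> T \<Longrightarrow> B'' t = 0"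
      by (rule smooth_window[OF T]) (rule that; assumption)
    then show ?thesis unfolding window_def by blast
  qed
  have windowD: "0 \<le> B t" "B t \<le> 1" "\<bar>t\<bar> \<le> T \<Longrightarrow> B t = 1" "\<bar>t\<bar> \<ge> T + 3 \<Longrightarrow> B t = 0" "continuous_on S B" if "window T B" for T B t S
  proof -
    from that obtain B' where d: "\<forall>t. (B has_real_derivative B' t) (at t)" unfolding window_def by blast
    show "continuous_on S B" using DERIV_continuous_on[OF has_field_derivative_at_within] d by blast
  qed (use that in \<open>auto simp: window_def\<close>)
  have iB: "set_integrable lborel {-R..R} (\<lambda>y. u0 y * B y)" if w: "window T B" for T B R
  proof -
    have "integrable lborel (\<lambda>y. (indicator {-R..R} y *\<^sub>R u0 y))" using int[of R] by (simp add: set_integrable_def)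
    moreover have "(\<lambda>y. (indicator {-R..R} y *\<^sub>R u0 y) * B y) \<in> borel_measurable lborel"
      using int[of R] borel_measurable_continuous_onI[OF windowD(5)[OF w]] by (intro borel_measurable_times) (auto simp: set_integrable_def)
    ultimately have "integrable lborel (\<lambda>y. (indicator {-R..R} y *\<^sub>R u0 y) * B y)"
    proof (rule Bochner_Integration.integrable_bound)
      show "AE y in lborel. norm ((indicator {-R..R} y *\<^sub>R u0 y) * B y) \<le> norm (indicator {-R..R} y *\<^sub>R u0 y)"
        using windowD(1,2)[OF w] u0 by (auto simp: abs_mult mult_left_le)
    qed
    then show ?thesis by (simp add: set_integrable_def mult_ac)
  qed
  have main: "\<exists>C0. \<forall>T\<ge>3. (\<lambda>s. g s) summable_on Z T \<and> \<bar>2 * pi * infsum g (Z T) + J T - 2 * T * m\<bar> \<le> e * (2 * T + 6) + C0" if e: "e > 0" for e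
  proof -
    obtain C0 where C0: "C0 \<ge> 0" and WE: "\<And>T B a. T \<ge> 0 \<Longrightarrow> window T B \<Longrightarrow> 0 < a \<Longrightarrow> a \<le> 1/2 \<Longrightarrow>
     \<bar>2 * pi * (\<Sum>w\<in>zeros a (T + 3). real_of_int (zorder F w) * (Re w - a) * B (Im w))
      + (LINT y:{- (T + 3)..T + 3}|lborel. u a y * B y) - 2 * T * m\<bar> \<le> e * (2 * T + 6) + C0"
      using window_estimate[OF e] unfolding m_def by blast
    \<comment> \<open>The upper bound is first proved for finite sets of zeros: such a set lies to
      the right of \<open>\<sigma> n\<close> for large \<open>n\<close>, and the terms left out are
      nonnegative.\<close>
    have up: "2 * pi * sum g \<Phi> + J T \<le> 2 * T * m + e * (2 * T + 6) + C0" if T: "T \<ge> 0" and \<Phi>: "finite \<Phi>" "\<Phi> \<subseteq> Z T" for T \<Phi>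
    proof -
      obtain B where B: "window T B" using win[OF T] by blast
      let ?E = "\<lambda>n. 2 * pi * (\<Sum>w\<in>\<Phi>. real_of_int (zorder F w) * (Re w - \<sigma> n) * B (Im w)) + (LINT y:{- (T + 3)..T + 3}|lborel. u (\<sigma> n) y * B y)"
      have "?E \<longlonglongrightarrow> 2 * pi * (\<Sum>w\<in>\<Phi>. real_of_int (zorder F w) * (Re w - 0) * B (Im w)) + (LINT y:{- (T + 3)..T + 3}|lborel. u0 y * B y)"
        by (intro tendsto_intros \<sigma>(2) conv T B)
      moreover have "eventually (\<lambda>n. ?E n \<le> 2 * T * m + e * (2 * T + 6) + C0) sequentially"
      proof -
        have "eventually (\<lambda>n. \<forall>w\<in>\<Phi>. \<sigma> n < Re w) sequentially"
          using \<Phi> by (intro eventually_ball_finite ballI small) (auto simp: Z_def)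
        moreover have "eventually (\<lambda>n. \<sigma> n < 1/2) sequentially" by (rule small) simp
        ultimately show ?thesis
        proof eventually_elim
          case (elim n)
          have "\<Phi> \<subseteq> zeros (\<sigma> n) (T + 3)" using elim(1) \<Phi>(2) by (auto simp: zeros_def Z_def less_imp_le)
          then have "(\<Sum>w\<in>\<Phi>. real_of_int (zorder F w) * (Re w - \<sigma> n) * B (Im w)) \<le> (\<Sum>w\<in>zeros (\<sigma> n) (T + 3). real_of_int (zorder F w) * (Re w - \<sigma> n) * B (Im w))"
          proof (rule sum_mono2[OF finite_zeros_right[OF \<sigma>(1)]])
            fix w assume "w \<in> zeros (\<sigma> n) (T + 3) - \<Phi>"
            then have "Re w \<ge> \<sigma> n" "Re w > 0" using \<sigma>(1)[of n] by (auto simp: zeros_def)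
            then show "0 \<le> real_of_int (zorder F w) * (Re w - \<sigma> n) * B (Im w)"
              using zorder_nonneg[of w] windowD(1)[OF B] by (intro mult_nonneg_nonneg) auto
          qed
          then have "2 * pi * (\<Sum>w\<in>\<Phi>. real_of_int (zorder F w) * (Re w - \<sigma> n) * B (Im w)) \<le> 2 * pi * (\<Sum>w\<in>zeros (\<sigma> n) (T + 3). real_of_int (zorder F w) * (Re w - \<sigma> n) * B (Im w))"
            by (rule mult_left_mono) simp
          moreover have "\<sigma> n \<le> 1/2" using elim(2) by simp
          note WE[OF T B \<sigma>(1)[of n] this]
          ultimately show ?case by linarith
        qed
      qed
      ultimately have le: "2 * pi * (\<Sum>w\<in>\<Phi>. real_of_int (zorder F w) * (Re w - 0) * B (Im w)) + (LINT y:{- (T + 3)..T + 3}|lborel. u0 y * B y) \<le> 2 * T * m + e * (2 * T + 6) + C0"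
        by (rule tendsto_upperbound) simp
      have "(\<Sum>w\<in>\<Phi>. real_of_int (zorder F w) * (Re w - 0) * B (Im w)) = sum g \<Phi>"
        by (rule sum.cong[OF refl]) (use \<Phi>(2) windowD(3)[OF B] in \<open>auto simp: g_def Z_def\<close>)
      moreover have "J T \<le> (LINT y:{- (T + 3)..T + 3}|lborel. u0 y * B y)"
        unfolding J_def set_lebesgue_integral_def
      proof (rule integral_mono)
        show "integrable lborel (\<lambda>y. indicator {-T..T} y *\<^sub>R u0 y)" using int by (simp add: set_integrable_def)
        show "integrable lborel (\<lambda>y. indicator {- (T + 3)..T + 3} y *\<^sub>R (u0 y * B y))" using iB[OF B, of "T + 3"] unfolding set_integrable_def .
        show "indicator {-T..T} y *\<^sub>R u0 y \<le> indicator {- (T + 3)..T + 3} y *\<^sub>R (u0 y * B y)" for y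
        proof (cases "y \<in> {-T..T}")
          case True
          then have "B y = 1" by (intro windowD(3)[OF B]) auto
          then show ?thesis using True by (simp add: indicator_def)
        next
          case False
          then have "indicator {-T..T} y *\<^sub>R u0 y = 0" by simp
          also have "0 \<le> indicator {- (T + 3)..T + 3} y *\<^sub>R (u0 y * B y)"
            unfolding real_scaleR_def by (intro mult_nonneg_nonneg u0 windowD(1)[OF B]) simp
          finally show ?thesis .
        qed
      qed
      ultimately show ?thesis using le by simp
    qed
    \<comment> \<open>This must be proved, since \<open>infsum\<close> is 0 for a family that is not
      summable; the upper bound on finite sums provides it.\<close>
    have summ: "g summable_on Z T" if T: "T \<ge> 0" for T
    proof (rule nonneg_bdd_above_summable_on)
      show "0 \<le> g s" if "s \<in> Z T" for s using g0 that by (auto simp: Z_def)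
      have J0: "0 \<le> J T" unfolding J_def set_lebesgue_integral_def by (intro integral_nonneg_AE AE_I2) (use u0 in auto)
      show "bdd_above (sum g ` {\<Phi>. \<Phi> \<subseteq> Z T \<and> finite \<Phi>})"
      proof (rule bdd_aboveI2)
        fix \<Phi> assume "\<Phi> \<in> {\<Phi>. \<Phi> \<subseteq> Z T \<and> finite \<Phi>}"
        then have "2 * pi * sum g \<Phi> \<le> 2 * T * m + e * (2 * T + 6) + C0" using up[OF T, of \<Phi>] J0 by auto
        then show "sum g \<Phi> \<le> (2 * T * m + e * (2 * T + 6) + C0) / (2 * pi)" by (simp add: pos_le_divide_eq mult.commute)
      qed
    qed
    have up': "2 * pi * infsum g (Z T) + J T \<le> 2 * T * m + e * (2 * T + 6) + C0" if T: "T \<ge> 0" for T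
    proof -
      have "infsum g (Z T) \<le> (2 * T * m + e * (2 * T + 6) + C0 - J T) / (2 * pi)"
      proof (rule infsum_le_finite_sums[OF summ[OF T]])
        fix \<Phi> assume "finite \<Phi>" "\<Phi> \<subseteq> Z T"
        from up[OF T this] show "sum g \<Phi> \<le> (2 * T * m + e * (2 * T + 6) + C0 - J T) / (2 * pi)"
          by (simp add: pos_le_divide_eq mult.commute)
      qed
      then show ?thesis by (simp add: pos_le_divide_eq mult.commute)
    qed
    \<comment> \<open>Here the window belongs to \<open>T - 3\<close>, so that
      \<open>B \<le> 1\<close> vanishes for \<open>|y| \<ge> T\<close>; moreover
      \<open>Re w - a \<le> Re w\<close>, so each term is at most \<open>g w\<close>.\<close>
    have low: "2 * (T - 3) * m - (e * (2 * T) + C0) \<le> 2 * pi * infsum g (Z T) + J T" if T: "T \<ge> 3" for T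
    proof -
      have T3: "T - 3 \<ge> 0" using T by simp
      obtain B where B: "window (T - 3) B" using win[OF T3] by blast
      have WE': "2 * (T - 3) * m - (e * (2 * T) + C0) \<le> 2 * pi * infsum g (Z T) + (LINT y:{-T..T}|lborel. u a y * B y)" if a: "0 < a" "a \<le> 1/2" for a
      proof -
        let ?t = "\<lambda>w. real_of_int (zorder F w) * (Re w - a) * B (Im w)"
        have "sum ?t (zeros a T) \<le> sum g (zeros a T \<inter> Z T)"
        proof -
          \<comment> \<open>\<open>zeros a T\<close> contains zeros at height exactly
            \<open>T\<close>, which \<open>Z T\<close> does not; \<open>B\<close> vanishes
            there.\<close>
          have "sum ?t (zeros a T) = sum ?t (zeros a T \<inter> Z T)"
          proof (rule sum.mono_neutral_right[OF finite_zeros_right[OF a(1)]])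
            show "\<forall>i\<in>zeros a T - zeros a T \<inter> Z T. ?t i = 0"
            proof
              fix i assume "i \<in> zeros a T - zeros a T \<inter> Z T"
              then have "\<not> \<bar>Im i\<bar> < T" using a(1) unfolding zeros_def Z_def by force
              then have "B (Im i) = 0" by (intro windowD(4)[OF B]) simp
              then show "?t i = 0" by simp
            qed
          qed auto
          also have "\<dots> \<le> sum g (zeros a T \<inter> Z T)"
          proof (rule sum_mono)
            fix w assume "w \<in> zeros a T \<inter> Z T"
            then have w: "a \<le> Re w" "Re w > 0" by (auto simp: zeros_def Z_def)
            have "?t w \<le> real_of_int (zorder F w) * Re w * 1"
              using w zorder_nonneg[of w] windowD(1,2)[OF B] a by (intro mult_mono) auto
            then show "?t w \<le> g w" by (simp add: g_def)
          qed
          finally show ?thesis .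
        qed
        also have "\<dots> \<le> infsum g (Z T)"
          by (rule finite_sum_le_infsum[OF summ]) (use T finite_zeros_right[OF a(1)] g0 in \<open>auto simp: Z_def\<close>)
        finally have "2 * pi * sum ?t (zeros a T) \<le> 2 * pi * infsum g (Z T)" by (rule mult_left_mono) simp
        moreover have "\<bar>2 * pi * sum ?t (zeros a T) + (LINT y:{-T..T}|lborel. u a y * B y) - 2 * (T - 3) * m\<bar> \<le> e * (2 * (T - 3) + 6) + C0"
          using WE[OF T3 B a] unfolding diff_add_cancel .
        moreover have "2 * (T - 3) + 6 = 2 * T" by simp
        ultimately show ?thesis by (simp only:)
      qed
      have ev: "eventually (\<lambda>n. 2 * (T - 3) * m - (e * (2 * T) + C0) \<le> 2 * pi * infsum g (Z T) + (LINT y:{-T..T}|lborel. u (\<sigma> n) y * B y)) sequentially"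
      proof -
        have "eventually (\<lambda>n. \<sigma> n < 1 / 2) sequentially" by (rule small) simp
        then show ?thesis
        proof eventually_elim
          case (elim n)
          show ?case by (rule WE'[OF \<sigma>(1) less_imp_le[OF elim]])
        qed
      qed
      have "(\<lambda>n. LINT y:{-T..T}|lborel. u (\<sigma> n) y * B y) \<longlonglongrightarrow> (LINT y:{-T..T}|lborel. u0 y * B y)"
        using conv[OF T3 B] by simp
      then have "(\<lambda>n. 2 * pi * infsum g (Z T) + (LINT y:{-T..T}|lborel. u (\<sigma> n) y * B y)) \<longlonglongrightarrow> 2 * pi * infsum g (Z T) + (LINT y:{-T..T}|lborel. u0 y * B y)"
        by (intro tendsto_intros)
      then have "2 * (T - 3) * m - (e * (2 * T) + C0) \<le> 2 * pi * infsum g (Z T) + (LINT y:{-T..T}|lborel. u0 y * B y)"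
        using ev by (rule tendsto_lowerbound) simp
      moreover have "(LINT y:{-T..T}|lborel. u0 y * B y) \<le> J T"
        unfolding J_def by (rule set_integral_mono[OF iB[OF B] int]) (use u0 windowD(2)[OF B] in \<open>auto simp: mult_left_le\<close>)
      ultimately show ?thesis by linarith
    qed
    show ?thesis
    proof (intro exI[of _ "C0 + 6 * \<bar>m\<bar>"] allI impI conjI)
      fix T :: real assume T: "T \<ge> 3"
      show "(\<lambda>s. g s) summable_on Z T" using summ T by simp
      have "e * (2 * T) \<le> e * (2 * T + 6)" using e by (intro mult_left_mono) auto
      moreover have "2 * (T - 3) * m = 2 * T * m - 6 * m" by (simp add: algebra_simps)
      ultimately show "\<bar>2 * pi * infsum g (Z T) + J T - 2 * T * m\<bar> \<le> e * (2 * T + 6) + (C0 + 6 * \<bar>m\<bar>)"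
        using up'[of T] low[OF T] T by linarith
    qed
  qed
  have "((\<lambda>T. pi / T * infsum g (Z T) + 1 / (2 * T) * J T) \<longlongrightarrow> m) at_top"
  proof (rule tendstoI)
    fix e :: real assume e: "e > 0"
    then obtain C0 where C0: "\<And>T. T \<ge> 3 \<Longrightarrow> \<bar>2 * pi * infsum g (Z T) + J T - 2 * T * m\<bar> \<le> e / 2 * (2 * T + 6) + C0"
      using main[of "e/2"] by auto
    have "((\<lambda>T::real. (e / 2 * (2 * T + 6) + C0) / (2 * T)) \<longlongrightarrow> e / 2) at_top" by real_asymp
    then have "eventually (\<lambda>T. (e / 2 * (2 * T + 6) + C0) / (2 * T) < e) at_top"
      by (rule order_tendstoD(2)) (use e in simp)
    then show "eventually (\<lambda>T. dist (pi / T * infsum g (Z T) + 1 / (2 * T) * J T) m < e) at_top"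
      using eventually_ge_at_top[of 3]
    proof eventually_elim
      case (elim T)
      have "pi / T * infsum g (Z T) + 1 / (2 * T) * J T - m = (2 * pi * infsum g (Z T) + J T - 2 * T * m) / (2 * T)"
        using elim(2) by (simp add: field_simps)
      then have "\<bar>pi / T * infsum g (Z T) + 1 / (2 * T) * J T - m\<bar> = \<bar>2 * pi * infsum g (Z T) + J T - 2 * T * m\<bar> / (2 * T)"
        using elim(2) by (simp add: abs_divide)
      also have "\<dots> \<le> (e / 2 * (2 * T + 6) + C0) / (2 * T)" using elim(2) C0[OF elim(2)] by (intro divide_right_mono) auto
      also have "\<dots> < e" by (rule elim(1))
      finally show ?case by (simp add: dist_real_def)
    qed
  qed
  then show ?thesis unfolding m_def g_def Z_def J_def .
qed

end

text \<open>Convergence at one point \<open>k\<close> bounds \<open>a n\<close> by a multiple of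
  \<open>n powr k\<close>. For \<open>n \<ge> 2\<close> and \<open>Re s \<ge> k + 2\<close>, split
  \<open>n powr (k - Re s)\<close> into the summable \<open>n powr (- 2)\<close> and
  \<open>n powr (k + 2 - Re s)\<close>, which is largest at \<open>n = 2\<close>.\<close>

lemma dirichlet_series_decay:
  assumes "dirichlet_series_map f a"
  shows "\<exists>C \<kappa>. \<forall>s. Re s \<ge> \<kappa> \<longrightarrow> cmod (f s - a 1) \<le> C * 2 powr (- Re s)"
proof -
  obtain \<kappa> where \<kappa>: "\<kappa> > 0" "\<And>s. Re s > \<kappa> \<Longrightarrow> (\<lambda>n. a (Suc n) * of_nat (Suc n) powr (- s)) sums f s"
    using assms unfolding dirichlet_series_map_def halfplane_def by blast
  define k where "k = \<kappa> + 1"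
  have np: "cmod (of_nat (Suc n) powr (- s)) = real (Suc n) powr (- Re s)" for n s
    using norm_powr_real_powr[of "of_nat (Suc n)" "- s"] by simp
  have "(\<lambda>n. a (Suc n) * of_nat (Suc n) powr (- of_real k)) \<longlonglongrightarrow> 0"
    using \<kappa>(2)[of "of_real k"] by (intro summable_LIMSEQ_zero) (auto simp: k_def sums_iff)
  then have "Bseq (\<lambda>n. a (Suc n) * of_nat (Suc n) powr (- of_real k))" by (intro convergent_imp_Bseq convergentI)
  then obtain K where K: "K > 0" "\<And>n. cmod (a (Suc n) * of_nat (Suc n) powr (- of_real k)) \<le> K" unfolding Bseq_def by blast
  have an: "cmod (a (Suc n)) \<le> K * real (Suc n) powr k" for n
  proof -
    have "cmod (a (Suc n)) * real (Suc n) powr (- k) \<le> K" using K(2)[of n] np[of n "of_real k"] by (simp add: norm_mult)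
    then have "cmod (a (Suc n)) * real (Suc n) powr (- k) * real (Suc n) powr k \<le> K * real (Suc n) powr k" by (rule mult_right_mono) simp
    moreover have "real (Suc n) powr (- k) * real (Suc n) powr k = 1" by (simp add: powr_add[symmetric])
    ultimately show ?thesis by (simp only: mult.assoc mult_1_right)
  qed
  define S where "S = (\<Sum>n. 1 / real (n + 2) ^ 2)"
  have sS: "summable (\<lambda>n. 1 / real (n + 2) ^ 2)"
    using summable_ignore_initial_segment[OF inverse_power_summable[of 2, where ?'a = real], of 2] by (simp add: inverse_eq_divide)
  have "cmod (f s - a 1) \<le> (K * S * 2 powr (k + 2)) * 2 powr (- Re s)" if s: "Re s \<ge> k + 2" for s
  proof -
    have "(\<lambda>n. a (Suc n) * of_nat (Suc n) powr (- s)) sums f s" using s \<kappa> by (intro \<kappa>(2)) (simp add: k_def)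
    \<comment> \<open>The summand with index \<open>n\<close> belongs to \<open>a (Suc n)\<close>,
      so removing \<open>n = 0\<close> removes exactly \<open>a 1\<close>.\<close>
    then have sm: "(\<lambda>n. a (Suc (Suc n)) * of_nat (Suc (Suc n)) powr (- s)) sums (f s - a 1)"
      using sums_Suc_iff[of "\<lambda>n. a (Suc n) * of_nat (Suc n) powr (- s)" "f s - a 1"] by simp
    have bound: "cmod (a (Suc (Suc n)) * of_nat (Suc (Suc n)) powr (- s)) \<le> K * 2 powr (k + 2 - Re s) * (1 / real (n + 2) ^ 2)" for n
    proof -
      have "cmod (a (Suc (Suc n)) * of_nat (Suc (Suc n)) powr (- s)) = cmod (a (Suc (Suc n))) * real (Suc (Suc n)) powr (- Re s)"
        using np[of "Suc n" s] by (simp add: norm_mult)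
      also have "\<dots> \<le> K * real (Suc (Suc n)) powr k * real (Suc (Suc n)) powr (- Re s)"
        by (intro mult_right_mono an) simp
      also have "\<dots> = K * (real (Suc (Suc n)) powr (k + 2 - Re s) * real (Suc (Suc n)) powr (- 2))"
        by (simp add: powr_add[symmetric] mult.assoc)
      also have "\<dots> \<le> K * (2 powr (k + 2 - Re s) * real (Suc (Suc n)) powr (- 2))"
        using K(1) s by (intro mult_left_mono mult_right_mono powr_mono2') auto
      also have "real (Suc (Suc n)) powr (- 2) = 1 / real (n + 2) ^ 2"
        by (simp add: powr_minus powr_numeral inverse_eq_divide add.commute)
      finally show ?thesis by (simp add: mult_ac)
    qed
    have "cmod (f s - a 1) = cmod (\<Sum>n. a (Suc (Suc n)) * of_nat (Suc (Suc n)) powr (- s))" using sm by (simp add: sums_iff)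
    also have "\<dots> \<le> (\<Sum>n. K * 2 powr (k + 2 - Re s) * (1 / real (n + 2) ^ 2))"
      using bound by (intro norm_suminf_le summable_mult sS)
    also have "\<dots> = K * 2 powr (k + 2 - Re s) * S" unfolding S_def by (rule suminf_mult[OF sS])
    also have "2 powr (k + 2 - Re s) = 2 powr (k + 2) * 2 powr (- Re s)" by (simp add: powr_add[symmetric])
    finally show ?thesis by (simp add: mult_ac)
  qed
  then show ?thesis by blast
qed

section \<open>Existence and measurability of boundary values\<close>

lemma boundary_value_eq:
  "((\<lambda>\<sigma>. g (Complex \<sigma> \<tau>)) \<longlongrightarrow> l) (at_right 0) \<Longrightarrow> boundary_value g \<tau> = l"
  unfolding boundary_value_def by (rule tendsto_Lim) simp

text \<open>Cauchy's criterion for the radial limit, arranged so that for continuous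
  \<open>g\<close> the uncountable intersections are of closed sets and only countable operations
  remain outside them.\<close>

definition cauchy_boundary :: "(complex \<Rightarrow> complex) \<Rightarrow> real set" where
  "cauchy_boundary g = (\<Inter>n. \<Union>m. \<Inter>\<sigma>\<in>{0<..<1 / real (Suc m)}. \<Inter>\<sigma>'\<in>{0<..<1 / real (Suc m)}.
     {\<tau>. dist (g (Complex \<sigma> \<tau>)) (g (Complex \<sigma>' \<tau>)) \<le> 1 / real (Suc n)})"

lemma cauchy_boundary_iff:
  "\<tau> \<in> cauchy_boundary g \<longleftrightarrow> (\<exists>l. ((\<lambda>\<sigma>. g (Complex \<sigma> \<tau>)) \<longlongrightarrow> l) (at_right 0))"
proof
  assume "\<exists>l. ((\<lambda>\<sigma>. g (Complex \<sigma> \<tau>)) \<longlongrightarrow> l) (at_right 0)"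
  then obtain l where l: "((\<lambda>\<sigma>. g (Complex \<sigma> \<tau>)) \<longlongrightarrow> l) (at_right 0)" by blast
  have "\<exists>m. \<forall>\<sigma>\<in>{0<..<1 / real (Suc m)}. \<forall>\<sigma>'\<in>{0<..<1 / real (Suc m)}. dist (g (Complex \<sigma> \<tau>)) (g (Complex \<sigma>' \<tau>)) \<le> 1 / real (Suc n)" for n
  proof -
    have "eventually (\<lambda>\<sigma>. dist (g (Complex \<sigma> \<tau>)) l < 1 / real (Suc n) / 2) (at_right 0)"
      by (rule tendstoD[OF l]) simp
    then obtain d where d: "d > 0" "\<And>\<sigma>. 0 < \<sigma> \<Longrightarrow> \<sigma> < d \<Longrightarrow> dist (g (Complex \<sigma> \<tau>)) l < 1 / real (Suc n) / 2"
      unfolding eventually_at_right_field by auto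
    obtain m where m: "1 / real (Suc m) < d" using nat_approx_posE[OF d(1)] by blast
    show ?thesis
    proof (intro exI ballI)
      fix \<sigma> \<sigma>' assume "\<sigma> \<in> {0<..<1 / real (Suc m)}" "\<sigma>' \<in> {0<..<1 / real (Suc m)}"
      then have s: "0 < \<sigma>" "\<sigma> < d" "0 < \<sigma>'" "\<sigma>' < d" using m by (simp_all del: of_nat_Suc)
      from d(2)[OF s(1,2)] d(2)[OF s(3,4)] have "dist (g (Complex \<sigma> \<tau>)) (g (Complex \<sigma>' \<tau>)) < 1 / real (Suc n)" by (rule dist_triangle_half_l)
      then show "dist (g (Complex \<sigma> \<tau>)) (g (Complex \<sigma>' \<tau>)) \<le> 1 / real (Suc n)" by simp
    qed
  qed
  then show "\<tau> \<in> cauchy_boundary g" unfolding cauchy_boundary_def INT_iff UN_iff mem_Collect_eq ball_UNIV bex_UNIV by (rule allI)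
next
  assume "\<tau> \<in> cauchy_boundary g"
  then have c: "\<exists>m. \<forall>\<sigma>\<in>{0<..<1 / real (Suc m)}. \<forall>\<sigma>'\<in>{0<..<1 / real (Suc m)}. dist (g (Complex \<sigma> \<tau>)) (g (Complex \<sigma>' \<tau>)) \<le> 1 / real (Suc n)" for n
    unfolding cauchy_boundary_def INT_iff UN_iff mem_Collect_eq ball_UNIV bex_UNIV by (rule spec)
  have "cauchy_filter (filtermap (\<lambda>\<sigma>. g (Complex \<sigma> \<tau>)) (at_right 0))"
    unfolding cauchy_filter_metric_filtermap
  proof (intro allI impI)
    fix e :: real assume "e > 0"
    then obtain n where n: "1 / real (Suc n) < e" using nat_approx_posE by blast
    obtain m where m: "\<And>\<sigma> \<sigma>'. \<sigma> \<in> {0<..<1 / real (Suc m)} \<Longrightarrow> \<sigma>' \<in> {0<..<1 / real (Suc m)} \<Longrightarrow> dist (g (Complex \<sigma> \<tau>)) (g (Complex \<sigma>' \<tau>)) \<le> 1 / real (Suc n)"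
      using c[of n] by blast
    have "eventually (\<lambda>\<sigma>. \<sigma> \<in> {0<..<1 / real (Suc m)}) (at_right 0)" by (intro eventually_at_right_real) simp
    then show "\<exists>P. eventually P (at_right 0) \<and> (\<forall>x y. P x \<and> P y \<longrightarrow> dist (g (Complex x \<tau>)) (g (Complex y \<tau>)) < e)"
      using m n by (intro exI[of _ "\<lambda>\<sigma>. \<sigma> \<in> {0<..<1 / real (Suc m)}"]) (auto intro: le_less_trans)
  qed
  then obtain l where "filtermap (\<lambda>\<sigma>. g (Complex \<sigma> \<tau>)) (at_right 0) \<le> nhds l"
    using complete_uniform[of "UNIV :: complex set"] complete_UNIV
    by (metis (no_types, lifting) filtermap_bot_iff principal_UNIV top_greatest trivial_limit_at_right_real)
  then show "\<exists>l. ((\<lambda>\<sigma>. g (Complex \<sigma> \<tau>)) \<longlongrightarrow> l) (at_right 0)" by (auto simp: filterlim_def)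
qed

text \<open>Where the radial limit exists it is the limit of a sequence of continuous functions.
  Elsewhere the description behind \<open>Lim\<close> has no witness, and all these points receive
  the one value \<open>THE l. False\<close>.\<close>

lemma boundary_value_measurable:
  assumes g: "continuous_on {s. Re s > 0} g"
  shows "cauchy_boundary g \<in> sets borel" "boundary_value g \<in> borel_measurable borel"
proof -
  have gc: "continuous_on UNIV (\<lambda>\<tau>. g (Complex \<sigma> \<tau>))" if "\<sigma> > 0" for \<sigma>
    by (rule continuous_on_compose2[OF g]) (use that in \<open>auto simp: Complex_eq intro!: continuous_intros\<close>)
  show S [measurable]: "cauchy_boundary g \<in> sets borel"
  proof -
    define A where "A n m = (\<Inter>\<sigma>\<in>{0<..<1 / real (Suc m)}. \<Inter>\<sigma>'\<in>{0<..<1 / real (Suc m)}.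
     {\<tau>. dist (g (Complex \<sigma> \<tau>)) (g (Complex \<sigma>' \<tau>)) \<le> 1 / real (Suc n)})" for n m
    have "closed (A n m)" for n m
      unfolding A_def by (intro closed_INT ballI closed_Collect_le continuous_intros gc) auto
    then have [measurable]: "A n m \<in> sets borel" for n m by (rule borel_closed)
    have "(\<Inter>n. \<Union>m. A n m) \<in> sets borel" by measurable
    then show ?thesis unfolding cauchy_boundary_def A_def .
  qed
  have [measurable]: "(\<lambda>\<tau>. g (Complex (1 / real (Suc k)) \<tau>)) \<in> borel_measurable borel" for k
    by (intro borel_measurable_continuous_onI gc) simp
  have "boundary_value g = (\<lambda>\<tau>. if \<tau> \<in> cauchy_boundary g then lim (\<lambda>k. g (Complex (1 / real (Suc k)) \<tau>)) else (THE l. False))"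
  proof
    fix \<tau>
    show "boundary_value g \<tau> = (if \<tau> \<in> cauchy_boundary g then lim (\<lambda>k. g (Complex (1 / real (Suc k)) \<tau>)) else (THE l. False))"
    proof (cases "\<tau> \<in> cauchy_boundary g")
      case True
      then obtain l where l: "((\<lambda>\<sigma>. g (Complex \<sigma> \<tau>)) \<longlongrightarrow> l) (at_right 0)" by (auto simp: cauchy_boundary_iff)
      have "filterlim (\<lambda>k. 1 / real (Suc k)) (at_right 0) sequentially"
        unfolding filterlim_at divide_inverse mult_1_left
        by (intro conjI LIMSEQ_inverse_real_of_nat always_eventually allI) auto
      then have "(\<lambda>k. g (Complex (1 / real (Suc k)) \<tau>)) \<longlonglongrightarrow> l" by (rule filterlim_compose[OF l])
      then show ?thesis using True boundary_value_eq[OF l] by (simp add: limI)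
    next
      case False
      then have "((\<lambda>\<sigma>. g (Complex \<sigma> \<tau>)) \<longlongrightarrow> l) (at_right 0) = False" for l by (auto simp: cauchy_boundary_iff)
      then have "boundary_value g \<tau> = (THE l. False)" unfolding boundary_value_def Topological_Spaces.Lim_def by simp
      then show ?thesis using False by simp
    qed
  qed
  then show "boundary_value g \<in> borel_measurable borel" by simp
qed

section \<open>Boundary behaviour off the exceptional set\<close>

text \<open>\<open>arctan\<close> is an antiderivative of the density, so the mass is finite. The
  null sets are those of Lebesgue measure, and on \<open>[- R, R]\<close> Lebesgue measure is at
  most \<open>1 + R^2\<close> times this one.\<close>

definition arctan_measure :: "real measure" where
  "arctan_measure = density lborel (\<lambda>\<tau>. ennreal (1 / (1 + \<tau>\<^sup>2)))"

lemma sets_arctan_measure [simp, measurable_cong]: "sets arctan_measure = sets borel"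
  by (simp add: arctan_measure_def)

lemma nn_integral_arctan_measure:
  "g \<in> borel_measurable borel \<Longrightarrow> (\<integral>\<^sup>+ \<tau>. g \<tau> \<partial>arctan_measure) = (\<integral>\<^sup>+ \<tau>. ennreal (1 / (1 + \<tau>\<^sup>2)) * g \<tau> \<partial>lborel)"
  unfolding arctan_measure_def by (subst nn_integral_density) auto

lemma AE_arctan_measure: "(AE \<tau> in arctan_measure. P \<tau>) \<longleftrightarrow> (AE \<tau> in lborel. P \<tau>)"
proof -
  have "0 < 1 + \<tau>\<^sup>2" for \<tau> :: real by (simp add: add_pos_nonneg)
  then show ?thesis unfolding arctan_measure_def by (subst AE_density) auto
qed

lemma finite_arctan_measure: "finite_measure arctan_measure"
proof
  have "set_integrable lborel (einterval (-\<infinity>) \<infinity>) (\<lambda>\<tau>. 1 / (1 + \<tau>\<^sup>2)) \<and>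
     (LBINT \<tau>=-\<infinity>..\<infinity>. 1 / (1 + \<tau>\<^sup>2)) = pi / 2 - (- (pi / 2))"
  proof (intro conjI interval_integral_FTC_nonneg[where F = arctan])
    have p: "1 + \<tau>\<^sup>2 \<noteq> 0" for \<tau> :: real by (simp add: add_nonneg_eq_0_iff)
    show "isCont (\<lambda>\<tau>. 1 / (1 + \<tau>\<^sup>2)) x" "isCont (\<lambda>\<tau>. 1 / (1 + \<tau>\<^sup>2)) x" for x :: real
      using p by (auto intro!: continuous_intros)
  qed (use tendsto_arctan_at_top tendsto_arctan_at_bot DERIV_arctan in \<open>auto simp: ereal_tendsto_simps inverse_eq_divide add_nonneg_eq_0_iff intro!: continuous_intros\<close>)
  then have "integrable lborel (\<lambda>\<tau>::real. 1 / (1 + \<tau>\<^sup>2))"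
    by (simp add: set_integrable_def einterval_def)
  then have "(\<integral>\<^sup>+ \<tau>. ennreal (norm (1 / (1 + (\<tau>::real)\<^sup>2))) \<partial>lborel) < \<infinity>"
    unfolding integrable_iff_bounded by blast
  moreover have "emeasure arctan_measure (space arctan_measure) = (\<integral>\<^sup>+ \<tau>. ennreal (norm (1 / (1 + (\<tau>::real)\<^sup>2))) \<partial>lborel)"
    unfolding arctan_measure_def by (simp add: emeasure_density)
  ultimately show "emeasure arctan_measure (space arctan_measure) \<noteq> \<infinity>" by simp
qed

lemma norm_frostman_le_one:
  fixes \<xi> w :: complex
  assumes "cmod \<xi> < 1" "cmod w \<le> 1"
  shows "cmod ((\<xi> - w) / (1 - cnj \<xi> * w)) \<le> 1"
proof -
  have "(cmod (1 - cnj \<xi> * w))\<^sup>2 - (cmod (\<xi> - w))\<^sup>2 = (1 - (cmod \<xi>)\<^sup>2) * (1 - (cmod w)\<^sup>2)"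
    unfolding cmod_power2 by (simp add: power2_eq_square algebra_simps)
  moreover have "(cmod \<xi>)\<^sup>2 \<le> 1" "(cmod w)\<^sup>2 \<le> 1" using assms by (auto simp: power_le_one)
  ultimately have "(cmod (\<xi> - w))\<^sup>2 \<le> (cmod (1 - cnj \<xi> * w))\<^sup>2"
    by (metis diff_ge_0_iff_ge mult_nonneg_nonneg)
  then have "cmod (\<xi> - w) \<le> cmod (1 - cnj \<xi> * w)" by (rule power2_le_imp_le) simp
  then show ?thesis using frostman_denominator_nonzero[OF assms] by (simp add: norm_divide divide_le_eq_1)
qed

context halfplane_selfmap
begin

lemma u_measurable: "x > 0 \<Longrightarrow> u x \<in> borel_measurable borel"
  and F_line_measurable: "x > 0 \<Longrightarrow> (\<lambda>\<tau>. F (Complex x \<tau>)) \<in> borel_measurable borel"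
proof -
  assume x: "x > 0"
  have "continuous_on UNIV (\<lambda>\<tau>. F (Complex x \<tau>))"
    by (rule continuous_on_compose2[OF holomorphic_on_imp_continuous_on[OF hol]]) (use x in \<open>auto simp: Complex_eq intro!: continuous_intros\<close>)
  then show m [measurable]: "(\<lambda>\<tau>. F (Complex x \<tau>)) \<in> borel_measurable borel" by (rule borel_measurable_continuous_onI)
  show "u x \<in> borel_measurable borel" unfolding u_def[abs_def] by measurable
qed

text \<open>Finitely many zeros lie on each bounded piece of the line, hence countably many on all
  of it. Off them the finite-valued \<open>u\<close> and the function \<open>nlog\<close> of the
  modulus agree.\<close>

lemma AE_line_nonzero:
  assumes x: "x > 0" shows "AE \<tau> in lborel. F (Complex x \<tau>) \<noteq> 0"
proof -
  have "{\<tau>. F (Complex x \<tau>) = 0} = (\<Union>n::nat. Im ` {w \<in> zeros x (real n). Re w = x})"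
  proof (intro equalityI subsetI)
    fix \<tau> assume t: "\<tau> \<in> {\<tau>. F (Complex x \<tau>) = 0}"
    obtain n where "\<bar>\<tau>\<bar> \<le> real n" using real_arch_simple by blast
    then have "Complex x \<tau> \<in> {w \<in> zeros x (real n). Re w = x}" using t by (simp add: zeros_def)
    then show "\<tau> \<in> (\<Union>n::nat. Im ` {w \<in> zeros x (real n). Re w = x})" by force
  next
    fix \<tau> assume "\<tau> \<in> (\<Union>n::nat. Im ` {w \<in> zeros x (real n). Re w = x})"
    then obtain w where "Re w = x" "Im w = \<tau>" "F w = 0" by (auto simp: zeros_def)
    then show "\<tau> \<in> {\<tau>. F (Complex x \<tau>) = 0}" by (auto simp: complex_eq_iff[symmetric] complex_surj)
  qed
  moreover have "countable (\<Union>n::nat. Im ` {w \<in> zeros x (real n). Re w = x})"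
  proof -
    have "finite {w \<in> zeros x (real n). Re w = x}" for n
      by (rule finite_subset[OF _ finite_zeros_right[OF x, of "real n"]]) auto
    then have "countable (Im ` {w \<in> zeros x (real n). Re w = x})" for n by (intro countable_finite finite_imageI)
    then show ?thesis by (intro countable_UN) simp_all
  qed
  ultimately have "{\<tau>. F (Complex x \<tau>) = 0} \<in> null_sets lborel" by (simp add: countable_imp_null_set_lborel)
  from AE_not_in[OF this] show ?thesis by simp
qed

text \<open>Scheffe's lemma needs the limit superior of the masses to be at most the mass of the
  limit. Only the limit inferior is controlled, so a subsequence attaining it is taken. Convergence
  in mean for the finite weight then gives convergence against every window, along one subsequence
  for all \<open>T\<close>.\<close>

lemma boundary_convergence:
  fixes F0 :: "real \<Rightarrow> complex" and \<sigma> :: "nat \<Rightarrow> real"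
  defines "u0 \<equiv> \<lambda>\<tau>. - ln (cmod (F0 \<tau>))"
  assumes \<sigma>: "\<And>n. \<sigma> n > 0" and F0 [measurable]: "F0 \<in> borel_measurable borel" and F01: "\<And>\<tau>. cmod (F0 \<tau>) \<le> 1"
    and lim: "AE \<tau> in lborel. (\<lambda>n. F (Complex (\<sigma> n) \<tau>)) \<longlonglongrightarrow> F0 \<tau>"
    and le: "liminf (\<lambda>n. \<integral>\<^sup>+ \<tau>. nlog (cmod (F (Complex (\<sigma> n) \<tau>))) \<partial>arctan_measure) \<le> (\<integral>\<^sup>+ \<tau>. nlog (cmod (F0 \<tau>)) \<partial>arctan_measure)"
    and fin: "(\<integral>\<^sup>+ \<tau>. nlog (cmod (F0 \<tau>)) \<partial>arctan_measure) < \<infinity>"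
  shows "\<exists>r. strict_mono r \<and> (\<forall>R. set_integrable lborel {-R..R} u0) \<and>
     (\<forall>T B. T \<ge> 0 \<longrightarrow> window T B \<longrightarrow>
      (\<lambda>n. LINT y:{- (T + 3)..T + 3}|lborel. u (\<sigma> (r n)) y * B y) \<longlonglongrightarrow> (LINT y:{- (T + 3)..T + 3}|lborel. u0 y * B y))"
proof -
  let ?W = arctan_measure
  define h where "h n = (\<integral>\<^sup>+ \<tau>. nlog (cmod (F (Complex (\<sigma> n) \<tau>))) \<partial>?W)" for n
  define I where "I = (\<integral>\<^sup>+ \<tau>. nlog (cmod (F0 \<tau>)) \<partial>?W)"
  obtain r0 where r0: "strict_mono r0" "(h \<circ> r0) \<longlonglongrightarrow> liminf h" using liminf_subseq_lim by blast
  have lI: "liminf h \<le> I" "I < \<infinity>" using le fin unfolding h_def[abs_def] I_def by auto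
  have "eventually (\<lambda>k. (h \<circ> r0) k < \<infinity>) sequentially"
    by (rule order_tendstoD(2)[OF r0(2)]) (use lI in auto)
  then obtain k0 where k0: "\<And>k. k \<ge> k0 \<Longrightarrow> h (r0 k) < \<infinity>" by (auto simp: eventually_sequentially)
  \<comment> \<open>Dropping \<open>k0\<close> terms makes every integral finite, so that all
    \<open>U k\<close> are integrable.\<close>
  define r where "r k = r0 (k + k0)" for k
  have r: "strict_mono r" using r0(1) by (auto simp: r_def strict_mono_def)
  have hr: "(\<lambda>k. h (r k)) \<longlonglongrightarrow> liminf h"
    using LIMSEQ_ignore_initial_segment[OF r0(2), of k0] by (simp add: r_def)
  have hfin: "h (r k) < \<infinity>" for k using k0 by (simp add: r_def)
  define U where "U k \<tau> = u (\<sigma> (r k)) \<tau>" for k \<tau>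
  have Um [measurable]: "U k \<in> borel_measurable borel" for k unfolding U_def[abs_def] using u_measurable[OF \<sigma>] by simp
  have u0m [measurable]: "u0 \<in> borel_measurable borel" unfolding u0_def by measurable
  have U0: "U k \<tau> \<ge> 0" for k \<tau> unfolding U_def by (rule u_nonneg[OF \<sigma>])
  have u00: "u0 \<tau> \<ge> 0" for \<tau> unfolding u0_def using F01[of \<tau>] by (cases "F0 \<tau> = 0") auto
  have normU: "(\<integral>\<^sup>+ \<tau>. norm (U k \<tau>) \<partial>?W) = h (r k)" for k
    unfolding h_def
  proof (rule nn_integral_cong_AE)
    show "AE \<tau> in ?W. ennreal (norm (U k \<tau>)) = nlog (cmod (F (Complex (\<sigma> (r k)) \<tau>)))"
      unfolding AE_arctan_measure using AE_line_nonzero[OF \<sigma>[of "r k"]]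
    proof eventually_elim
      case (elim \<tau>)
      have "norm (U k \<tau>) = U k \<tau>" using U0 by simp
      then show ?case using elim by (simp add: U_def u_def nlog_def)
    qed
  qed
  have F0nz: "AE \<tau> in ?W. F0 \<tau> \<noteq> 0"
  proof -
    have "AE \<tau> in ?W. nlog (cmod (F0 \<tau>)) \<noteq> \<infinity>" using lI(2) unfolding I_def by (intro nn_integral_PInf_AE) auto
    then show ?thesis by eventually_elim (auto simp: nlog_def)
  qed
  have normu0: "(\<integral>\<^sup>+ \<tau>. norm (u0 \<tau>) \<partial>?W) = I"
    unfolding I_def
  proof (rule nn_integral_cong_AE)
    show "AE \<tau> in ?W. ennreal (norm (u0 \<tau>)) = nlog (cmod (F0 \<tau>))"
      using F0nz
    proof eventually_elim
      case (elim \<tau>)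
      have "norm (u0 \<tau>) = u0 \<tau>" using u00 by simp
      then show ?case using elim by (simp add: u0_def nlog_def)
    qed
  qed
  have iU: "integrable ?W (U k)" for k using normU[of k] hfin[of k] by (intro integrableI_bounded) auto
  have iu0: "integrable ?W u0" using normu0 lI(2) by (intro integrableI_bounded) auto
  have sch: "(\<lambda>k. \<integral>\<^sup>+ \<tau>. norm (U k \<tau> - u0 \<tau>) \<partial>?W) \<longlonglongrightarrow> 0"
  proof (rule Scheffe_lemma1[OF iU iu0])
    show "AE \<tau> in ?W. (\<lambda>k. U k \<tau>) \<longlonglongrightarrow> u0 \<tau>"
      using F0nz lim[folded AE_arctan_measure]
    proof eventually_elim
      case (elim \<tau>)
      have "(\<lambda>k. F (Complex (\<sigma> (r k)) \<tau>)) \<longlonglongrightarrow> F0 \<tau>"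
        using LIMSEQ_subseq_LIMSEQ[OF elim(2) r] by (simp add: o_def)
      then show ?case unfolding U_def u_def u0_def using elim(1) by (intro tendsto_intros) auto
    qed
    have "limsup (\<lambda>k. h (r k)) = liminf h" by (rule lim_imp_Limsup[OF _ hr]) simp
    then show "limsup (\<lambda>k. \<integral>\<^sup>+ \<tau>. norm (U k \<tau>) \<partial>?W) \<le> (\<integral>\<^sup>+ \<tau>. norm (u0 \<tau>) \<partial>?W)"
      unfolding normU normu0 using lI(1) by simp
  qed
  \<comment> \<open>On \<open>[- R, R]\<close> the density of the weight is at least
    \<open>1 / (1 + R^2)\<close>.\<close>
  have loc: "(\<integral>\<^sup>+ \<tau>. ennreal (norm (indicator {-R..R} \<tau> * g \<tau>)) \<partial>lborel) \<le> ennreal (1 + R\<^sup>2) * (\<integral>\<^sup>+ \<tau>. ennreal (norm (g \<tau>)) \<partial>?W)"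
    if g [measurable]: "g \<in> borel_measurable borel" for R and g :: "real \<Rightarrow> real"
  proof -
    have "(\<integral>\<^sup>+ \<tau>. ennreal (norm (indicator {-R..R} \<tau> * g \<tau>)) \<partial>lborel) \<le> (\<integral>\<^sup>+ \<tau>. ennreal (1 + R\<^sup>2) * (ennreal (1 / (1 + \<tau>\<^sup>2)) * ennreal (norm (g \<tau>))) \<partial>lborel)"
    proof (rule nn_integral_mono)
      fix \<tau> :: real
      have p: "0 < 1 + \<tau>\<^sup>2" "0 < 1 + R\<^sup>2" by (simp_all add: add_pos_nonneg)
      have "norm (indicator {-R..R} \<tau> * g \<tau>) \<le> (1 + R\<^sup>2) * (1 / (1 + \<tau>\<^sup>2) * norm (g \<tau>))"
      proof (cases "\<tau> \<in> {-R..R}")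
        case True
        then have "\<bar>\<tau>\<bar> \<le> \<bar>R\<bar>" by auto
        then have "\<tau>\<^sup>2 \<le> R\<^sup>2" by (simp add: abs_le_square_iff)
        then have "1 \<le> (1 + R\<^sup>2) * (1 / (1 + \<tau>\<^sup>2))" using p by simp
        then have "1 * norm (g \<tau>) \<le> (1 + R\<^sup>2) * (1 / (1 + \<tau>\<^sup>2)) * norm (g \<tau>)" by (rule mult_right_mono) simp
        then show ?thesis using True by (simp only: indicator_simps mult_1_left mult.assoc)
      next
        case False
        have "0 \<le> (1 + R\<^sup>2) * (1 / (1 + \<tau>\<^sup>2) * norm (g \<tau>))" using p by (intro mult_nonneg_nonneg) auto
        then show ?thesis using False by simp
      qed
      then have "ennreal (norm (indicator {-R..R} \<tau> * g \<tau>)) \<le> ennreal ((1 + R\<^sup>2) * (1 / (1 + \<tau>\<^sup>2) * norm (g \<tau>)))" by (rule ennreal_leI)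
      also have "\<dots> = ennreal (1 + R\<^sup>2) * (ennreal (1 / (1 + \<tau>\<^sup>2)) * ennreal (norm (g \<tau>)))"
      proof -
        have q: "0 \<le> 1 / (1 + \<tau>\<^sup>2)" "0 \<le> 1 + R\<^sup>2" using p by simp_all
        show ?thesis
          by (simp only: ennreal_mult[OF q(2) mult_nonneg_nonneg[OF q(1) norm_ge_zero]] ennreal_mult[OF q(1) norm_ge_zero])
      qed
      finally show "ennreal (norm (indicator {-R..R} \<tau> * g \<tau>)) \<le> ennreal (1 + R\<^sup>2) * (ennreal (1 / (1 + \<tau>\<^sup>2)) * ennreal (norm (g \<tau>)))" .
    qed
    also have "\<dots> = ennreal (1 + R\<^sup>2) * (\<integral>\<^sup>+ \<tau>. ennreal (norm (g \<tau>)) \<partial>?W)"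
      by (subst nn_integral_cmult) (auto simp: nn_integral_arctan_measure)
    finally show ?thesis .
  qed
  have iloc: "integrable lborel (\<lambda>\<tau>. indicator {-R..R} \<tau> * g \<tau>)" if "integrable ?W g" for R and g :: "real \<Rightarrow> real"
  proof (rule integrableI_bounded)
    have [measurable]: "g \<in> borel_measurable borel" using borel_measurable_integrable[OF that] by simp
    show "(\<lambda>\<tau>. indicator {-R..R} \<tau> * g \<tau>) \<in> borel_measurable lborel" by measurable
    have "(\<integral>\<^sup>+ \<tau>. ennreal (norm (g \<tau>)) \<partial>?W) < \<infinity>" using that by (simp add: integrable_iff_bounded)
    then have "ennreal (1 + R\<^sup>2) * (\<integral>\<^sup>+ \<tau>. ennreal (norm (g \<tau>)) \<partial>?W) < \<infinity>" by (simp add: ennreal_mult_less_top)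
    with loc[of g R] show "(\<integral>\<^sup>+ \<tau>. ennreal (norm (indicator {-R..R} \<tau> * g \<tau>)) \<partial>lborel) < \<infinity>"
      by (intro le_less_trans[OF loc]) auto
  qed
  have "(\<lambda>n. LINT y:{- (T + 3)..T + 3}|lborel. u (\<sigma> (r n)) y * B y) \<longlonglongrightarrow> (LINT y:{- (T + 3)..T + 3}|lborel. u0 y * B y)"
    if T: "T \<ge> 0" and B: "window T B" for T B
  proof -
    have B01: "\<And>t. 0 \<le> B t \<and> B t \<le> 1" and "\<exists>B'. \<forall>t. (B has_real_derivative B' t) (at t)" using B unfolding window_def by blast+
    then have "continuous_on UNIV B" using DERIV_continuous_on[OF has_field_derivative_at_within] by blast
    then have Bm [measurable]: "B \<in> borel_measurable borel" by (rule borel_measurable_continuous_onI)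
    let ?R = "T + 3"
    have iB: "integrable lborel (\<lambda>y. indicator {-?R..?R} y *\<^sub>R (g y * B y))" if g: "integrable ?W g" for g
    proof (rule Bochner_Integration.integrable_bound[OF iloc[OF g, of ?R]])
      have [measurable]: "g \<in> borel_measurable borel" using borel_measurable_integrable[OF g] by simp
      show "(\<lambda>y. indicator {-?R..?R} y *\<^sub>R (g y * B y)) \<in> borel_measurable lborel" by measurable
      show "AE y in lborel. norm (indicator {-?R..?R} y *\<^sub>R (g y * B y)) \<le> norm (indicator {-?R..?R} y * g y)"
        using B01 by (auto simp: abs_mult indicator_def mult_left_le)
    qed
    have "((\<lambda>n. \<integral>y. indicator {-?R..?R} y *\<^sub>R (U n y * B y) \<partial>lborel) \<longlongrightarrow> (\<integral>y. indicator {-?R..?R} y *\<^sub>R (u0 y * B y) \<partial>lborel)) sequentially"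
    proof (rule tendsto_L1_int[OF iB[OF iU] iB[OF iu0]])
      have le: "(\<integral>\<^sup>+ y. norm (indicator {-?R..?R} y *\<^sub>R (U n y * B y) - indicator {-?R..?R} y *\<^sub>R (u0 y * B y)) \<partial>lborel)
         \<le> ennreal (1 + ?R\<^sup>2) * (\<integral>\<^sup>+ \<tau>. norm (U n \<tau> - u0 \<tau>) \<partial>?W)" for n
      proof -
        have "(\<integral>\<^sup>+ y. norm (indicator {-?R..?R} y *\<^sub>R (U n y * B y) - indicator {-?R..?R} y *\<^sub>R (u0 y * B y)) \<partial>lborel)
          \<le> (\<integral>\<^sup>+ y. norm (indicator {-?R..?R} y * (U n y - u0 y)) \<partial>lborel)"
        proof (rule nn_integral_mono, rule ennreal_leI)
          fix y
          have "\<bar>U n y * B y - u0 y * B y\<bar> = \<bar>U n y - u0 y\<bar> * B y" using B01[of y] by (simp add: left_diff_distrib[symmetric] abs_mult)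
          also have "\<dots> \<le> \<bar>U n y - u0 y\<bar>" using B01[of y] by (simp add: mult_left_le)
          finally show "norm (indicator {-?R..?R} y *\<^sub>R (U n y * B y) - indicator {-?R..?R} y *\<^sub>R (u0 y * B y)) \<le> norm (indicator {-?R..?R} y * (U n y - u0 y))"
            by (simp add: indicator_def)
        qed
        also have "\<dots> \<le> ennreal (1 + ?R\<^sup>2) * (\<integral>\<^sup>+ \<tau>. norm (U n \<tau> - u0 \<tau>) \<partial>?W)" by (rule loc) measurable
        finally show ?thesis .
      qed
      have "(\<lambda>n. ennreal (1 + ?R\<^sup>2) * (\<integral>\<^sup>+ \<tau>. norm (U n \<tau> - u0 \<tau>) \<partial>?W)) \<longlonglongrightarrow> ennreal (1 + ?R\<^sup>2) * 0"
        by (intro ennreal_tendsto_cmult sch) simp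
      then have up: "(\<lambda>n. ennreal (1 + ?R\<^sup>2) * (\<integral>\<^sup>+ \<tau>. norm (U n \<tau> - u0 \<tau>) \<partial>?W)) \<longlonglongrightarrow> 0"
        by (simp only: mult_zero_right)
      show "((\<lambda>n. \<integral>\<^sup>+ y. norm (indicator {-?R..?R} y *\<^sub>R (U n y * B y) - indicator {-?R..?R} y *\<^sub>R (u0 y * B y)) \<partial>lborel) \<longlongrightarrow> 0) sequentially"
      proof (rule tendsto_sandwich[OF _ _ tendsto_const up])
        show "\<forall>\<^sub>F n in sequentially. 0 \<le> (\<integral>\<^sup>+ y. norm (indicator {-?R..?R} y *\<^sub>R (U n y * B y) - indicator {-?R..?R} y *\<^sub>R (u0 y * B y)) \<partial>lborel)"
          by (intro always_eventually allI zero_le)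
        show "\<forall>\<^sub>F n in sequentially. (\<integral>\<^sup>+ y. norm (indicator {-?R..?R} y *\<^sub>R (U n y * B y) - indicator {-?R..?R} y *\<^sub>R (u0 y * B y)) \<partial>lborel)
            \<le> ennreal (1 + ?R\<^sup>2) * (\<integral>\<^sup>+ \<tau>. norm (U n \<tau> - u0 \<tau>) \<partial>?W)"
          by (intro always_eventually allI le)
      qed
    qed
    then show ?thesis unfolding set_lebesgue_integral_def U_def .
  qed
  moreover have "set_integrable lborel {-R..R} u0" for R
    using iloc[OF iu0, of R] by (simp add: set_integrable_def)
  ultimately show ?thesis using r by blast
qed

end

text \<open>The exceptional set is built from the values of \<open>f\<close> on the lines
  \<open>Re s = \<sigma> n\<close> and from its boundary values, before \<open>T\<close> enters. For
  \<open>\<xi>\<close> outside it, the solutions of \<open>f s = \<xi>\<close> are the zeros of the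
  Frostman shift with the same orders, and \<open>counting_limit\<close> with \<open>L\<close> the
  shifted \<open>a 1\<close> is the claim.\<close>

theorem theorem1p5:
  fixes f :: "complex \<Rightarrow> complex" and a :: "nat \<Rightarrow> complex"
  assumes "dirichlet_series_map f a"
  shows "\<exists>E. polar E \<and>
    (\<forall>\<xi> \<in> ball 0 1 - {a 1} - E.
      ((\<lambda>T. \<bar>N_count f \<xi> T
             - 1 / (2 * T) * (LINT \<tau>:{-T..T}|lborel. ln (cmod (boundary_value (frostman f \<xi>) \<tau>)))
             - ln (cmod ((1 - cnj \<xi> * a 1) / (\<xi> - a 1)))\<bar>) \<longlongrightarrow> 0) at_top)"
proof -
  let ?H = "{s::complex. Re s > 0}"
  have H: "halfplane 0 = ?H" by (simp add: halfplane_def)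
  have fh: "f holomorphic_on ?H" and f1: "\<And>s. Re s > 0 \<Longrightarrow> cmod (f s) < 1"
    using assms unfolding dirichlet_series_map_def H by (auto simp: analytic_imp_holomorphic)
  have fc: "continuous_on ?H f" by (rule holomorphic_on_imp_continuous_on[OF fh])
  obtain C \<kappa> where dec: "\<And>s. Re s \<ge> \<kappa> \<Longrightarrow> cmod (f s - a 1) \<le> C * 2 powr (- Re s)"
    using dirichlet_series_decay[OF assms] by blast
  \<comment> \<open>\<open>a 1\<close> is a limit of values of \<open>f\<close> along the positive
    reals, so this argument places it in the closed disc; that suffices for the denominators since
    \<open>cmod \<xi> < 1\<close>.\<close>
  have a1: "cmod (a 1) \<le> 1"
  proof -
    have p0: "((\<lambda>x::real. 2 powr (- x)) \<longlongrightarrow> 0) at_top" by real_asymp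
    have "((\<lambda>x. 1 + C * 2 powr (- x)) \<longlongrightarrow> 1 + C * 0) at_top" by (intro tendsto_intros p0)
    moreover have "eventually (\<lambda>x. cmod (a 1) \<le> 1 + C * 2 powr (- x)) at_top"
      using eventually_gt_at_top[of "max 0 \<kappa>"]
    proof eventually_elim
      case (elim x)
      have "cmod (a 1) \<le> cmod (f (of_real x)) + cmod (f (of_real x) - a 1)"
        using norm_triangle_ineq4[of "f (of_real x)" "f (of_real x) - a 1"] by simp
      also have "\<dots> \<le> 1 + C * 2 powr (- x)"
        using f1[of "of_real x"] dec[of "of_real x"] elim by (intro add_mono) auto
      finally show ?case .
    qed
    ultimately have "cmod (a 1) \<le> 1 + C * 0" by (rule tendsto_lowerbound) simp
    then show ?thesis by simp
  qed
  define \<sigma> :: "nat \<Rightarrow> real" where "\<sigma> n = inverse (real (Suc n))" for n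
  have \<sigma>: "\<sigma> n > 0" "\<sigma> \<longlonglongrightarrow> 0" for n unfolding \<sigma>_def by (simp, rule LIMSEQ_inverse_real_of_nat)
  have \<sigma>r: "filterlim \<sigma> (at_right 0) sequentially"
    using \<sigma> unfolding filterlim_at by (auto simp: less_imp_neq[symmetric] intro!: always_eventually)
  \<comment> \<open>Where the radial limit does not exist, \<open>boundary_value\<close> is an unspecified complex number.\<close>
  define \<phi>0 where "\<phi>0 \<tau> = (if cmod (boundary_value f \<tau>) \<le> 1 then boundary_value f \<tau> else 0)" for \<tau>
  have bvm [measurable]: "boundary_value f \<in> borel_measurable borel" by (rule boundary_value_measurable(2)[OF fc])
  have \<phi>0m [measurable]: "\<phi>0 \<in> borel_measurable borel" unfolding \<phi>0_def[abs_def] by measurable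
  have \<phi>01: "cmod (\<phi>0 \<tau>) \<le> 1" for \<tau> by (simp add: \<phi>0_def)
  define \<phi> where "\<phi> n \<tau> = f (Complex (\<sigma> n) \<tau>)" for n \<tau>
  have \<phi>m: "\<phi> n \<in> borel_measurable borel" for n
  proof -
    have "continuous_on UNIV (\<lambda>\<tau>. f (Complex (\<sigma> n) \<tau>))"
      by (rule continuous_on_compose2[OF fc]) (use \<sigma> in \<open>auto simp: Complex_eq intro!: continuous_intros\<close>)
    then show ?thesis unfolding \<phi>_def[abs_def] by (rule borel_measurable_continuous_onI)
  qed
  have \<phi>1: "cmod (\<phi> n \<tau>) \<le> 1" for n \<tau> unfolding \<phi>_def using \<sigma>(1)[of n] by (intro less_imp_le f1) simp
  obtain N where N: "negligible N" "\<And>\<tau>. \<tau> \<notin> N \<Longrightarrow> \<exists>l. ((\<lambda>\<sigma>. f (Complex \<sigma> \<tau>)) \<longlongrightarrow> l) (at_right 0)"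
    using Fatou_halfplane[OF fh, of 1] f1 by (auto simp: less_imp_le)
  have "AE \<tau> in lborel. \<tau> \<notin> N"
    using AE_not_in[of N lebesgue] N(1) by (simp add: negligible_iff_null_sets AE_completion_iff)
  moreover have bl: "((\<lambda>\<sigma>. f (Complex \<sigma> \<tau>)) \<longlongrightarrow> \<phi>0 \<tau>) (at_right 0)" if t: "\<tau> \<notin> N" for \<tau>
  proof -
    obtain l where l: "((\<lambda>\<sigma>. f (Complex \<sigma> \<tau>)) \<longlongrightarrow> l) (at_right 0)" using N(2)[OF t] by blast
    have "eventually (\<lambda>\<sigma>::real. \<sigma> > 0) (at_right 0)" by (simp add: eventually_at_right_less)
    then have "eventually (\<lambda>\<sigma>. cmod (f (Complex \<sigma> \<tau>)) \<le> 1) (at_right 0)"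
      by eventually_elim (simp add: f1 less_imp_le)
    then have "cmod l \<le> 1" by (rule tendsto_upperbound[OF tendsto_norm[OF l]]) simp
    then show ?thesis using l boundary_value_eq[OF l] by (simp add: \<phi>0_def)
  qed
  ultimately have AEbl: "AE \<tau> in lborel. ((\<lambda>\<sigma>. f (Complex \<sigma> \<tau>)) \<longlongrightarrow> \<phi>0 \<tau>) (at_right 0)"
    by (auto elim: eventually_mono)
  have lim: "AE \<tau> in lborel. (\<lambda>n. \<phi> n \<tau>) \<longlonglongrightarrow> \<phi>0 \<tau>"
    using AEbl unfolding \<phi>_def by eventually_elim (rule filterlim_compose[OF _ \<sigma>r])
  define E where "E = {\<xi> \<in> ball 0 1. \<not> (liminf (\<lambda>n. \<integral>\<^sup>+ \<tau>. green_disc \<xi> (\<phi> n \<tau>) \<partial>arctan_measure) \<le> (\<integral>\<^sup>+ \<tau>. green_disc \<xi> (\<phi>0 \<tau>) \<partial>arctan_measure)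
      \<and> (\<integral>\<^sup>+ \<tau>. green_disc \<xi> (\<phi>0 \<tau>) \<partial>arctan_measure) < \<infinity>)}"
  have "polar E"
    unfolding E_def by (rule Frostman_polar[OF finite_arctan_measure sets_arctan_measure \<phi>m \<phi>0m \<phi>1 \<phi>01]) (simp add: AE_arctan_measure lim)
  moreover have "((\<lambda>T. \<bar>N_count f \<xi> T
             - 1 / (2 * T) * (LINT \<tau>:{-T..T}|lborel. ln (cmod (boundary_value (frostman f \<xi>) \<tau>)))
             - ln (cmod ((1 - cnj \<xi> * a 1) / (\<xi> - a 1)))\<bar>) \<longlongrightarrow> 0) at_top"
    if \<xi>: "\<xi> \<in> ball 0 1 - {a 1} - E" for \<xi>
  proof -
    have x1: "cmod \<xi> < 1" and xa: "\<xi> \<noteq> a 1" using \<xi> by auto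
    have g1: "liminf (\<lambda>n. \<integral>\<^sup>+ \<tau>. green_disc \<xi> (\<phi> n \<tau>) \<partial>arctan_measure) \<le> (\<integral>\<^sup>+ \<tau>. green_disc \<xi> (\<phi>0 \<tau>) \<partial>arctan_measure)"
      and g2: "(\<integral>\<^sup>+ \<tau>. green_disc \<xi> (\<phi>0 \<tau>) \<partial>arctan_measure) < \<infinity>"
      using \<xi> unfolding E_def by auto
    define F where "F = frostman f \<xi>"
    define L where "L = (\<xi> - a 1) / (1 - cnj \<xi> * a 1)"
    have den: "1 - cnj \<xi> * f s \<noteq> 0" if "Re s > 0" for s by (rule frostman_denominator_nonzero[OF x1 less_imp_le[OF f1[OF that]]])
    have dena: "1 - cnj \<xi> * a 1 \<noteq> 0" by (rule frostman_denominator_nonzero[OF x1 a1])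
    have Fh: "F holomorphic_on ?H" unfolding F_def frostman_def using den by (intro holomorphic_intros fh) auto
    have F1: "cmod (F s) \<le> 1" if "Re s > 0" for s unfolding F_def frostman_def by (rule norm_frostman_le_one[OF x1 less_imp_le[OF f1[OF that]]])
    \<comment> \<open>A lower bound for both Frostman denominators, uniform in \<open>s\<close>; its
      square is in the decay constant of the shift.\<close>
    have dl: "1 - cmod \<xi> \<le> cmod (1 - cnj \<xi> * w)" if "cmod w \<le> 1" for w
    proof -
      have "cmod (cnj \<xi> * w) \<le> cmod \<xi>" using that by (simp add: norm_mult mult_left_le)
      moreover have "cmod (1::complex) - cmod (cnj \<xi> * w) \<le> cmod (1 - cnj \<xi> * w)" by (rule norm_triangle_ineq2)
      ultimately show ?thesis by simp
    qed
    have Fdec: "cmod (F s - L) \<le> (2 * \<bar>C\<bar> / (1 - cmod \<xi>)\<^sup>2) * 2 powr (- Re s)" if s: "Re s \<ge> max \<kappa> 1" for s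
    proof -
      have s0: "Re s > 0" "Re s \<ge> \<kappa>" using s by auto
      \<comment> \<open>The difference of two values of one Moebius map; the factor
        \<open>cnj \<xi> * \<xi> - 1\<close> is its determinant.\<close>
      have "F s - L = (f s - a 1) * (cnj \<xi> * \<xi> - 1) / ((1 - cnj \<xi> * f s) * (1 - cnj \<xi> * a 1))"
        unfolding F_def L_def frostman_def using den[OF s0(1)] dena by (simp add: diff_frac_eq) (simp add: algebra_simps)
      then have "cmod (F s - L) = cmod (f s - a 1) * cmod (cnj \<xi> * \<xi> - 1) / (cmod (1 - cnj \<xi> * f s) * cmod (1 - cnj \<xi> * a 1))"
        by (simp add: norm_divide norm_mult)
      also have "\<dots> \<le> (\<bar>C\<bar> * 2 powr (- Re s)) * 2 / ((1 - cmod \<xi>) * (1 - cmod \<xi>))"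
      proof (rule frac_le)
        have "cmod (f s - a 1) \<le> \<bar>C\<bar> * 2 powr (- Re s)"
          by (rule order_trans[OF dec[OF s0(2)]]) (simp add: mult_right_mono)
        moreover have "cmod (cnj \<xi> * \<xi> - 1) \<le> 2"
        proof -
          have "cmod (cnj \<xi> * \<xi> - 1) \<le> cmod (cnj \<xi> * \<xi>) + cmod (1::complex)" by (rule norm_triangle_ineq4)
          also have "\<dots> \<le> 1 * 1 + 1" using x1 unfolding norm_mult by (intro add_mono mult_mono) auto
          finally show ?thesis by simp
        qed
        ultimately show "cmod (f s - a 1) * cmod (cnj \<xi> * \<xi> - 1) \<le> (\<bar>C\<bar> * 2 powr (- Re s)) * 2" by (intro mult_mono) auto
        show "(1 - cmod \<xi>) * (1 - cmod \<xi>) \<le> cmod (1 - cnj \<xi> * f s) * cmod (1 - cnj \<xi> * a 1)"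
          using x1 by (intro mult_mono dl a1 less_imp_le[OF f1[OF s0(1)]]) auto
      qed (use x1 in auto)
      finally show ?thesis by (simp add: power2_eq_square mult_ac)
    qed
    have L0: "L \<noteq> 0" using xa dena by (simp add: L_def)
    interpret halfplane_selfmap F L "2 * \<bar>C\<bar> / (1 - cmod \<xi>)\<^sup>2" "max \<kappa> 1"
      by unfold_locales (fact Fh, fact F1, fact L0, fact Fdec)
    define F0 where "F0 \<tau> = (\<xi> - \<phi>0 \<tau>) / (1 - cnj \<xi> * \<phi>0 \<tau>)" for \<tau>
    have F0m [measurable]: "F0 \<in> borel_measurable borel" unfolding F0_def[abs_def] by measurable
    have F01: "cmod (F0 \<tau>) \<le> 1" for \<tau> unfolding F0_def by (rule norm_frostman_le_one[OF x1 \<phi>01])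
    have den0: "1 - cnj \<xi> * \<phi>0 \<tau> \<noteq> 0" for \<tau> by (rule frostman_denominator_nonzero[OF x1 \<phi>01])
    have Fb: "((\<lambda>\<sigma>. F (Complex \<sigma> \<tau>)) \<longlongrightarrow> F0 \<tau>) (at_right 0)" if "((\<lambda>\<sigma>. f (Complex \<sigma> \<tau>)) \<longlongrightarrow> \<phi>0 \<tau>) (at_right 0)" for \<tau>
      unfolding F_def frostman_def F0_def using den0 by (intro tendsto_intros that) auto
    have Flim: "AE \<tau> in lborel. (\<lambda>n. F (Complex (\<sigma> n) \<tau>)) \<longlonglongrightarrow> F0 \<tau>"
      using AEbl by eventually_elim (rule filterlim_compose[OF Fb \<sigma>r])
    have "liminf (\<lambda>n. \<integral>\<^sup>+ \<tau>. nlog (cmod (F (Complex (\<sigma> n) \<tau>))) \<partial>arctan_measure) \<le> (\<integral>\<^sup>+ \<tau>. nlog (cmod (F0 \<tau>)) \<partial>arctan_measure)"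
      "(\<integral>\<^sup>+ \<tau>. nlog (cmod (F0 \<tau>)) \<partial>arctan_measure) < \<infinity>"
      using g1 g2 unfolding green_disc_def F_def frostman_def F0_def \<phi>_def by auto
    from boundary_convergence[OF \<sigma>(1) F0m F01 Flim this]
    obtain r where r: "strict_mono r" "\<And>R. set_integrable lborel {-R..R} (\<lambda>\<tau>. - ln (cmod (F0 \<tau>)))"
      "\<And>T B. T \<ge> 0 \<Longrightarrow> window T B \<Longrightarrow>
      (\<lambda>n. LINT y:{- (T + 3)..T + 3}|lborel. u (\<sigma> (r n)) y * B y) \<longlonglongrightarrow> (LINT y:{- (T + 3)..T + 3}|lborel. - ln (cmod (F0 y)) * B y)"
      by blast
    have \<sigma>r0: "(\<lambda>n. \<sigma> (r n)) \<longlonglongrightarrow> 0" using LIMSEQ_subseq_LIMSEQ[OF \<sigma>(2) r(1)] by (simp add: o_def)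
    have u00: "0 \<le> - ln (cmod (F0 y))" for y using F01[of y] by (cases "F0 y = 0") auto
    from counting_limit[OF \<sigma>(1) \<sigma>r0 u00 r(2,3)]
    have cl: "((\<lambda>T. pi / T * (\<Sum>\<^sub>\<infinity>s\<in>{s. Re s > 0 \<and> \<bar>Im s\<bar> < T \<and> F s = 0}. real_of_int (zorder F s) * Re s)
     + 1 / (2 * T) * (LINT y:{-T..T}|lborel. - ln (cmod (F0 y)))) \<longlongrightarrow> - ln (cmod L)) at_top" .
    have F_zero: "F s = 0 \<longleftrightarrow> f s = \<xi>" if "Re s > 0" for s
      using den[OF that] by (auto simp: F_def frostman_def)
    have zo: "zorder (\<lambda>z. f z - \<xi>) s = zorder F s" if s: "Re s > 0" for s
    proof -
      let ?g = "\<lambda>z. - inverse (1 - cnj \<xi> * f z)"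
      have op: "open ?H" by (rule open_halfspace_Re_gt)
      have gh: "?g holomorphic_on ?H" using den by (intro holomorphic_intros fh) auto
      have fsh: "(\<lambda>z. f z - \<xi>) holomorphic_on ?H" by (intro holomorphic_intros fh)
      have ana: "(\<lambda>z. f z - \<xi>) analytic_on {s}" "?g analytic_on {s}"
        using fsh gh op s by (auto simp: analytic_at)
      \<comment> \<open>\<open>F\<close> is \<open>f - \<xi>\<close> times a factor that does not
        vanish in the half-plane, so the orders agree. The equation holds at every \<open>z\<close>,
        since division by 0 and \<open>inverse 0\<close> are both 0.\<close>
      have Feq: "F = (\<lambda>z. (f z - \<xi>) * ?g z)"
        unfolding F_def frostman_def by (rule ext) (simp add: divide_inverse algebra_simps)
      have "?g s \<noteq> 0" using den[OF s] by simp
      then have "zorder ?g s = 0" by (rule zorder_eq_0I[OF ana(2)])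
      moreover have "eventually (\<lambda>z. (f z - \<xi>) * ?g z \<noteq> 0) (at s)"
        using eventually_nonzero[OF s] unfolding Feq .
      ultimately show ?thesis unfolding Feq by (subst zorder_times_analytic[OF ana]) auto
    qed
    have Ncount: "N_count f \<xi> T = pi / T * (\<Sum>\<^sub>\<infinity>s\<in>{s. Re s > 0 \<and> \<bar>Im s\<bar> < T \<and> F s = 0}. real_of_int (zorder F s) * Re s)" for T
    proof -
      have "{s. Re s > 0 \<and> \<bar>Im s\<bar> < T \<and> f s = \<xi>} = {s. Re s > 0 \<and> \<bar>Im s\<bar> < T \<and> F s = 0}" using F_zero by auto
      moreover have "(\<Sum>\<^sub>\<infinity>s\<in>{s. Re s > 0 \<and> \<bar>Im s\<bar> < T \<and> F s = 0}. real_of_int (zorder (\<lambda>z. f z - \<xi>) s) * Re s) =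
         (\<Sum>\<^sub>\<infinity>s\<in>{s. Re s > 0 \<and> \<bar>Im s\<bar> < T \<and> F s = 0}. real_of_int (zorder F s) * Re s)"
        by (rule infsum_cong) (use zo in auto)
      ultimately show ?thesis unfolding N_count_def by (simp only:)
    qed
    \<comment> \<open>\<open>F0\<close> and the boundary value of \<open>F\<close> agree only almost
      everywhere: \<open>\<phi>0\<close> has been altered at points without radial limit. The
      integral does not notice this.\<close>
    have bint: "(LINT \<tau>:{-T..T}|lborel. ln (cmod (boundary_value (frostman f \<xi>) \<tau>))) = - (LINT y:{-T..T}|lborel. - ln (cmod (F0 y)))" for T
    proof -
      have [measurable]: "boundary_value F \<in> borel_measurable borel"
        by (rule boundary_value_measurable(2)[OF holomorphic_on_imp_continuous_on[OF Fh]])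
      have "AE \<tau> in lborel. boundary_value F \<tau> = F0 \<tau>"
        using AEbl by eventually_elim (rule boundary_value_eq[OF Fb])
      then have "(LINT \<tau>:{-T..T}|lborel. ln (cmod (boundary_value F \<tau>))) = (LINT y:{-T..T}|lborel. ln (cmod (F0 y)))"
        by (intro set_lebesgue_integral_cong_AE) (auto elim: eventually_mono)
      then show ?thesis unfolding F_def by (simp add: set_lebesgue_integral_def)
    qed
    have lnL: "ln (cmod ((1 - cnj \<xi> * a 1) / (\<xi> - a 1))) = - ln (cmod L)"
    proof -
      have "(1 - cnj \<xi> * a 1) / (\<xi> - a 1) = inverse L" by (simp add: L_def)
      then show ?thesis using L0 by (simp add: norm_inverse ln_inverse)
    qed
    from tendsto_rabs[OF tendsto_diff[OF cl tendsto_const[of "- ln (cmod L)"]]]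
    show ?thesis unfolding Ncount bint lnL by (simp only: mult_minus_right diff_minus_eq_add diff_self abs_zero)
  qed
  ultimately show ?thesis by blast
qed

end
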